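(* Let $G$ be a finite connected simple bipartite graph on the vertex set $[d]$ with edge set $\{e_1,\dots,e_n\}$. Let $\rho(\{i,j\})=\mathbf e_i+\mathbf e_j\in\mathbb R^d$, $\mathcal P_{A_G}=\mathrm{conv}(\{\rho(e_1),\dots,\rho(e_n)\})$ and $\mathcal P_{(A_G)_0}=\mathrm{conv}(\{\rho(e_1),\dots,\rho(e_n),\mathbf 0\})$. Then: (1) $\mathcal P_{(A_G)_0}*(-\mathcal P_{(A_G)_0})$ is Gorenstein of index $2$ and has a regular unimodular triangulation; (2) $\mathcal P_{(A_G)_0}+(-\mathcal P_{(A_G)_0})$ is reflexive and has a regular unimodular triangulation; in particular $\mathcal P_{(A_G)_0}+(-\mathcal P_{(A_G)_0})$ is a nef-partition; (3) $(\mathcal P_{(A_G)_0}\cap\mathbb Z^d)+(-\mathcal P_{(A_G)_0}\cap\mathbb Z^d)=(\mathcal P_{(A_G)_0}+(-\mathcal P_{(A_G)_0}))\cap\mathbb Z^d$; (4) $h^*(\mathcal P_{(A_G)_0}*(-\mathcal P_{(A_G)_0}),t)=(1+t)\,h^*(\mathcal P_{A_G}*(-\mathcal P_{A_G}),t)$.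
   Context: $-\mathcal P=\{-\mathbf a:\mathbf a\in\mathcal P\}$ and $+$ is Minkowski sum. Two lattice polytopes are unimodularly equivalent if there is an affine map between their affine spans mapping the lattice points of one affine span bijectively onto those of the other and one polytope onto the other; properties below are meant up to this equivalence (every lattice polytope is equivalent to a full-dimensional one). A full-dimensional lattice polytope is reflexive if the origin is in its interior and its dual $\{\mathbf x:\langle\mathbf x,\mathbf y\rangle\le1\ \forall\mathbf y\in\mathcal P\}$ is a lattice polytope; $\mathcal P$ is Gorenstein of index $r$ if $r\mathcal P$ is unimodularly equivalent to a reflexive polytope. The Cayley sum is $\mathcal P_1*\mathcal P_2=\mathrm{conv}(\{1\}\times\mathcal P_1\cup\{0\}\times\mathcal P_2)$. A triangulation is unimodular if all its maximal simplices are unimodularly equivalent to the standard simplex. A nef-partition is a decomposition $\mathcal P=\mathcal P_1+\cdots+\mathcal P_r$ of a reflexive polytope into a Minkowski sum of lattice polytopes each containing the origin. For a lattice polytope $\mathcal P$ of dimension $e$ (regarded as full-dimensional in $\mathbb R^e$ after unimodular equivalence), $h^*(\mathcal P,t)$ is defined by $1+\sum_{k\ge1}|k\mathcal P\cap\mathbb Z^e|t^k=h^*(\mathcal P,t)/(1-t)^{e+1}$. *)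

theory Defs
  imports "HOL-Analysis.Analysis" "HOL-Computational_Algebra.Formal_Power_Series"
begin

section \<open>Lattice polytopes and unimodular equivalence\<close>

definition integer_points :: "'a::euclidean_space set" where
  "integer_points = {x. \<forall>b\<in>Basis. x \<bullet> b \<in> \<int>}"

definition lattice_polytope :: "'a::euclidean_space set \<Rightarrow> bool" where
  "lattice_polytope P \<longleftrightarrow>
     (\<exists>V. finite V \<and> V \<noteq> {} \<and> V \<subseteq> integer_points \<and> P = convex hull V)"

text \<open>An affine map between affine spans is the restriction of an affine map \<open>x \<mapsto> c + L x\<close> of the
  ambient spaces. For lattice polytopes its bijectivity on the spans is automatic, since an affine
  span is affinely spanned by its lattice points.\<close>

definition unimodular_map ::
  "('a::euclidean_space \<Rightarrow> 'b::euclidean_space) \<Rightarrow> 'a set \<Rightarrow> 'b set \<Rightarrow> bool" where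
  "unimodular_map f P Q \<longleftrightarrow>
     (\<exists>L c. linear L \<and> f = (\<lambda>x. c + L x)) \<and>
     bij_betw f (affine hull P) (affine hull Q) \<and>
     bij_betw f (affine hull P \<inter> integer_points) (affine hull Q \<inter> integer_points) \<and>
     f ` P = Q"

definition unimodularly_equivalent :: "'a::euclidean_space set \<Rightarrow> 'b::euclidean_space set \<Rightarrow> bool" where
  "unimodularly_equivalent P Q \<longleftrightarrow> (\<exists>f. unimodular_map f P Q)"

section \<open>Reflexive and Gorenstein polytopes, nef-partitions\<close>

text \<open>Since dimensions are types, \<open>\<real>\<^sup>e\<close> with its lattice \<open>\<int>\<^sup>e\<close> is represented, for every
  \<open>e \<le> DIM('a)\<close>, by the coordinate subspace \<open>span B\<close> with \<open>B \<subseteq> Basis\<close> and \<open>card B = e\<close>. Thus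
  \<open>reflexive_in B Q\<close> says that \<open>Q\<close> is a full-dimensional reflexive polytope in \<open>\<real>\<^sup>B\<close>; the
  interior in \<open>\<real>\<^sup>B\<close> is then the relative interior, and the dual is taken inside \<open>\<real>\<^sup>B\<close>.\<close>

definition reflexive_in :: "'a::euclidean_space set \<Rightarrow> 'a set \<Rightarrow> bool" where
  "reflexive_in B Q \<longleftrightarrow>
     B \<subseteq> Basis \<and> lattice_polytope Q \<and> affine hull Q = span B \<and>
     0 \<in> rel_interior Q \<and>
     lattice_polytope {x \<in> span B. \<forall>y\<in>Q. x \<bullet> y \<le> 1}"

text \<open>Reflexivity up to unimodular equivalence, for polytopes that need not be full-dimensional.\<close>

definition reflexive :: "'a::euclidean_space set \<Rightarrow> bool" where
  "reflexive P \<longleftrightarrow>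
     lattice_polytope P \<and> (\<exists>B (Q :: 'a set). reflexive_in B Q \<and> unimodularly_equivalent P Q)"

definition gorenstein_of_index :: "nat \<Rightarrow> 'a::euclidean_space set \<Rightarrow> bool" where
  "gorenstein_of_index r P \<longleftrightarrow>
     r \<ge> 1 \<and> lattice_polytope P \<and> reflexive ((\<lambda>x. real r *\<^sub>R x) ` P)"

definition nef_partition_in ::
  "'a::euclidean_space set \<Rightarrow> 'a set \<Rightarrow> 'a set list \<Rightarrow> bool" where
  "nef_partition_in B P Ps \<longleftrightarrow>
     reflexive_in B P \<and> Ps \<noteq> [] \<and> P = sum_list Ps \<and>
     (\<forall>Q\<in>set Ps. lattice_polytope Q \<and> 0 \<in> Q)"

text \<open>For nef-partitions the equivalence with a full-dimensional polytope has to act on the summands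
  as well and to preserve the origin, so it is required to be linear.\<close>

definition nef_partition :: "'a::euclidean_space set \<Rightarrow> 'a set list \<Rightarrow> bool" where
  "nef_partition P Ps \<longleftrightarrow>
     P = sum_list Ps \<and> (\<forall>Q\<in>set Ps. lattice_polytope Q \<and> 0 \<in> Q) \<and>
     (\<exists>B. \<exists>f :: 'a \<Rightarrow> 'a. linear f \<and> unimodular_map f P (f ` P) \<and>
        nef_partition_in B (f ` P) (map ((`) f) Ps))"

definition cayley_sum :: "'a::euclidean_space set \<Rightarrow> 'a set \<Rightarrow> (real \<times> 'a) set" where
  "cayley_sum P1 P2 = convex hull ({1} \<times> P1 \<union> {0} \<times> P2)"

section \<open>Regular unimodular triangulations\<close>

definition lattice_triangulation :: "'a::euclidean_space set \<Rightarrow> 'a set set \<Rightarrow> bool" where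
  "lattice_triangulation P T \<longleftrightarrow>
     simplicial_complex T \<and> \<Union>T = P \<and>
     (\<forall>S\<in>T. \<forall>v. v extreme_point_of S \<longrightarrow> v \<in> integer_points)"

text \<open>\<open>convex hull (insert 0 B)\<close> is the standard simplex of \<open>\<real>\<^sup>B\<close>.\<close>

definition unimodular_triangulation :: "'a::euclidean_space set set \<Rightarrow> bool" where
  "unimodular_triangulation T \<longleftrightarrow>
     (\<forall>S\<in>T. (\<forall>S'\<in>T. S \<subseteq> S' \<longrightarrow> S' = S) \<longrightarrow>
        (\<exists>B\<subseteq>Basis. unimodularly_equivalent S (convex hull (insert 0 B) :: 'a set)))"

definition lifted_polytope :: "('a::euclidean_space \<Rightarrow> real) \<Rightarrow> 'a set \<Rightarrow> ('a \<times> real) set" where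
  "lifted_polytope w P = convex hull ((\<lambda>a. (a, w a)) ` (P \<inter> integer_points))"

text \<open>The face of \<open>L\<close> minimizing the functional \<open>(x, h) \<mapsto> c \<bullet> x + h\<close>; as the last coordinate of the
  functional is positive, these are exactly the lower faces.\<close>

definition lower_face :: "'a::euclidean_space \<Rightarrow> ('a \<times> real) set \<Rightarrow> ('a \<times> real) set" where
  "lower_face c L = {p\<in>L. \<forall>q\<in>L. c \<bullet> fst p + snd p \<le> c \<bullet> fst q + snd q}"

text \<open>A simplicial complex contains the empty simplex, which is not of the form of a lower face.\<close>

definition regular_triangulation :: "'a::euclidean_space set \<Rightarrow> 'a set set \<Rightarrow> bool" where
  "regular_triangulation P T \<longleftrightarrow>
     (\<exists>w. T - {{}} = {fst ` lower_face c (lifted_polytope w P) | c. True})"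

definition has_regular_unimodular_triangulation :: "'a::euclidean_space set \<Rightarrow> bool" where
  "has_regular_unimodular_triangulation P \<longleftrightarrow>
     (\<exists>T. lattice_triangulation P T \<and> unimodular_triangulation T \<and> regular_triangulation P T)"

section \<open>The \<open>h\<^sup>*\<close>-polynomial\<close>

definition ehrhart_series :: "'a::euclidean_space set \<Rightarrow> int fps" where
  "ehrhart_series P = Abs_fps (\<lambda>k. if k = 0 then 1
     else int (card ((\<lambda>x. real k *\<^sub>R x) ` P \<inter> integer_points)))"

text \<open>Lattice points are counted in the ambient lattice; by \<open>hstar_unimodularly_equivalent\<close> below this
  agrees with the count for any full-dimensional polytope equivalent to \<open>P\<close>.\<close>

definition hstar :: "'a::euclidean_space set \<Rightarrow> int fps" where
  "hstar P = (1 - fps_X) ^ (nat (aff_dim P) + 1) * ehrhart_series P"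

lemma integer_points_diff: "x \<in> integer_points \<Longrightarrow> y \<in> integer_points \<Longrightarrow> x - y \<in> integer_points"
  by (simp add: integer_points_def inner_diff_left)

lemma integer_points_add: "x \<in> integer_points \<Longrightarrow> y \<in> integer_points \<Longrightarrow> x + y \<in> integer_points"
  by (simp add: integer_points_def inner_add_left)

lemma integer_points_scale: "x \<in> integer_points \<Longrightarrow> real k *\<^sub>R x \<in> integer_points"
  by (simp add: integer_points_def)

lemma unimodular_map_aff_dim:
  assumes "unimodular_map f P Q"
  shows "aff_dim Q \<le> aff_dim P"
proof -
  obtain L c where "linear L" and f: "f = (\<lambda>x. c + L x)" and "f ` P = Q"
    using assms unfolding unimodular_map_def by blast
  then have "Q = (+) c ` (L ` P)" by auto
  then show ?thesis
    using aff_dim_linear_image_le[OF \<open>linear L\<close>] by (metis aff_dim_translation_eq)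
qed

lemma affine_hull_shift:
  assumes "p \<in> affine hull P" "x \<in> affine hull P" "y \<in> affine hull P"
  shows "p + r *\<^sub>R (x - y) \<in> affine hull P"
proof -
  have "affine (affine hull P)" by simp
  from mem_affine_3_minus[OF this assms(1,2,3)] show ?thesis .
qed

lemma unimodular_map_inverse:
  assumes u: "unimodular_map f P Q" and ne: "P \<noteq> {}"
  shows "\<exists>g. unimodular_map g Q P"
proof -
  obtain L c where L: "linear L" and f: "f = (\<lambda>x. c + L x)"
    and b: "bij_betw f (affine hull P) (affine hull Q)"
    and bi: "bij_betw f (affine hull P \<inter> integer_points) (affine hull Q \<inter> integer_points)"
    and im: "f ` P = Q"
    using u unfolding unimodular_map_def by blast
  obtain p where p: "p \<in> P" using ne by blast
  then have ph: "p \<in> affine hull P" by (simp add: hull_inc)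
  define D where "D = (\<lambda>x. x - p) ` (affine hull P)"
  have subD: "subspace D"
    unfolding D_def using ph by (simp add: affine_diffs_subspace_subtract)
  have injD: "inj_on L D"
  proof (rule inj_onI)
    fix u v assume "u \<in> D" "v \<in> D" and e: "L u = L v"
    then obtain x y where x: "x \<in> affine hull P" "u = x - p" and y: "y \<in> affine hull P" "v = y - p"
      unfolding D_def by blast
    then have "f x = f y" using e L by (simp add: f linear_diff)
    then show "u = v" using b x y unfolding bij_betw_def inj_on_def by blast
  qed
  have "inj_on L (span D)" using subD injD by (simp add: span_eq_iff[THEN iffD2])
  then obtain g where g: "linear g" "\<And>v. v \<in> D \<Longrightarrow> g (L v) = v"
    using linear_exists_left_inverse_on[OF L subD injD] by blast
  define h where "h = (\<lambda>y. (p - g (f p)) + g y)"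
  have hf: "h (f x) = x" if "x \<in> affine hull P" for x
  proof -
    have "x - p \<in> D" using that unfolding D_def by blast
    have "h (f x) = p + g (f x - f p)" using g(1) by (simp add: h_def linear_diff)
    also have "f x - f p = L (x - p)" using L by (simp add: f linear_diff)
    finally show ?thesis using g(2)[OF \<open>x - p \<in> D\<close>] by simp
  qed
  have inv: "bij_betw h (f ` A) A" if "A \<subseteq> affine hull P" for A
    using that hf by (intro bij_betw_byWitness[where f' = f]) (auto simp: subset_iff)
  have "bij_betw h (affine hull Q) (affine hull P)"
    using inv[of "affine hull P"] b by (simp add: bij_betw_def)
  moreover have "bij_betw h (affine hull Q \<inter> integer_points) (affine hull P \<inter> integer_points)"
    using inv[of "affine hull P \<inter> integer_points"] bi by (simp add: bij_betw_def)
  moreover have "h ` Q = P"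
    using inv[of P] im by (simp add: bij_betw_def hull_subset)
  ultimately show ?thesis
    unfolding unimodular_map_def h_def using g(1) by blast
qed

lemma unimodular_map_card_le:
  assumes u: "unimodular_map f P Q" and P: "lattice_polytope P"
    and fin: "finite ((\<lambda>x. real k *\<^sub>R x) ` Q \<inter> integer_points)" and k: "k > 0"
  shows "card ((\<lambda>x. real k *\<^sub>R x) ` P \<inter> integer_points)
           \<le> card ((\<lambda>x. real k *\<^sub>R x) ` Q \<inter> integer_points)"
proof -
  obtain L c where L: "linear L" and f: "f = (\<lambda>x. c + L x)"
    and b: "bij_betw f (affine hull P) (affine hull Q)"
    and bi: "bij_betw f (affine hull P \<inter> integer_points) (affine hull Q \<inter> integer_points)"
    and im: "f ` P = Q"
    using u unfolding unimodular_map_def by blast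
  obtain p where p: "p \<in> P" "p \<in> integer_points"
    using P unfolding lattice_polytope_def using hull_subset by (metis all_not_in_conv subsetD)
  then have ph: "p \<in> affine hull P" by (simp add: hull_inc)
  have fp: "f p \<in> integer_points" using bi ph p unfolding bij_betw_def by blast
  define F where "F = (\<lambda>x. real k *\<^sub>R c + L x)"
  have Fk: "F (real k *\<^sub>R x) = real k *\<^sub>R f x" for x
    using L by (simp add: F_def f linear_scale scaleR_add_right)
  have "inj_on F ((\<lambda>x. real k *\<^sub>R x) ` P \<inter> integer_points)"
  proof (rule inj_onI; clarify)
    fix x y assume xy: "x \<in> P" "y \<in> P" and "F (real k *\<^sub>R x) = F (real k *\<^sub>R y)"
    then have "f x = f y" using k by (simp add: Fk)
    then have "x = y" using b xy hull_inc unfolding bij_betw_def inj_on_def by metis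
    then show "real k *\<^sub>R x = real k *\<^sub>R y" by simp
  qed
  moreover have "F ` ((\<lambda>x. real k *\<^sub>R x) ` P \<inter> integer_points)
      \<subseteq> (\<lambda>x. real k *\<^sub>R x) ` Q \<inter> integer_points"
  proof clarify
    fix x assume x: "x \<in> P" "real k *\<^sub>R x \<in> integer_points"
    let ?z = "p + real k *\<^sub>R (x - p)"
    have "?z \<in> affine hull P" using affine_hull_shift[OF ph hull_inc[OF x(1)] ph] .
    moreover have "?z = p + (real k *\<^sub>R x - real k *\<^sub>R p)" by (simp add: scaleR_diff_right)
    then have "?z \<in> integer_points"
      using p x by (metis integer_points_add integer_points_diff integer_points_scale)
    ultimately have "f ?z \<in> integer_points" using bi unfolding bij_betw_def by blast
    moreover have "F (real k *\<^sub>R x) = f ?z + (real k *\<^sub>R f p - f p)"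
      using L by (simp add: F_def f linear_add linear_diff linear_scale algebra_simps)
    ultimately have "F (real k *\<^sub>R x) \<in> integer_points"
      using fp by (metis integer_points_add integer_points_diff integer_points_scale)
    then show "F (real k *\<^sub>R x) \<in> (\<lambda>x. real k *\<^sub>R x) ` Q \<inter> integer_points"
      using x im by (auto simp: Fk)
  qed
  ultimately show ?thesis using fin by (rule card_inj_on_le)
qed

lemma finite_integer_points_bounded:
  fixes S :: "'a::euclidean_space set"
  assumes "bounded S"
  shows "finite (S \<inter> integer_points)"
proof -
  obtain M where M: "\<And>x. x \<in> S \<Longrightarrow> norm x \<le> M" using assms bounded_iff by blast
  define R where "R = {r\<in>\<int>. \<bar>r\<bar> \<le> M}"
  have "R \<subseteq> real_of_int ` {-\<lfloor>M\<rfloor>..\<lfloor>M\<rfloor>}"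
  proof
    fix r assume "r \<in> R"
    then obtain i where i: "r = real_of_int i" "\<bar>real_of_int i\<bar> \<le> M"
      unfolding R_def by (auto elim: Ints_cases)
    then have "\<bar>i\<bar> \<le> \<lfloor>M\<rfloor>" by (simp add: le_floor_iff)
    then show "r \<in> real_of_int ` {-\<lfloor>M\<rfloor>..\<lfloor>M\<rfloor>}"
      using i(1) by (intro image_eqI[where x = i]) (auto simp: abs_le_iff)
  qed
  then have "finite R" by (rule finite_subset) simp
  then have fP: "finite (PiE (Basis::'a set) (\<lambda>_. R))" by (intro finite_PiE) auto
  let ?c = "\<lambda>x::'a. restrict (\<lambda>b. x \<bullet> b) Basis"
  have "inj_on ?c (S \<inter> integer_points)"
  proof (rule inj_onI)
    fix x y assume "?c x = ?c y"
    then have "x \<bullet> b = y \<bullet> b" if "b \<in> Basis" for b using that by (metis restrict_apply')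
    then show "x = y" by (rule euclidean_eqI)
  qed
  moreover have "?c ` (S \<inter> integer_points) \<subseteq> PiE Basis (\<lambda>_. R)"
  proof (intro image_subsetI restrict_PiE_iff[THEN iffD2] ballI)
    fix x b assume "x \<in> S \<inter> integer_points" "b \<in> (Basis::'a set)"
    moreover from this have "\<bar>x \<bullet> b\<bar> \<le> M" using M[of x] Basis_le_norm[of b x] by simp
    ultimately show "x \<bullet> b \<in> R" by (simp add: R_def integer_points_def)
  qed
  ultimately show ?thesis using fP by (rule inj_on_finite)
qed

lemma hstar_unimodularly_equivalent:
  assumes "lattice_polytope P" "lattice_polytope Q" "unimodularly_equivalent P Q"
  shows "hstar P = hstar Q"
proof -
  obtain f where f: "unimodular_map f P Q"
    using assms(3) unfolding unimodularly_equivalent_def by blast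
  have "P \<noteq> {}" using assms(1) unfolding lattice_polytope_def by auto
  then obtain g where g: "unimodular_map g Q P" using unimodular_map_inverse[OF f] by blast
  have fin: "finite ((\<lambda>x. real k *\<^sub>R x) ` R \<inter> integer_points)"
    if R: "lattice_polytope R" for k and R :: "'c::euclidean_space set"
  proof -
    obtain V where "finite V" "R = convex hull V" using R unfolding lattice_polytope_def by blast
    then have "bounded R" by (simp add: bounded_convex_hull finite_imp_bounded)
    then show ?thesis by (intro finite_integer_points_bounded bounded_scaling)
  qed
  have "card ((\<lambda>x. real k *\<^sub>R x) ` P \<inter> integer_points)
      = card ((\<lambda>x. real k *\<^sub>R x) ` Q \<inter> integer_points)" if "k > 0" for k
    using unimodular_map_card_le[OF f assms(1) fin[OF assms(2)] that]
      unimodular_map_card_le[OF g assms(2) fin[OF assms(1)] that] by simp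
  then have "ehrhart_series P = ehrhart_series Q"
    unfolding ehrhart_series_def by (intro arg_cong[where f = Abs_fps] ext) simp
  moreover have "aff_dim P = aff_dim Q"
    using unimodular_map_aff_dim[OF f] unimodular_map_aff_dim[OF g] by simp
  ultimately show ?thesis unfolding hstar_def by simp
qed

section \<open>Bipartite graphs and their edge polytopes\<close>

text \<open>The vertex set \<open>[d]\<close> is the finite type \<open>'d\<close>; a graph is given by its set of edges.\<close>

definition simple_graph :: "'d set set \<Rightarrow> bool" where
  "simple_graph E \<longleftrightarrow> (\<forall>e\<in>E. card e = 2)"

definition connected_graph :: "'d set set \<Rightarrow> bool" where
  "connected_graph E \<longleftrightarrow> (\<forall>u v. (u, v) \<in> {(i, j). {i, j} \<in> E}\<^sup>*)"

definition bipartite_graph :: "'d set set \<Rightarrow> bool" where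
  "bipartite_graph E \<longleftrightarrow>
     (\<exists>U W. U \<inter> W = {} \<and> U \<union> W = UNIV \<and> (\<forall>e\<in>E. \<exists>i\<in>U. \<exists>j\<in>W. e = {i, j}))"

definition edge_vector :: "'d::finite set \<Rightarrow> real ^ 'd" where
  "edge_vector e = (\<Sum>i\<in>e. axis i 1)"

definition edge_polytope :: "'d::finite set set \<Rightarrow> (real ^ 'd) set" where
  "edge_polytope E = convex hull (edge_vector ` E)"

definition edge_polytope0 :: "'d::finite set set \<Rightarrow> (real ^ 'd) set" where
  "edge_polytope0 E = convex hull (insert 0 (edge_vector ` E))"

end

theory Submission
  imports Defs
begin

text \<open>A triangulation induced by a weight on the lattice points is determined by its full-dimensional
  cells, so it is unimodular as soon as every affinely spanning set of minimizers is a unimodular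
  simplex. On the Cayley sum of \<open>P\<close> and \<open>- P\<close> we take weight \<open>0\<close> at \<open>(1, 0)\<close> and \<open>(0, 0)\<close> and weight
  \<open>1\<close> elsewhere, perturbed generically. The cells are then double cones over linearly independent sets
  of edge vectors \<open>\<plusminus> \<rho> e\<close>, that is over forests, which are unimodular because an edge weight on a
  forest with integral vertex sums is integral. The Cayley trick turns this triangulation into a fine
  mixed subdivision of \<open>P - P\<close>; a generic refinement of it cuts a mixed cell into simplices that are
  again spanning forests, now of a complete bipartite graph. Since unimodular triangulations give
  integer decompositions, the lattice points of \<open>P\<close> and \<open>- P\<close> add up to those of \<open>P - P\<close>.

  The polars of \<open>P - P\<close> and of twice the Cayley sum are both integral images of one polytope given by
  difference constraints, hence are lattice polytopes. For the \<open>h\<^sup>*\<close>-polynomials, both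
  \<open>a\<^sub>k - a\<^bsub>k-1\<^esub>\<close> and \<open>b\<^sub>k + b\<^bsub>k-1\<^esub>\<close> count the points \<open>x\<close> that occur in a lattice point \<open>(t, x)\<close> of
  the \<open>k\<close>-th dilate of the Cayley sum of \<open>P\<close> and \<open>- P\<close>, where \<open>a\<^sub>k\<close> and \<open>b\<^sub>k\<close> are the Ehrhart numbers
  with and without the origin.\<close>

section \<open>Lower faces of lifted point configurations\<close>

text \<open>Regularity is built in: a weight on all lattice points gives one cell
  \<open>convex hull (minimizers w A c)\<close> for every functional \<open>c\<close>, and
  everything is read off from the sets \<open>minimizers w A c\<close>. Only coarse weights are
  written down. A small generic perturbation can only subdivide their cells, so it remains to check
  that every independent spanning subset of a coarse cell is unimodular; bipartiteness enters there.
  The edge polytopes lie in the hyperplane where both colour classes have the same coordinate sum,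
  so they are never full-dimensional. Hence cells are called spanning relative to the affine hull of
  the points, and reflexivity is proved after deleting the coordinate of one vertex. The deletion is
  invertible over the integers on the hyperplane, because the deleted coordinate has coefficient 1
  or -1 in its equation. Connectedness makes the projected edge vectors span and the polar bounded.
  Index 2 comes from the centre \<open>(1/2, 0)\<close> of the Cayley sum, which doubling turns into
  a lattice point.\<close>

definition minimizers :: "('a::euclidean_space \<Rightarrow> real) \<Rightarrow> 'a set \<Rightarrow> 'a \<Rightarrow> 'a set" where
  "minimizers w A c = {p\<in>A. \<forall>q\<in>A. c \<bullet> p + w p \<le> c \<bullet> q + w q}"

lemma minimizers_subset: "minimizers w A c \<subseteq> A"
  by (auto simp: minimizers_def)

lemma minimizers_le:
  "p \<in> minimizers w A c \<Longrightarrow> q \<in> A \<Longrightarrow> c \<bullet> p + w p \<le> c \<bullet> q + w q"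
  by (auto simp: minimizers_def)

lemma minimizers_less:
  assumes "p \<in> minimizers w A c" "q \<in> A" "q \<notin> minimizers w A c"
  shows "c \<bullet> p + w p < c \<bullet> q + w q"
  using assms by (force simp: minimizers_def)

lemma minimizers_eq:
  assumes "p \<in> minimizers w A c" "q \<in> minimizers w A c"
  shows "c \<bullet> p + w p = c \<bullet> q + w q"
  using assms by (force simp: minimizers_def)

lemma minimizers_eqI:
  assumes "p \<in> minimizers w A c" "q \<in> A" "c \<bullet> q + w q = c \<bullet> p + w p"
  shows "q \<in> minimizers w A c"
  using assms by (auto simp: minimizers_def)

lemma minimizers_level:
  assumes "p \<in> A" "c \<bullet> p + w p = m" "\<And>q. q \<in> A \<Longrightarrow> m \<le> c \<bullet> q + w q"
  shows "minimizers w A c = {q\<in>A. c \<bullet> q + w q = m}"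
proof
  show "minimizers w A c \<subseteq> {q\<in>A. c \<bullet> q + w q = m}"
  proof
    fix q assume q: "q \<in> minimizers w A c"
    then have "q \<in> A" using minimizers_subset by blast
    then show "q \<in> {q\<in>A. c \<bullet> q + w q = m}"
      using minimizers_le[OF q assms(1)] assms(2) assms(3)[of q] by simp
  qed
  show "{q\<in>A. c \<bullet> q + w q = m} \<subseteq> minimizers w A c"
    using assms(3) by (auto simp: minimizers_def)
qed

text \<open>On a cell the weight agrees with an affine function of the point. This serves both
  affine dependencies (coefficient sum 0) and affine combinations (coefficient sum 1).\<close>

lemma sum_minimizers:
  assumes "p0 \<in> minimizers w A c" "M \<subseteq> minimizers w A c"
  shows "(\<Sum>p\<in>M. \<kappa> p * w p) = sum \<kappa> M * (c \<bullet> p0 + w p0) - c \<bullet> (\<Sum>p\<in>M. \<kappa> p *\<^sub>R p)"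
proof -
  define m where "m = c \<bullet> p0 + w p0"
  have "(\<Sum>p\<in>M. \<kappa> p * w p) = (\<Sum>p\<in>M. \<kappa> p * m - \<kappa> p * (c \<bullet> p))"
  proof (intro sum.cong refl)
    fix p assume "p \<in> M"
    then have "c \<bullet> p + w p = m" unfolding m_def using assms by (intro minimizers_eq) auto
    then have "w p = m - c \<bullet> p" by linarith
    then show "\<kappa> p * w p = \<kappa> p * m - \<kappa> p * (c \<bullet> p)" by (simp add: right_diff_distrib)
  qed
  then show ?thesis by (simp add: m_def sum_subtractf sum_distrib_right inner_sum_right)
qed

lemma minimizers_nonempty:
  assumes "finite A" "A \<noteq> {}"
  shows "minimizers w A c \<noteq> {}"
proof -
  obtain p where "is_arg_min (\<lambda>p. c \<bullet> p + w p) (\<lambda>p. p \<in> A) p"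
    using ex_is_arg_min_if_finite[OF assms] by blast
  then show ?thesis by (force simp: minimizers_def is_arg_min_linorder)
qed

lemma finite_minimizers: "finite A \<Longrightarrow> finite (minimizers w A c)"
  by (rule finite_subset[OF minimizers_subset])

text \<open>The hyperplane supports the hull, so the section is a face and therefore the hull of
  some subset of \<open>S\<close>; that subset lies in the hyperplane.\<close>

lemma convex_hull_Int_hyperplane:
  fixes S :: "'a::euclidean_space set"
  assumes S: "finite S" "\<And>x. x \<in> S \<Longrightarrow> b \<le> a \<bullet> x"
  shows "convex hull S \<inter> {x. a \<bullet> x = b} = convex hull (S \<inter> {x. a \<bullet> x = b})" (is "?F = _")
proof
  have "convex hull S \<subseteq> {x. b \<le> a \<bullet> x}"
    using S(2) by (intro hull_minimal convex_halfspace_ge) auto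
  then have "?F face_of (convex hull S)"
    by (intro face_of_Int_supporting_hyperplane_ge) auto
  then obtain T where T: "T \<subseteq> S" "?F = convex hull T"
    using face_of_convex_hull_subset[OF finite_imp_compact[OF S(1)]] by metis
  have "T \<subseteq> S \<inter> {x. a \<bullet> x = b}" using T(1) hull_subset[of T convex] unfolding T(2)[symmetric] by simp
  then show "?F \<subseteq> convex hull (S \<inter> {x. a \<bullet> x = b})" unfolding T(2) by (rule hull_mono)
  show "convex hull (S \<inter> {x. a \<bullet> x = b}) \<subseteq> ?F"
    by (rule hull_minimal) (auto intro: hull_inc convex_Int convex_hyperplane)
qed

text \<open>Translates the lower faces in the definition of regularity into sets of minimizers:
  \<open>(c, 1)\<close> attains its minimum on the lift at the lifted minimizers, and hulls commute
  with the linear map \<open>fst\<close>.\<close>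

lemma lower_face_convex_hull:
  assumes A: "finite A" "A \<noteq> {}"
  shows "fst ` lower_face c (convex hull ((\<lambda>a. (a, w a)) ` A)) = convex hull (minimizers w A c)"
proof -
  let ?g = "\<lambda>a. (a, w a)" and ?M = "minimizers w A c"
  let ?L = "convex hull (?g ` A)"
  obtain p where p: "p \<in> ?M" using minimizers_nonempty[OF A] by blast
  define m where "m = c \<bullet> p + w p"
  have M: "?M = {q\<in>A. c \<bullet> q + w q = m}"
    using p by (intro minimizers_level[of p]) (auto simp: m_def minimizers_def)
  have ge: "m \<le> (c, 1) \<bullet> z" if "z \<in> ?g ` A" for z
    using p that by (auto simp: m_def minimizers_def)
  have L: "m \<le> c \<bullet> fst z + snd z" if z: "z \<in> ?L" for z
  proof -
    have "?L \<subseteq> {z. m \<le> (c, 1) \<bullet> z}" using ge by (intro hull_minimal convex_halfspace_ge) auto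
    then show ?thesis using z by (auto simp: inner_prod_def)
  qed
  have p_L: "?g p \<in> ?L" using p by (auto intro: hull_inc simp: minimizers_def)
  have "lower_face c ?L = ?L \<inter> {z. (c, 1) \<bullet> z = m}"
  proof (intro set_eqI iffI)
    fix z assume z: "z \<in> lower_face c ?L"
    then have "z \<in> ?L" "c \<bullet> fst z + snd z \<le> m" using p_L by (force simp: lower_face_def m_def)+
    then show "z \<in> ?L \<inter> {z. (c, 1) \<bullet> z = m}" using L[of z] by (simp add: inner_prod_def)
  qed (use L in \<open>auto simp: lower_face_def inner_prod_def\<close>)
  also have "\<dots> = convex hull (?g ` A \<inter> {z. (c, 1) \<bullet> z = m})"
    by (rule convex_hull_Int_hyperplane) (use A ge in auto)
  also have "?g ` A \<inter> {z. (c, 1) \<bullet> z = m} = ?g ` ?M" unfolding M by auto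
  finally have "lower_face c ?L = convex hull (?g ` ?M)" .
  moreover have "fst ` (convex hull (?g ` ?M)) = convex hull (fst ` ?g ` ?M)"
    by (rule convex_hull_linear_image) (rule linear_fst)
  ultimately show ?thesis by (simp add: image_image)
qed

section \<open>Spanning cells and how they cover the polytope\<close>

lemma affine_hull_separation:
  fixes p :: "'a::euclidean_space"
  assumes "p \<notin> affine hull M" "M \<noteq> {}"
  shows "\<exists>d k. (\<forall>q\<in>affine hull M. d \<bullet> q = k) \<and> d \<bullet> p \<noteq> k"
proof -
  obtain q0 where q0: "q0 \<in> M" using assms by blast
  define S where "S = (\<lambda>x. x - q0) ` (affine hull M)"
  have "subspace S"
    unfolding S_def using q0 by (simp add: affine_diffs_subspace_subtract hull_inc)
  \<comment> \<open>The separating functional is the component of \<open>p - q0\<close> orthogonal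
    to the direction space of the affine hull.\<close>
  obtain y z where yz: "y \<in> span S" "\<And>w. w \<in> span S \<Longrightarrow> orthogonal z w" "p - q0 = y + z"
    using orthogonal_subspace_decomp_exists[of S "p - q0"] by metis
  have "y \<in> S" using yz(1) \<open>subspace S\<close> by (simp add: span_eq_iff[THEN iffD2])
  have "z \<noteq> 0"
  proof
    assume "z = 0"
    then have "p - q0 \<in> S" using yz(3) \<open>y \<in> S\<close> by simp
    then show False using assms(1) by (auto simp: S_def)
  qed
  have "z \<bullet> q = z \<bullet> q0" if "q \<in> affine hull M" for q
  proof -
    have "q - q0 \<in> span S" using that by (auto simp: S_def intro: span_base)
    then have "z \<bullet> (q - q0) = 0" using yz(2) by (simp add: orthogonal_def)
    then show ?thesis by (simp add: inner_diff_right)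
  qed
  moreover have "z \<bullet> p \<noteq> z \<bullet> q0"
  proof -
    have "z \<bullet> (p - q0) = z \<bullet> z"
      using yz(2)[OF yz(1)] by (simp add: yz(3) orthogonal_def inner_add_right)
    moreover have "z \<bullet> z > 0" using \<open>z \<noteq> 0\<close> by simp
    ultimately have "z \<bullet> p - z \<bullet> q0 > 0" by (simp only: inner_diff_right)
    then show ?thesis by linarith
  qed
  ultimately show ?thesis by blast
qed

lemma finite_pos_lower_bound:
  assumes "finite I" "\<And>i. i \<in> I \<Longrightarrow> (0::real) < f i"
  shows "\<exists>e>0. \<forall>i\<in>I. e \<le> f i"
proof (cases "I = {}")
  case False
  then show ?thesis
    using assms by (intro exI[of _ "Min (f ` I)"]) auto
qed (auto intro: exI[of _ 1])

lemma convex_hull_exists_inner_le: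
  fixes x :: "'a::euclidean_space"
  assumes "x \<in> convex hull A"
  shows "\<exists>p\<in>A. d \<bullet> p \<le> d \<bullet> x"
proof (rule ccontr)
  assume "\<not> ?thesis"
  then have "A \<subseteq> {y. d \<bullet> x < d \<bullet> y}" by auto
  then have "convex hull A \<subseteq> {y. d \<bullet> x < d \<bullet> y}"
    by (rule hull_minimal) (rule convex_halfspace_gt)
  then show False using assms by auto
qed

text \<open>The value at \<open>x\<close> of the affine function through the lifted minimizers. As a function of \<open>c\<close> it
  is concave and piecewise linear, bounded above for \<open>x\<close> in the polytope, and its maximizers are the negated
  subgradients of the lower hull at \<open>x\<close>.\<close>

definition lower_value :: "('a::euclidean_space \<Rightarrow> real) \<Rightarrow> 'a set \<Rightarrow> 'a \<Rightarrow> 'a \<Rightarrow> real" where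
  "lower_value w A x c = Min ((\<lambda>p. c \<bullet> p + w p) ` A) - c \<bullet> x"

lemma lower_value_eq:
  assumes "finite A" "p \<in> minimizers w A c"
  shows "lower_value w A x c = c \<bullet> p + w p - c \<bullet> x"
proof -
  have "Min ((\<lambda>p. c \<bullet> p + w p) ` A) = c \<bullet> p + w p"
    using assms by (intro Min_eqI) (auto simp: minimizers_def)
  then show ?thesis by (simp add: lower_value_def)
qed

text \<open>Tilt \<open>c\<close> along a direction that is constant on the current cell until a
  further point of \<open>A\<close> comes down to the minimal level. The sign of the direction is
  chosen so that the value at \<open>x\<close> does not fall.\<close>

lemma minimizers_enlarge:
  assumes A: "finite A" "A \<noteq> {}" and x: "x \<in> convex hull A"
    and ns: "affine hull (minimizers w A c) \<noteq> affine hull A"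
  shows "\<exists>c'. minimizers w A c \<subset> minimizers w A c' \<and> lower_value w A x c \<le> lower_value w A x c'"
proof -
  let ?M = "minimizers w A c"
  obtain p where p: "p \<in> ?M" using minimizers_nonempty[OF A] by blast
  have "\<exists>p0\<in>A. p0 \<notin> affine hull ?M"
  proof (rule ccontr)
    assume "\<not> ?thesis"
    then have "affine hull A \<subseteq> affine hull ?M" by (intro hull_minimal) auto
    moreover have "affine hull ?M \<subseteq> affine hull A" by (intro hull_mono minimizers_subset)
    ultimately show False using ns by simp
  qed
  then obtain p0 where p0: "p0 \<in> A" "p0 \<notin> affine hull ?M" by blast
  obtain d0 k0 where d0: "\<And>q. q \<in> affine hull ?M \<Longrightarrow> d0 \<bullet> q = k0" "d0 \<bullet> p0 \<noteq> k0"
    using affine_hull_separation[OF p0(2)] p by blast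
  \<comment> \<open>If \<open>x\<close> is off the hyperplane, the sign is dictated by its side, and
    \<open>x \<in> convex hull A\<close> supplies a point of \<open>A\<close> on that side;
    otherwise the side of \<open>p0\<close> decides.\<close>
  have "\<exists>s::real. (s *\<^sub>R d0) \<bullet> x \<le> s * k0 \<and> (\<exists>q\<in>A. (s *\<^sub>R d0) \<bullet> q < s * k0)"
  proof -
    consider "d0 \<bullet> x < k0" | "d0 \<bullet> x > k0" | "d0 \<bullet> x = k0" by linarith
    then show ?thesis
    proof cases
      case 1
      obtain q where "q \<in> A" "d0 \<bullet> q \<le> d0 \<bullet> x" using convex_hull_exists_inner_le[OF x] by blast
      then have "d0 \<bullet> x \<le> k0 \<and> (\<exists>q\<in>A. d0 \<bullet> q < k0)"
        using 1 by (intro conjI bexI[of _ q]; linarith)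
      then show ?thesis by (intro exI[of _ 1]) simp
    next
      case 2
      obtain q where "q \<in> A" "- d0 \<bullet> q \<le> - d0 \<bullet> x" using convex_hull_exists_inner_le[OF x] by blast
      then have "q \<in> A" "d0 \<bullet> x \<le> d0 \<bullet> q" by simp_all
      then have "k0 \<le> d0 \<bullet> x \<and> (\<exists>q\<in>A. k0 < d0 \<bullet> q)"
        using 2 by (intro conjI bexI[of _ q]; linarith)
      then show ?thesis by (intro exI[of _ "-1"]) simp
    next
      case 3
      show ?thesis
      proof (cases "d0 \<bullet> p0 < k0")
        case True
        then show ?thesis using 3 p0 by (intro exI[of _ 1]) auto
      next
        case False
        then show ?thesis using 3 p0 d0(2) by (intro exI[of _ "-1"]) force
      qed
    qed
  qed
  then obtain s q0 where s: "(s *\<^sub>R d0) \<bullet> x \<le> s * k0" and q0: "q0 \<in> A" "(s *\<^sub>R d0) \<bullet> q0 < s * k0"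
    by blast
  define d where "d = s *\<^sub>R d0"
  define k where "k = s * k0"
  have dM: "d \<bullet> q = k" if "q \<in> ?M" for q
    using d0(1)[OF hull_inc[OF that]] by (simp add: d_def k_def)
  define m where "m = c \<bullet> p + w p"
  define I where "I = {q\<in>A. d \<bullet> q < k}"
  have I: "finite I" "I \<noteq> {}" using A q0 by (auto simp: I_def d_def k_def)
  \<comment> \<open>\<open>r q\<close> is the step length at which \<open>q\<close> reaches the
    level of the cell; the smallest one is taken, so no point is overtaken.\<close>
  define r where "r q = (c \<bullet> q + w q - m) / (k - d \<bullet> q)" for q
  obtain q1 where q1: "q1 \<in> I" "\<And>q. q \<in> I \<Longrightarrow> r q1 \<le> r q"
    using ex_is_arg_min_if_finite[OF I, of r] by (auto simp: is_arg_min_linorder)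
  define \<eta> where "\<eta> = r q1"
  have ge: "m \<le> c \<bullet> q + w q" if "q \<in> A" for q
    using minimizers_le[OF p that] by (simp add: m_def)
  have \<eta>0: "\<eta> \<ge> 0" using ge q1(1) by (auto simp: \<eta>_def r_def I_def)
  define c' where "c' = c + \<eta> *\<^sub>R d"
  have c': "c' \<bullet> q = c \<bullet> q + \<eta> * (d \<bullet> q)" for q
    by (simp add: c'_def inner_add_left)
  have all: "m + \<eta> * k \<le> c' \<bullet> q + w q" if "q \<in> A" for q
  proof (cases "q \<in> I")
    case True
    then have "\<eta> \<le> r q" "k - d \<bullet> q > 0" using q1 by (auto simp: \<eta>_def I_def)
    then have "\<eta> * (k - d \<bullet> q) \<le> c \<bullet> q + w q - m" by (simp add: r_def pos_le_divide_eq)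
    then show ?thesis by (simp add: c' algebra_simps)
  next
    case False
    then have "k \<le> d \<bullet> q" using that by (simp add: I_def)
    then have "\<eta> * k \<le> \<eta> * (d \<bullet> q)" using \<eta>0 by (rule mult_left_mono)
    then show ?thesis using ge[OF that] by (simp add: c')
  qed
  have eqM: "c' \<bullet> q + w q = m + \<eta> * k" if "q \<in> ?M" for q
    using dM[OF that] minimizers_eq[OF that p] by (simp add: c' m_def)
  have eq1: "c' \<bullet> q1 + w q1 = m + \<eta> * k"
  proof -
    have "k - d \<bullet> q1 > 0" using q1(1) by (simp add: I_def)
    then have "\<eta> * (k - d \<bullet> q1) = c \<bullet> q1 + w q1 - m" by (simp add: \<eta>_def r_def)
    then show ?thesis by (simp add: c' algebra_simps)
  qed
  have sub: "insert q1 ?M \<subseteq> minimizers w A c'"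
    using eqM eq1 all q1(1) minimizers_subset[of w A c]
    by (auto simp: minimizers_def[of w A c'] I_def)
  have "q1 \<notin> ?M" using dM[of q1] q1(1) by (auto simp: I_def)
  then have "?M \<subset> minimizers w A c'" using sub by blast
  moreover have "lower_value w A x c \<le> lower_value w A x c'"
  proof -
    have "p \<in> minimizers w A c'" using sub p by blast
    then have "lower_value w A x c' = m + \<eta> * k - c' \<bullet> x"
      using lower_value_eq[OF A(1)] eqM[OF p] by simp
    also have "\<dots> = m - c \<bullet> x + \<eta> * (k - d \<bullet> x)"
      by (simp add: c'_def inner_add_left algebra_simps)
    also have "\<dots> \<ge> m - c \<bullet> x" using \<eta>0 s by (simp add: d_def k_def)
    finally show ?thesis using lower_value_eq[OF A(1) p] by (simp add: m_def)
  qed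
  ultimately show ?thesis by blast
qed

text \<open>Every enlargement adds a minimizer and \<open>A\<close> is finite; the process can stop
  only at a spanning cell.\<close>

lemma minimizers_spanning:
  assumes A: "finite A" "A \<noteq> {}" and x: "x \<in> convex hull A"
  shows "\<exists>c'. minimizers w A c \<subseteq> minimizers w A c' \<and>
    affine hull (minimizers w A c') = affine hull A \<and> lower_value w A x c \<le> lower_value w A x c'"
proof (induction "card A - card (minimizers w A c)" arbitrary: c rule: less_induct)
  case less
  show ?case
  proof (cases "affine hull (minimizers w A c) = affine hull A")
    case False
    then obtain c1 where c1: "minimizers w A c \<subset> minimizers w A c1"
        "lower_value w A x c \<le> lower_value w A x c1"
      using minimizers_enlarge[OF A x] by blast
    have "card (minimizers w A c) < card (minimizers w A c1)"
      using c1(1) finite_minimizers[OF A(1)] by (rule psubset_card_mono[rotated])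
    moreover have "card (minimizers w A c1) \<le> card A"
      by (rule card_mono[OF A(1) minimizers_subset])
    ultimately have "card A - card (minimizers w A c1) < card A - card (minimizers w A c)"
      by linarith
    from less[OF this] show ?thesis using c1 by (meson order_trans psubset_imp_subset)
  qed auto
qed

text \<open>The finitely many points outside the cell have positive slack, so a small tilt along
  \<open>d\<close>, measured from the level \<open>b\<close>, cannot bring them into the
  cell.\<close>

lemma minimizers_step:
  assumes A: "finite A" and p: "p \<in> minimizers w A c"
  shows "\<exists>\<eta>>0. \<forall>q\<in>A - minimizers w A c. c \<bullet> p + w p + \<eta> * \<bar>d \<bullet> q - b\<bar> < c \<bullet> q + w q"
proof -
  \<comment> \<open>Adding 1 keeps the denominator positive and makes the resulting inequality
    strict.\<close>
  define h where "h q = (c \<bullet> q + w q - (c \<bullet> p + w p)) / (1 + \<bar>d \<bullet> q - b\<bar>)" for q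
  have "h q > 0" if "q \<in> A - minimizers w A c" for q
    using minimizers_less[OF p, of q] that by (auto simp: h_def intro!: divide_pos_pos)
  then obtain \<eta> where \<eta>: "\<eta> > 0" "\<And>q. q \<in> A - minimizers w A c \<Longrightarrow> \<eta> \<le> h q"
    using finite_pos_lower_bound[of "A - minimizers w A c" h] A by blast
  have "c \<bullet> p + w p + \<eta> * \<bar>d \<bullet> q - b\<bar> < c \<bullet> q + w q" if "q \<in> A - minimizers w A c" for q
  proof -
    have "\<eta> * (1 + \<bar>d \<bullet> q - b\<bar>) \<le> c \<bullet> q + w q - (c \<bullet> p + w p)"
      using \<eta>(2)[OF that] by (simp add: h_def pos_le_divide_eq)
    then show ?thesis using \<eta>(1) by (simp add: distrib_left)
  qed
  then show ?thesis using \<eta>(1) by blast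
qed

text \<open>Linear programming duality in disguise: a maximizer of \<open>lower_value w A x\<close>
  yields a cell around \<open>x\<close>, because a hyperplane separating \<open>x\<close> from the
  cell would give a direction of increase.\<close>

lemma minimizers_cover:
  assumes A: "finite A" and x: "x \<in> convex hull A"
  shows "\<exists>c. affine hull (minimizers w A c) = affine hull A \<and> x \<in> convex hull (minimizers w A c)"
proof -
  have ne: "A \<noteq> {}" using x by auto
  define Sp where "Sp = {c. affine hull (minimizers w A c) = affine hull A}"
  \<comment> \<open>Two functionals with the same spanning cell differ by one that is constant on
    the affine hull of \<open>A\<close>, so the value at \<open>x\<close> depends only on the cell.
    Hence only finitely many values occur and a maximum exists.\<close>
  have det: "lower_value w A x c1 = lower_value w A x c2"
    if c12: "c1 \<in> Sp" "c2 \<in> Sp" and eq: "minimizers w A c1 = minimizers w A c2" for c1 c2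
  proof -
    let ?M = "minimizers w A c1"
    obtain p where p: "p \<in> ?M" using minimizers_nonempty[OF A ne] by blast
    define k where "k = (c1 - c2) \<bullet> p"
    have "?M \<subseteq> {q. (c1 - c2) \<bullet> q = k}"
    proof clarify
      fix q assume q: "q \<in> ?M"
      have "c1 \<bullet> q + w q = c1 \<bullet> p + w p" using minimizers_eq[OF q p] .
      moreover have "c2 \<bullet> q + w q = c2 \<bullet> p + w p"
        using q p minimizers_eq[of q w A c2 p] unfolding eq by simp
      ultimately show "(c1 - c2) \<bullet> q = k" by (simp add: k_def inner_diff_left)
    qed
    then have "affine hull ?M \<subseteq> {q. (c1 - c2) \<bullet> q = k}"
      by (rule hull_minimal) (rule affine_hyperplane)
    moreover have "x \<in> affine hull ?M"
      using x c12(1) convex_hull_subset_affine_hull[of A] by (auto simp: Sp_def)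
    ultimately have "(c1 - c2) \<bullet> x = k" by blast
    then show ?thesis
      using lower_value_eq[OF A p] lower_value_eq[OF A, of p w c2] p unfolding eq
      by (simp add: k_def inner_diff_left)
  qed
  have fin: "finite (lower_value w A x ` Sp)"
  proof (rule finite_surj)
    show "finite (minimizers w A ` Sp)"
      using minimizers_subset by (intro finite_subset[OF _ finite_Pow_iff[THEN iffD2, OF A]]) blast
    show "lower_value w A x ` Sp
        \<subseteq> (\<lambda>M. lower_value w A x (inv_into Sp (minimizers w A) M)) ` minimizers w A ` Sp"
    proof clarify
      fix c assume c: "c \<in> Sp"
      then have "lower_value w A x c = lower_value w A x (inv_into Sp (minimizers w A) (minimizers w A c))"
        by (intro det) (simp_all add: f_inv_into_f inv_into_into)
      then show "lower_value w A x c
          \<in> (\<lambda>M. lower_value w A x (inv_into Sp (minimizers w A) M)) ` minimizers w A ` Sp"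
        using c by blast
    qed
  qed
  have "Sp \<noteq> {}" unfolding Sp_def using minimizers_spanning[OF A ne x, of w] by blast
  then have "Max (lower_value w A x ` Sp) \<in> lower_value w A x ` Sp" using fin by (intro Max_in) auto
  then obtain c where c: "c \<in> Sp" "lower_value w A x c = Max (lower_value w A x ` Sp)" by auto
  have max: "lower_value w A x c' \<le> lower_value w A x c" for c'
  proof -
    obtain c2 where c2: "c2 \<in> Sp" "lower_value w A x c' \<le> lower_value w A x c2"
      unfolding Sp_def using minimizers_spanning[OF A ne x, of w c'] by blast
    have "lower_value w A x c2 \<le> lower_value w A x c" unfolding c(2) using fin c2 by (intro Max_ge) auto
    then show ?thesis using c2 by simp
  qed
  have "x \<in> convex hull (minimizers w A c)"
  proof (rule ccontr)
    let ?M = "minimizers w A c"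
    assume "x \<notin> convex hull ?M"
    moreover have "closed (convex hull ?M)"
      by (intro compact_imp_closed compact_convex_hull finite_imp_compact finite_minimizers A)
    ultimately obtain d b where d: "d \<bullet> x < b" "\<And>y. y \<in> convex hull ?M \<Longrightarrow> b < d \<bullet> y"
      using separating_hyperplane_closed_point[OF convex_convex_hull] by metis
    have dM: "d \<bullet> x < d \<bullet> p" if "p \<in> ?M" for p using d(1) d(2)[OF hull_inc[OF that]] by linarith
    obtain p where p: "p \<in> ?M" using minimizers_nonempty[OF A ne] by blast
    define m where "m = c \<bullet> p + w p"
    obtain \<eta> where \<eta>: "\<eta> > 0" "\<And>q. q \<in> A - ?M \<Longrightarrow> m + \<eta> * \<bar>d \<bullet> q - d \<bullet> x\<bar> < c \<bullet> q + w q"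
      using minimizers_step[OF A p, of d "d \<bullet> x"] unfolding m_def by blast
    \<comment> \<open>Tilting along \<open>d\<close> raises the level of the cell by more than it
      raises \<open>c \<bullet> x\<close>; the points outside the cell stay too high to
      interfere.\<close>
    define c' where "c' = c + \<eta> *\<^sub>R d"
    obtain q where q: "q \<in> minimizers w A c'" using minimizers_nonempty[OF A ne] by blast
    then have qA: "q \<in> A" using minimizers_subset by blast
    have "lower_value w A x c' = c \<bullet> q + w q - c \<bullet> x + \<eta> * (d \<bullet> q - d \<bullet> x)"
      using lower_value_eq[OF A q] by (simp add: c'_def inner_add_left algebra_simps)
    moreover have "m < c \<bullet> q + w q + \<eta> * (d \<bullet> q - d \<bullet> x)"
    proof (cases "q \<in> ?M")
      case True
      then show ?thesis using minimizers_eq[OF True p] dM[OF True] \<eta>(1) by (simp add: m_def)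
    next
      case False
      then have "m + \<eta> * \<bar>d \<bullet> q - d \<bullet> x\<bar> < c \<bullet> q + w q" using \<eta>(2) qA by blast
      moreover have "\<eta> * - (d \<bullet> q - d \<bullet> x) \<le> \<eta> * \<bar>d \<bullet> q - d \<bullet> x\<bar>"
        using \<eta>(1) by (intro mult_left_mono abs_ge_minus_self) simp
      ultimately show ?thesis by linarith
    qed
    moreover have "lower_value w A x c = m - c \<bullet> x" using lower_value_eq[OF A p] by (simp add: m_def)
    ultimately have "lower_value w A x c < lower_value w A x c'" by linarith
    then show False using max[of c'] by simp
  qed
  then show ?thesis using c(1) by (auto simp: Sp_def)
qed

section \<open>Unimodular simplices and triangulations\<close>

lemma integer_points_sum: "(\<And>i. i \<in> I \<Longrightarrow> f i \<in> integer_points) \<Longrightarrow> sum f I \<in> integer_points"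
  by (induction I rule: infinite_finite_induct) (auto simp: integer_points_def inner_add_left)

lemma integer_points_scaleR_Ints: "r \<in> \<int> \<Longrightarrow> x \<in> integer_points \<Longrightarrow> r *\<^sub>R x \<in> integer_points"
  by (simp add: integer_points_def)

lemma convex_hull_affine_image:
  assumes "linear L"
  shows "convex hull ((\<lambda>x. c + L x) ` S) = (\<lambda>x. c + L x) ` (convex hull S)"
proof -
  have "convex hull ((+) c ` L ` S) = (+) c ` L ` (convex hull S)"
    using convex_hull_linear_image[OF assms, of S] convex_hull_translation[of c "L ` S"] by simp
  then show ?thesis by (simp add: image_image)
qed

lemma affine_hull_affine_image:
  fixes L :: "'a::euclidean_space \<Rightarrow> 'b::euclidean_space"
  assumes "linear L"
  shows "affine hull ((\<lambda>x. c + L x) ` S) = (\<lambda>x. c + L x) ` (affine hull S)"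
proof -
  have "affine hull ((+) c ` L ` S) = (+) c ` L ` (affine hull S)"
    using affine_hull_linear_image[of L S] assms affine_hull_translation[of c "L ` S"]
    by (simp add: linear_conv_bounded_linear)
  then show ?thesis by (simp add: image_image)
qed

lemma unimodular_mapI:
  fixes f :: "'a::euclidean_space \<Rightarrow> 'b::euclidean_space"
  assumes L: "linear L" "f = (\<lambda>x. c + L x)" and inj: "inj_on f (affine hull P)"
    and int: "\<And>x. x \<in> affine hull P \<Longrightarrow> f x \<in> integer_points \<longleftrightarrow> x \<in> integer_points"
  shows "unimodular_map f P (f ` P)"
proof -
  have im: "f ` (affine hull P) = affine hull (f ` P)"
    unfolding L(2) by (rule affine_hull_affine_image[OF L(1), symmetric])
  have "bij_betw f (affine hull P \<inter> integer_points) (affine hull (f ` P) \<inter> integer_points)"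
    using inj int unfolding bij_betw_def im[symmetric] by (auto simp: inj_on_def)
  moreover have "bij_betw f (affine hull P) (affine hull (f ` P))"
    using inj im by (simp add: bij_betw_def)
  ultimately show ?thesis unfolding unimodular_map_def using L by blast
qed

text \<open>The difference of the slacks \<open>c \<bullet> p + w p - m\<close> and \<open>c' \<bullet> p + w p - m'\<close> is an affine function of
  \<open>p\<close> that separates the two cells and vanishes on the common minimizers only.\<close>

lemma convex_hull_minimizers_Int:
  assumes A: "finite A" "A \<noteq> {}"
  shows "convex hull (minimizers w A c) \<inter> convex hull (minimizers w A c')
    = convex hull (minimizers w A c \<inter> minimizers w A c')" (is "convex hull ?M \<inter> convex hull ?M' = _")
proof
  obtain p p' where p: "p \<in> ?M" and p': "p' \<in> ?M'" using minimizers_nonempty[OF A] by blast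
  define a where "a = c' - c"
  define b where "b = c' \<bullet> p' + w p' - (c \<bullet> p + w p)"
  have M: "b \<le> a \<bullet> q" "a \<bullet> q = b \<longleftrightarrow> q \<in> ?M'" if q: "q \<in> ?M" for q
  proof -
    have qA: "q \<in> A" using q minimizers_subset by blast
    have a: "a \<bullet> q = c' \<bullet> q + w q - (c \<bullet> p + w p)"
      using minimizers_eq[OF q p] by (simp add: a_def inner_diff_left)
    show "b \<le> a \<bullet> q" using minimizers_le[OF p' qA] unfolding a b_def by linarith
    show "a \<bullet> q = b \<longleftrightarrow> q \<in> ?M'"
      using minimizers_eq[OF _ p', of q] minimizers_eqI[OF p' qA] unfolding a b_def by auto
  qed
  have "?M' \<subseteq> {q. a \<bullet> q \<le> b}"
  proof
    fix q assume q: "q \<in> ?M'"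
    then have "c \<bullet> p + w p \<le> c \<bullet> q + w q" using minimizers_le[OF p] minimizers_subset by blast
    then show "q \<in> {q. a \<bullet> q \<le> b}"
      using minimizers_eq[OF q p'] by (simp add: a_def b_def inner_diff_left)
  qed
  then have "convex hull ?M' \<subseteq> {q. a \<bullet> q \<le> b}" by (intro hull_minimal convex_halfspace_le)
  moreover have "convex hull ?M \<subseteq> {q. b \<le> a \<bullet> q}" using M(1) by (intro hull_minimal convex_halfspace_ge) auto
  ultimately have "convex hull ?M \<inter> convex hull ?M' \<subseteq> convex hull ?M \<inter> {q. a \<bullet> q = b}"
    by (auto intro: order_antisym)
  also have "\<dots> = convex hull (?M \<inter> {q. a \<bullet> q = b})"
    using M(1) by (intro convex_hull_Int_hyperplane finite_minimizers A)
  also have "?M \<inter> {q. a \<bullet> q = b} = ?M \<inter> ?M'" using M(2) by blast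
  finally show "convex hull ?M \<inter> convex hull ?M' \<subseteq> convex hull (?M \<inter> ?M')" .
  show "convex hull (?M \<inter> ?M') \<subseteq> convex hull ?M \<inter> convex hull ?M'"
    by (simp add: hull_mono)
qed

text \<open>Makes the set of cells closed under faces: a face of a simplex is exposed, and a small
  tilt by its exposing functional leaves just the vertices of that face minimal.\<close>

lemma minimizers_subset_exposed:
  assumes A: "finite A" and ind: "\<not> affine_dependent (minimizers w A c)"
    and N: "N \<subseteq> minimizers w A c" "N \<noteq> {}"
  shows "\<exists>c'. minimizers w A c' = N"
proof -
  let ?M = "minimizers w A c"
  have "(convex hull N) face_of (convex hull ?M)"
    using face_of_convex_hull_affine_independent[OF ind] N by blast
  then have "(convex hull N) exposed_face_of (convex hull ?M)"
    using exposed_face_of_polyhedron[OF polytope_imp_polyhedron[OF polytope_convex_hull[OF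
      finite_minimizers[OF A]]]] by blast
  then obtain a b where ab: "convex hull ?M \<subseteq> {x. a \<bullet> x \<le> b}" "convex hull N = convex hull ?M \<inter> {x. a \<bullet> x = b}"
    unfolding exposed_face_of_def by blast
  have aN: "a \<bullet> p = b" if "p \<in> N" for p
    using ab(2) hull_inc[OF that] by blast
  \<comment> \<open>By independence a vertex outside \<open>N\<close> is not in the affine hull of
    \<open>N\<close>, so it cannot lie in the exposing hyperplane.\<close>
  have aM: "a \<bullet> p < b" if p: "p \<in> ?M" "p \<notin> N" for p
  proof -
    have "p \<notin> convex hull N"
    proof
      assume "p \<in> convex hull N"
      then have "p \<in> affine hull N" using convex_hull_subset_affine_hull by blast
      then have "p \<in> affine hull (?M - {p})" using N p hull_mono[of N "?M - {p}" affine] by blast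
      then show False using ind p unfolding affine_dependent_def by blast
    qed
    then have "a \<bullet> p \<noteq> b" "a \<bullet> p \<le> b" using ab hull_inc[OF p(1)] by blast+
    then show ?thesis by simp
  qed
  obtain p0 where p0: "p0 \<in> N" using N by blast
  then have p0M: "p0 \<in> ?M" using N by blast
  define m where "m = c \<bullet> p0 + w p0"
  obtain \<eta> where \<eta>: "\<eta> > 0" "\<And>q. q \<in> A - ?M \<Longrightarrow> m + \<eta> * \<bar>a \<bullet> q - b\<bar> < c \<bullet> q + w q"
    using minimizers_step[OF A p0M, of a b] unfolding m_def by blast
  \<comment> \<open>The sign is negative because \<open>a\<close> is maximal on
    \<open>N\<close>.\<close>
  define c' where "c' = c - \<eta> *\<^sub>R a"
  have c': "c' \<bullet> q = c \<bullet> q - \<eta> * (a \<bullet> q)" for q by (simp add: c'_def inner_diff_left)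
  have eq: "c' \<bullet> q + w q = m - \<eta> * b" if "q \<in> N" for q
    using minimizers_eq[of q w A c p0] that N p0M aN[OF that] by (auto simp: c' m_def)
  have gt: "m - \<eta> * b < c' \<bullet> q + w q" if q: "q \<in> A" "q \<notin> N" for q
  proof (cases "q \<in> ?M")
    case True
    have "\<eta> * (a \<bullet> q) < \<eta> * b" using aM[OF True q(2)] \<eta>(1) by (rule mult_strict_left_mono)
    then show ?thesis using minimizers_eq[OF True p0M] by (simp add: c' m_def)
  next
    case False
    then have "m + \<eta> * \<bar>a \<bullet> q - b\<bar> < c \<bullet> q + w q" using \<eta>(2) q by blast
    moreover have "\<eta> * (a \<bullet> q - b) \<le> \<eta> * \<bar>a \<bullet> q - b\<bar>" using \<eta>(1) by (intro mult_left_mono) auto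
    ultimately show ?thesis by (simp add: c' right_diff_distrib)
  qed
  have "minimizers w A c' = N"
  proof
    show "minimizers w A c' \<subseteq> N"
    proof
      fix q assume q: "q \<in> minimizers w A c'"
      have "p0 \<in> A" using p0M minimizers_subset by blast
      then have "c' \<bullet> q + w q \<le> m - \<eta> * b" using minimizers_le[OF q, of p0] eq[OF p0] by simp
      moreover have "q \<in> A" using q minimizers_subset by blast
      ultimately show "q \<in> N" using gt by force
    qed
    show "N \<subseteq> minimizers w A c'"
    proof
      fix q assume q: "q \<in> N"
      have "m - \<eta> * b \<le> c' \<bullet> r + w r" if "r \<in> A" for r
        using eq[of r] gt[OF that] by (cases "r \<in> N") auto
      then show "q \<in> minimizers w A c'"
        using q eq[OF q] N minimizers_subset[of w A c] by (auto simp: minimizers_def[of w A c'])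
    qed
  qed
  then show ?thesis by blast
qed

text \<open>For a nonempty set of lattice points this says that the differences to one vertex form a
  basis of the lattice parallel to the affine hull. Stated with barycentric coordinates, it singles
  out no vertex and covers simplices of every dimension.\<close>

definition unimodular_vertices :: "'a::euclidean_space set \<Rightarrow> bool" where
  "unimodular_vertices M \<longleftrightarrow> \<not> affine_dependent M \<and>
     (\<forall>u. sum u M = 1 \<longrightarrow> (\<Sum>p\<in>M. u p *\<^sub>R p) \<in> integer_points \<longrightarrow> (\<forall>p\<in>M. u p \<in> \<int>))"

text \<open>One vertex is sent to 0 and the others to distinct basis vectors, so the coordinates of
  an image are barycentric coordinates, and integrality transfers in both directions.\<close>

lemma unimodular_vertices_convex_hull:
  fixes M :: "'a::euclidean_space set"
  assumes uv: "unimodular_vertices M" and ne: "M \<noteq> {}" and int: "M \<subseteq> integer_points"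
  shows "\<exists>B\<subseteq>Basis. unimodularly_equivalent (convex hull M) (convex hull (insert 0 B) :: 'a set)"
proof -
  have ind: "\<not> affine_dependent M" using uv by (simp add: unimodular_vertices_def)
  have fin: "finite M" using aff_independent_finite[OF ind] .
  obtain p0 where p0: "p0 \<in> M" using ne by blast
  define N where "N = M - {p0}"
  have finN: "finite N" using fin by (simp add: N_def)
  have indN: "independent ((\<lambda>p. p - p0) ` N)"
    using ind affine_dependent_iff_dependent2[OF p0] by (simp add: N_def)
  have injN: "inj_on (\<lambda>p. p - p0) N" by (auto simp: inj_on_def)
  have "card N \<le> card (Basis :: 'a set)"
    using independent_card_le[OF indN] card_image[OF injN] by simp
  then obtain B :: "'a set" where B: "B \<subseteq> Basis" "card B = card N"
    using obtain_subset_with_card_n by metis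
  have finB: "finite B" using B finite_subset[OF _ finite_Basis] by blast
  obtain \<phi> where \<phi>: "bij_betw \<phi> N B"
    using finite_same_card_bij[OF finN finB] B(2) by auto
  obtain L where L: "linear L" "\<And>v. v \<in> (\<lambda>p. p - p0) ` N \<Longrightarrow> L v = \<phi> (p0 + v)"
    using linear_independent_extend[OF indN, of "\<lambda>v. \<phi> (p0 + v)"] by blast
  define f where "f x = L (x - p0)" for x
  have f_aff: "f = (\<lambda>x. - L p0 + L x)" by (auto simp: f_def linear_diff[OF L(1)])
  have fN: "f p = \<phi> p" if "p \<in> N" for p using L(2)[of "p - p0"] that by (simp add: f_def)
  have f0: "f p0 = 0" by (simp add: f_def linear_0[OF L(1)])
  have fsum: "f (\<Sum>p\<in>M. u p *\<^sub>R p) = (\<Sum>p\<in>N. u p *\<^sub>R \<phi> p)" if "sum u M = 1" for u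
  proof -
    have "(\<Sum>p\<in>M. u p *\<^sub>R p) - p0 = (\<Sum>p\<in>M. u p *\<^sub>R (p - p0))"
      using that by (simp add: scaleR_diff_right sum_subtractf flip: scaleR_sum_left)
    then have "f (\<Sum>p\<in>M. u p *\<^sub>R p) = (\<Sum>p\<in>M. u p *\<^sub>R f p)"
      by (simp add: f_def linear_sum[OF L(1)] linear_scale[OF L(1)])
    also have "\<dots> = (\<Sum>p\<in>N. u p *\<^sub>R f p)"
      unfolding N_def using fin p0 f0 by (simp add: sum.remove[of M p0])
    finally show ?thesis using fN by simp
  qed
  have coord: "(\<Sum>p\<in>N. u p *\<^sub>R \<phi> p) \<bullet> \<phi> q = u q" if q: "q \<in> N" for u q
  proof -
    have "(\<Sum>p\<in>N. u p *\<^sub>R \<phi> p) \<bullet> \<phi> q = (\<Sum>p\<in>N. if p = q then u p else 0)"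
    proof (unfold inner_sum_left, intro sum.cong refl)
      fix p assume p: "p \<in> N"
      have "\<phi> p \<in> Basis" "\<phi> q \<in> Basis" "\<phi> p = \<phi> q \<longleftrightarrow> p = q"
        using p q \<phi> B by (auto simp: bij_betw_def inj_on_def)
      then show "(u p *\<^sub>R \<phi> p) \<bullet> \<phi> q = (if p = q then u p else 0)" by (simp add: inner_Basis)
    qed
    then show ?thesis using finN q by simp
  qed
  have hull: "\<exists>u. sum u M = 1 \<and> x = (\<Sum>p\<in>M. u p *\<^sub>R p)" if "x \<in> affine hull M" for x
    using that affine_hull_finite[OF fin] by auto
  have fM: "f ` M = insert 0 B"
  proof -
    have "f ` M = insert (f p0) (f ` N)" using p0 by (auto simp: N_def)
    moreover have "f ` N = B" using fN \<phi> by (simp add: bij_betw_def)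
    ultimately show ?thesis by (simp add: f0)
  qed
  have imc: "f ` (convex hull M) = convex hull (insert 0 B)"
    unfolding fM[symmetric] f_aff by (rule convex_hull_affine_image[OF L(1), symmetric])
  have inj: "inj_on f (affine hull M)"
  proof (rule inj_onI)
    fix x y assume x: "x \<in> affine hull M" and y: "y \<in> affine hull M" and eq: "f x = f y"
    obtain u v where u: "sum u M = 1" "x = (\<Sum>p\<in>M. u p *\<^sub>R p)" and v: "sum v M = 1" "y = (\<Sum>p\<in>M. v p *\<^sub>R p)"
      using hull[OF x] hull[OF y] by blast
    have N: "u q = v q" if "q \<in> N" for q
      using coord[OF that, of u] coord[OF that, of v] fsum[OF u(1)] fsum[OF v(1)] eq u(2) v(2) by simp
    then have "sum u N = sum v N" by simp
    then have "u p0 = v p0" using u(1) v(1) fin p0 by (simp add: N_def sum.remove[of M p0])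
    then have "u p = v p" if "p \<in> M" for p using N that by (cases "p = p0") (auto simp: N_def)
    then show "x = y" unfolding u(2) v(2) by simp
  qed
  have int_iff: "f x \<in> integer_points \<longleftrightarrow> x \<in> integer_points" if x: "x \<in> affine hull M" for x
  proof -
    obtain u where u: "sum u M = 1" "x = (\<Sum>p\<in>M. u p *\<^sub>R p)" using hull[OF x] by blast
    have fx: "f x = (\<Sum>p\<in>N. u p *\<^sub>R \<phi> p)" using fsum[OF u(1)] u(2) by simp
    show ?thesis
    proof
      assume i: "f x \<in> integer_points"
      have N: "u q \<in> \<int>" if q: "q \<in> N" for q
      proof -
        have "\<phi> q \<in> Basis" using q \<phi> B by (auto simp: bij_betw_def)
        then have "f x \<bullet> \<phi> q \<in> \<int>" using i by (simp add: integer_points_def)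
        then show ?thesis using coord[OF q] fx by simp
      qed
      have "u p0 = 1 - sum u N" using u(1) fin p0 by (simp add: N_def sum.remove[of M p0])
      then have "u p0 \<in> \<int>" using N by (simp add: Ints_sum)
      then have "u p \<in> \<int>" if "p \<in> M" for p using N that by (cases "p = p0") (auto simp: N_def)
      then show "x \<in> integer_points" unfolding u(2)
        using int by (intro integer_points_sum integer_points_scaleR_Ints) auto
    next
      assume "x \<in> integer_points"
      then have "\<forall>p\<in>M. u p \<in> \<int>" using uv u unfolding unimodular_vertices_def by blast
      then show "f x \<in> integer_points" unfolding fx using \<phi> B
        by (intro integer_points_sum integer_points_scaleR_Ints)
          (auto simp: N_def bij_betw_def integer_points_def inner_Basis)
    qed
  qed
  have "unimodular_map f (convex hull M) (f ` (convex hull M))"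
    using unimodular_mapI[OF L(1) f_aff, of "convex hull M"] inj int_iff by simp
  then have "unimodular_map f (convex hull M) (convex hull (insert 0 B))" unfolding imc .
  then show ?thesis using B(1) unfolding unimodularly_equivalent_def by blast
qed

text \<open>Only spanning cells are constrained, since every other cell is contained in a spanning
  one.\<close>

definition unimodular_weight :: "('a::euclidean_space \<Rightarrow> real) \<Rightarrow> 'a set \<Rightarrow> bool" where
  "unimodular_weight w A \<longleftrightarrow> (\<forall>c. affine hull (minimizers w A c) = affine hull A
     \<longrightarrow> unimodular_vertices (minimizers w A c))"

lemma lattice_polytope_integer_points:
  assumes "lattice_polytope P"
  shows "finite (P \<inter> integer_points)" "P \<inter> integer_points \<noteq> {}" "convex hull (P \<inter> integer_points) = P"
proof -
  obtain V where V: "finite V" "V \<noteq> {}" "V \<subseteq> integer_points" "P = convex hull V"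
    using assms unfolding lattice_polytope_def by blast
  have "bounded P" using V by (simp add: bounded_convex_hull finite_imp_bounded)
  then show "finite (P \<inter> integer_points)" by (rule finite_integer_points_bounded)
  have sub: "V \<subseteq> P \<inter> integer_points" using V(3,4) hull_subset[of V convex] by auto
  then show "P \<inter> integer_points \<noteq> {}" using V(2) by blast
  have "convex P" using V by simp
  then show "convex hull (P \<inter> integer_points) = P"
    using hull_mono[OF sub, of convex] V(4) hull_minimal[of "P \<inter> integer_points" P convex] by blast
qed

text \<open>The complex consists of the hulls of all minimizer sets together with the empty face.
  Every such set lies in a spanning one and is thus independent, which makes all cells
  simplices.\<close>

lemma unimodular_weight_triangulation:
  fixes P :: "'a::euclidean_space set"
  assumes P: "lattice_polytope P" and w: "unimodular_weight w (P \<inter> integer_points)"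
  shows "has_regular_unimodular_triangulation P"
proof -
  let ?A = "P \<inter> integer_points"
  let ?M = "minimizers w ?A"
  note A = lattice_polytope_integer_points[OF P]
  define T where "T = insert {} (range (\<lambda>c. convex hull (?M c)))"
  obtain x0 where "x0 \<in> P" using A(2) by blast
  then have x0: "x0 \<in> convex hull ?A" using A(3) by simp
  have sp: "\<exists>c'. ?M c \<subseteq> ?M c' \<and> affine hull (?M c') = affine hull ?A" for c
    using minimizers_spanning[OF A(1,2) x0, of w c] by blast
  have ind: "\<not> affine_dependent (?M c)" for c
  proof -
    obtain c' where "?M c \<subseteq> ?M c'" "affine hull (?M c') = affine hull ?A" using sp by blast
    then show ?thesis
      using w affine_dependent_subset unfolding unimodular_weight_def unimodular_vertices_def by blast
  qed
  have ne: "?M c \<noteq> {}" for c using minimizers_nonempty[OF A(1,2)] .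
  have sub: "?M c \<subseteq> ?A" for c by (rule minimizers_subset)
  have Tsub: "\<exists>C. C \<subseteq> ?A \<and> \<not> affine_dependent C \<and> S = convex hull C" if "S \<in> T" for S
  proof (cases "S = {}")
    case True
    then show ?thesis by (intro exI[of _ "{}"]) simp
  next
    case False
    then obtain c where "S = convex hull (?M c)" using \<open>S \<in> T\<close> unfolding T_def by blast
    then show ?thesis using ind sub by (intro exI[of _ "?M c"]) blast
  qed
  have finT: "finite T"
  proof (rule finite_subset)
    show "T \<subseteq> (hull) convex ` Pow ?A"
    proof
      fix S assume "S \<in> T"
      then obtain C where "C \<subseteq> ?A" "S = convex hull C" using Tsub by blast
      then show "S \<in> (hull) convex ` Pow ?A" by simp
    qed
    show "finite ((hull) convex ` Pow ?A)" by (intro finite_imageI finite_Pow_iff[THEN iffD2] A(1))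
  qed
  have face: "F \<in> T" if "S \<in> T" "F face_of S" for S F
  proof (cases "S = {}")
    case True
    then show ?thesis using that by (simp add: T_def)
  next
    case False
    then obtain c where c: "S = convex hull (?M c)" using \<open>S \<in> T\<close> unfolding T_def by blast
    then obtain C where C: "C \<subseteq> ?M c" "F = convex hull C"
      using \<open>F face_of S\<close> face_of_convex_hull_affine_independent[OF ind] by blast
    show ?thesis
    proof (cases "C = {}")
      case False
      then obtain c' where "?M c' = C" using minimizers_subset_exposed[OF A(1) ind C(1)] by blast
      then show ?thesis using C(2) by (auto simp: T_def)
    qed (simp add: T_def C)
  qed
  have inter: "(S \<inter> S') face_of S" if "S \<in> T" "S' \<in> T" for S S'
  proof (cases "S = {} \<or> S' = {}")
    case False
    then obtain c c' where c: "S = convex hull (?M c)" "S' = convex hull (?M c')"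
      using False \<open>S \<in> T\<close> \<open>S' \<in> T\<close> unfolding T_def by blast
    show ?thesis unfolding c convex_hull_minimizers_Int[OF A(1,2)]
        face_of_convex_hull_affine_independent[OF ind]
      by (intro exI[of _ "?M c \<inter> ?M c'"]) simp
  qed auto
  have cx: "simplicial_complex T"
    unfolding simplicial_complex_def
  proof (intro conjI allI impI ballI)
    fix S assume "S \<in> T"
    then obtain C where C: "C \<subseteq> ?A" "\<not> affine_dependent C" "S = convex hull C" using Tsub by blast
    then show "\<exists>n. n simplex S"
      by (intro exI[of _ "int (card C) - 1"]) (auto intro: simplex_convex_hull)
  qed (use finT face inter in auto)
  have UT: "\<Union> T = P"
  proof
    have "convex hull (?M c) \<subseteq> P" for c using hull_mono[OF sub, of convex] A(3) by blast
    then show "\<Union> T \<subseteq> P" by (auto simp: T_def)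
    show "P \<subseteq> \<Union> T"
    proof
      fix x assume "x \<in> P"
      then obtain c where "x \<in> convex hull (?M c)" using minimizers_cover[OF A(1)] A(3) by metis
      then show "x \<in> \<Union> T" by (auto simp: T_def)
    qed
  qed
  have "v \<in> integer_points" if "S \<in> T" "v extreme_point_of S" for S v
  proof -
    obtain C where C: "C \<subseteq> ?A" "S = convex hull C" using Tsub \<open>S \<in> T\<close> by blast
    then show ?thesis using that extreme_point_of_convex_hull by blast
  qed
  then have "lattice_triangulation P T" using cx UT unfolding lattice_triangulation_def by blast
  moreover have "unimodular_triangulation T"
    unfolding unimodular_triangulation_def
  proof (intro ballI impI)
    fix S assume S: "S \<in> T" and max: "\<forall>S'\<in>T. S \<subseteq> S' \<longrightarrow> S' = S"
    have "\<exists>c. S \<subseteq> convex hull (?M c)" using S by (auto simp: T_def)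
    then obtain c where "S \<subseteq> convex hull (?M c)" by blast
    moreover obtain c' where c': "?M c \<subseteq> ?M c'" "affine hull (?M c') = affine hull ?A" using sp by blast
    ultimately have "S \<subseteq> convex hull (?M c')" using hull_mono[OF c'(1), of convex] by blast
    \<comment> \<open>A maximal simplex equals the spanning cell containing it, so the assumption on
      the weight applies to it.\<close>
    then have S_eq: "S = convex hull (?M c')" using max by (auto simp: T_def)
    have "unimodular_vertices (?M c')" using w c' by (simp add: unimodular_weight_def)
    moreover have "?M c' \<subseteq> integer_points" using sub[of c'] by simp
    ultimately show "\<exists>B\<subseteq>Basis. unimodularly_equivalent S (convex hull (insert 0 B) :: 'a set)"
      unfolding S_eq using unimodular_vertices_convex_hull[OF _ ne] by metis
  qed
  moreover have "regular_triangulation P T"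
  proof -
    have "T - {{}} = range (\<lambda>c. convex hull (?M c))" using ne by (auto simp: T_def)
    also have "\<dots> = range (\<lambda>c. fst ` lower_face c (lifted_polytope w P))"
      unfolding lifted_polytope_def lower_face_convex_hull[OF A(1,2)] ..
    finally show ?thesis unfolding regular_triangulation_def by (intro exI[of _ w]) auto
  qed
  ultimately show ?thesis unfolding has_regular_unimodular_triangulation_def by blast
qed

section \<open>Generic weights\<close>

text \<open>Points on the moment curve: with \<open>g i = t ^ h i\<close> each condition becomes a
  nonzero polynomial in \<open>t\<close>, which has finitely many roots. Taking
  \<open>0 < t < 1\<close> bounds the entries by 1.\<close>

lemma ex_generic_vector:
  fixes R :: "('i \<Rightarrow> real) set"
  assumes I: "finite I" and R: "finite R" "\<And>\<kappa>. \<kappa> \<in> R \<Longrightarrow> \<exists>i\<in>I. \<kappa> i \<noteq> 0"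
  shows "\<exists>g. (\<forall>i. \<bar>g i\<bar> \<le> 1) \<and> (\<forall>\<kappa>\<in>R. (\<Sum>i\<in>I. \<kappa> i * g i) \<noteq> 0)"
proof -
  obtain h where h: "bij_betw h I {..<card I}"
    using ex_bij_betw_finite_nat[OF I] by (auto simp: atLeast0LessThan)
  define h' where "h' = inv_into I h"
  define coef where "coef \<kappa> j = (if j < card I then \<kappa> (h' j) else 0 :: real)" for \<kappa> j
  define Z where "Z \<kappa> = {t::real. (\<Sum>j\<le>card I. coef \<kappa> j * t ^ j) = 0}" for \<kappa>
  have h'h: "h' (h i) = i" "h i < card I" if "i \<in> I" for i
    using that h by (auto simp: h'_def bij_betw_def inv_into_f_f)
  have "finite (Z \<kappa>)" if \<kappa>: "\<kappa> \<in> R" for \<kappa>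
  proof -
    obtain i where i: "i \<in> I" "\<kappa> i \<noteq> 0" using R(2)[OF \<kappa>] by blast
    then have "coef \<kappa> (h i) \<noteq> 0" "h i \<le> card I" using h'h[OF i(1)] by (auto simp: coef_def)
    then show ?thesis unfolding Z_def by (intro polyfun_roots_finite)
  qed
  then have "finite (\<Union>\<kappa>\<in>R. Z \<kappa>)" using R(1) by blast
  then have "infinite ({0<..<1} - (\<Union>\<kappa>\<in>R. Z \<kappa>))" by (simp add: infinite_Ioo)
  then obtain t where t: "t \<in> {0<..<1} - (\<Union>\<kappa>\<in>R. Z \<kappa>)" by (metis finite.emptyI equals0I)
  define g where "g i = t ^ h i" for i
  have "\<bar>g i\<bar> \<le> 1" for i using t by (auto simp: g_def power_le_one)
  moreover have "(\<Sum>i\<in>I. \<kappa> i * g i) \<noteq> 0" if "\<kappa> \<in> R" for \<kappa>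
  proof -
    have "(\<Sum>i\<in>I. \<kappa> i * g i) = (\<Sum>i\<in>I. coef \<kappa> (h i) * t ^ h i)"
      using h'h by (intro sum.cong) (auto simp: coef_def g_def)
    also have "\<dots> = (\<Sum>j<card I. coef \<kappa> j * t ^ j)" by (rule sum.reindex_bij_betw[OF h])
    also have "\<dots> = (\<Sum>j\<le>card I. coef \<kappa> j * t ^ j)"
      by (intro sum.mono_neutral_left) (auto simp: coef_def)
    finally show ?thesis using t that by (auto simp: Z_def)
  qed
  ultimately show ?thesis by blast
qed

text \<open>If a dependent set \<open>S\<close> were a set of minimizers, the weights would satisfy
  the linear relation given by an affine dependence of \<open>S\<close>. Only finitely many
  relations have to be avoided.\<close>

lemma generic_perturbation:
  fixes w0 :: "'a::euclidean_space \<Rightarrow> real"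
  assumes A: "finite A" and "\<epsilon> > 0"
  shows "\<exists>w. (\<forall>p\<in>A. \<bar>w p - w0 p\<bar> < \<epsilon>) \<and> (\<forall>c. \<not> affine_dependent (minimizers w A c))"
proof -
  define Dep where "Dep = {S\<in>Pow A. affine_dependent S}"
  have finDep: "finite Dep" using A by (simp add: Dep_def)
  have "\<exists>\<kappa>. sum \<kappa> S = 0 \<and> (\<exists>v\<in>A. \<kappa> v \<noteq> 0) \<and> (\<Sum>v\<in>S. \<kappa> v *\<^sub>R v) = 0 \<and> (\<forall>v. v \<notin> S \<longrightarrow> \<kappa> v = 0)"
    if S: "S \<in> Dep" for S
  proof -
    have "finite S" using S A finite_subset by (auto simp: Dep_def)
    then obtain U where U: "sum U S = 0" "\<exists>v\<in>S. U v \<noteq> 0" "(\<Sum>v\<in>S. U v *\<^sub>R v) = 0"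
      using S affine_dependent_explicit_finite[of S] unfolding Dep_def by blast
    define \<kappa> where "\<kappa> v = (if v \<in> S then U v else 0)" for v
    have "sum \<kappa> S = 0" "(\<Sum>v\<in>S. \<kappa> v *\<^sub>R v) = 0" using U by (simp_all add: \<kappa>_def)
    moreover have "\<exists>v\<in>A. \<kappa> v \<noteq> 0" using U(2) S by (auto simp: \<kappa>_def Dep_def)
    ultimately show ?thesis by (intro exI[of _ \<kappa>]) (simp add: \<kappa>_def)
  qed
  then have "\<forall>S\<in>Dep. \<exists>\<kappa>. sum \<kappa> S = 0 \<and> (\<exists>v\<in>A. \<kappa> v \<noteq> 0) \<and> (\<Sum>v\<in>S. \<kappa> v *\<^sub>R v) = 0 \<and> (\<forall>v. v \<notin> S \<longrightarrow> \<kappa> v = 0)"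
    by (rule ballI)
  from bchoice[OF this] obtain \<kappa> where \<kappa>: "\<And>S. S \<in> Dep \<Longrightarrow> sum (\<kappa> S) S = 0" "\<And>S. S \<in> Dep \<Longrightarrow> \<exists>v\<in>A. \<kappa> S v \<noteq> 0"
      "\<And>S. S \<in> Dep \<Longrightarrow> (\<Sum>v\<in>S. \<kappa> S v *\<^sub>R v) = 0" "\<And>S v. S \<in> Dep \<Longrightarrow> v \<notin> S \<Longrightarrow> \<kappa> S v = 0"
    by blast
  obtain g where g: "\<And>i. \<bar>g i\<bar> \<le> 1" "\<And>S. S \<in> Dep \<Longrightarrow> (\<Sum>i\<in>A. \<kappa> S i * g i) \<noteq> 0"
  proof -
    have "\<exists>i\<in>A. \<kappa>' i \<noteq> 0" if "\<kappa>' \<in> \<kappa> ` Dep" for \<kappa>' using that \<kappa>(2) by blast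
    from ex_generic_vector[OF A finite_imageI[OF finDep, of \<kappa>] this] show ?thesis using that by blast
  qed
  \<comment> \<open>The only step size at which the perturbed weight can satisfy the relation for
    \<open>S\<close>.\<close>
  define bad where "bad S = - (\<Sum>i\<in>A. \<kappa> S i * w0 i) / (\<Sum>i\<in>A. \<kappa> S i * g i)" for S
  have "infinite ({0<..<\<epsilon>} - bad ` Dep)" using finDep \<open>\<epsilon> > 0\<close> by (simp add: infinite_Ioo)
  then obtain \<delta> where \<delta>: "\<delta> \<in> {0<..<\<epsilon>} - bad ` Dep" by (metis finite.emptyI equals0I)
  define w where "w p = w0 p + \<delta> * g p" for p
  have "\<bar>w p - w0 p\<bar> < \<epsilon>" for p
  proof -
    have "\<bar>w p - w0 p\<bar> = \<delta> * \<bar>g p\<bar>" using \<delta> by (simp add: w_def abs_mult)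
    also have "\<dots> \<le> \<delta> * 1" using \<delta> g(1) by (intro mult_left_mono) auto
    finally show ?thesis using \<delta> by auto
  qed
  moreover have "\<not> affine_dependent (minimizers w A c)" for c
  proof
    let ?S = "minimizers w A c"
    assume "affine_dependent ?S"
    then have S: "?S \<in> Dep" using minimizers_subset[of w A c] by (simp add: Dep_def)
    obtain p0 where p0: "p0 \<in> ?S"
      using \<open>affine_dependent ?S\<close> by (auto simp: affine_dependent_def)
    have "(\<Sum>p\<in>?S. \<kappa> ?S p * w p) = 0"
      using sum_minimizers[OF p0 subset_refl] \<kappa>(1,3)[OF S] by simp
    moreover have "(\<Sum>p\<in>A. \<kappa> ?S p * w p) = (\<Sum>p\<in>?S. \<kappa> ?S p * w p)"
      using A \<kappa>(4)[OF S] minimizers_subset[of w A c] by (intro sum.mono_neutral_right) auto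
    ultimately have "(\<Sum>i\<in>A. \<kappa> ?S i * w0 i) + \<delta> * (\<Sum>i\<in>A. \<kappa> ?S i * g i) = 0"
      by (simp add: w_def algebra_simps sum.distrib sum_distrib_left)
    then have "\<delta> = bad ?S" using g(2)[OF S] by (simp add: bad_def field_simps)
    then show False using \<delta> S by blast
  qed
  ultimately show ?thesis by blast
qed

text \<open>A linear functional is prescribed on the differences to one point and represented as an
  inner product. Later it levels the lifted vertices of a simplex.\<close>

lemma affine_independent_interpolation:
  fixes M :: "'a::euclidean_space set"
  assumes "\<not> affine_dependent M"
  shows "\<exists>d k. \<forall>p\<in>M. d \<bullet> p = k + h p"
proof (cases "M = {}")
  case False
  then obtain p0 where p0: "p0 \<in> M" by blast
  have ind: "independent ((\<lambda>p. p - p0) ` (M - {p0}))"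
    using assms affine_dependent_iff_dependent2[OF p0] by simp
  obtain L where L: "linear L" "\<And>v. v \<in> (\<lambda>p. p - p0) ` (M - {p0}) \<Longrightarrow> L v = h (p0 + v) - h p0"
    using linear_independent_extend[OF ind, of "\<lambda>v. h (p0 + v) - h p0"] by blast
  define d where "d = adjoint L 1"
  have d: "d \<bullet> v = L v" for v
    using adjoint_works[OF L(1), of v 1] by (simp add: d_def inner_commute)
  have "d \<bullet> p = (d \<bullet> p0 - h p0) + h p" if "p \<in> M" for p
  proof (cases "p = p0")
    case False
    then have "d \<bullet> (p - p0) = h p - h p0" using L(2)[of "p - p0"] that by (simp add: d)
    then show ?thesis by (simp add: inner_diff_right)
  qed simp
  then show ?thesis by blast
qed simp

text \<open>If a spanning simplex \<open>M\<close> lies in no cell of \<open>w0\<close>, some point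
  of \<open>A\<close> is lifted strictly below the affine function interpolating \<open>w0\<close>
  on \<open>M\<close>. There are finitely many such defects, so all of them survive a small
  perturbation, and \<open>M\<close> is no cell of the perturbed weight.\<close>

lemma perturbation_refines:
  fixes w0 :: "'a::euclidean_space \<Rightarrow> real"
  assumes A: "finite A"
  shows "\<exists>\<epsilon>>0. \<forall>w c. (\<forall>p\<in>A. \<bar>w p - w0 p\<bar> < \<epsilon>) \<longrightarrow>
    affine hull (minimizers w A c) = affine hull A \<longrightarrow> \<not> affine_dependent (minimizers w A c) \<longrightarrow>
    (\<exists>c0. minimizers w A c \<subseteq> minimizers w0 A c0)"
proof -
  define Sp where "Sp = {M. M \<subseteq> A \<and> affine hull M = affine hull A}"
  have "\<exists>\<kappa>. sum \<kappa> M = 1 \<and> (\<Sum>p\<in>M. \<kappa> p *\<^sub>R p) = q" if "M \<in> Sp" "q \<in> A" for M q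
  proof -
    have "finite M" using that A finite_subset by (auto simp: Sp_def)
    moreover have "q \<in> affine hull M" using that hull_inc[of q A affine] by (simp add: Sp_def)
    ultimately show ?thesis using affine_hull_finite by auto
  qed
  then have "\<forall>x\<in>Sp \<times> A. \<exists>\<kappa>. sum \<kappa> (fst x) = 1 \<and> (\<Sum>p\<in>fst x. \<kappa> p *\<^sub>R p) = snd x" by auto
  from bchoice[OF this] obtain K' where K': "\<forall>x\<in>Sp \<times> A. sum (K' x) (fst x) = 1 \<and> (\<Sum>p\<in>fst x. K' x p *\<^sub>R p) = snd x"
    by blast
  define K where "K M q = K' (M, q)" for M q
  have K: "\<And>M q. M \<in> Sp \<Longrightarrow> q \<in> A \<Longrightarrow> sum (K M q) M = 1"
      "\<And>M q. M \<in> Sp \<Longrightarrow> q \<in> A \<Longrightarrow> (\<Sum>p\<in>M. K M q p *\<^sub>R p) = q"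
    using K' by (auto simp: K_def)
  \<comment> \<open>\<open>g (M, q)\<close> is the height of \<open>q\<close> above the affine
    interpolation on \<open>M\<close>; \<open>N\<close> bounds the change of this height per unit of
    perturbation.\<close>
  define g where "g = (\<lambda>(M, q). w0 q - (\<Sum>p\<in>M. K M q p * w0 p))"
  define N where "N = (\<lambda>(M, q). 1 + (\<Sum>p\<in>M. \<bar>K M q p\<bar>))"
  have N: "N x > 0" for x by (cases x) (auto simp: N_def intro!: add_pos_nonneg sum_nonneg)
  define J where "J = {x\<in>Sp \<times> A. g x < 0}"
  have "finite Sp" using A by (simp add: Sp_def)
  then have "finite J" using A by (simp add: J_def)
  moreover have "- g x / N x > 0" if "x \<in> J" for x using that N[of x] by (simp add: J_def divide_neg_pos)
  ultimately obtain \<epsilon> where \<epsilon>: "\<epsilon> > 0" "\<And>x. x \<in> J \<Longrightarrow> \<epsilon> \<le> - g x / N x"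
    using finite_pos_lower_bound[of J "\<lambda>x. - g x / N x"] by blast
  have "\<exists>c0. minimizers w A c \<subseteq> minimizers w0 A c0"
    if w: "\<And>p. p \<in> A \<Longrightarrow> \<bar>w p - w0 p\<bar> < \<epsilon>" and sp: "affine hull (minimizers w A c) = affine hull A"
      and ind: "\<not> affine_dependent (minimizers w A c)" for w c
  proof -
    let ?M = "minimizers w A c"
    have M: "?M \<in> Sp" using sp minimizers_subset[of w A c] by (simp add: Sp_def)
    have g0: "g (?M, q) \<ge> 0" if q: "q \<in> A" for q
    proof (rule ccontr)
      assume neg: "\<not> ?thesis"
      let ?K = "K ?M q"
      have "?M \<noteq> {}" using K(1)[OF M q] by auto
      then obtain p0 where p0: "p0 \<in> ?M" by blast
      have 1: "(\<Sum>p\<in>?M. ?K p * w p) \<le> w q"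
        using sum_minimizers[OF p0 subset_refl, of ?K] K[OF M q] minimizers_le[OF p0 q] by simp
      have "(\<Sum>p\<in>?M. ?K p * w0 p) - (\<Sum>p\<in>?M. ?K p * w p) = (\<Sum>p\<in>?M. ?K p * (w0 p - w p))"
        by (simp add: right_diff_distrib sum_subtractf)
      also have "\<dots> \<le> (\<Sum>p\<in>?M. \<bar>?K p\<bar> * \<epsilon>)"
      proof (rule sum_mono)
        fix p assume "p \<in> ?M"
        then have "\<bar>w0 p - w p\<bar> \<le> \<epsilon>" using w[of p] minimizers_subset[of w A c] by (force simp: abs_minus_commute)
        then have "\<bar>?K p\<bar> * \<bar>w0 p - w p\<bar> \<le> \<bar>?K p\<bar> * \<epsilon>" by (intro mult_left_mono) auto
        then show "?K p * (w0 p - w p) \<le> \<bar>?K p\<bar> * \<epsilon>"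
          using abs_ge_self[of "?K p * (w0 p - w p)"] by (simp add: abs_mult)
      qed
      finally have "(\<Sum>p\<in>?M. ?K p * w0 p) - w0 q < \<epsilon> * N (?M, q)"
        using 1 w[OF q] by (simp add: N_def algebra_simps sum_distrib_left)
      moreover have "\<epsilon> * N (?M, q) \<le> - g (?M, q)"
      proof -
        have "\<epsilon> \<le> - g (?M, q) / N (?M, q)" using \<epsilon>(2)[of "(?M, q)"] neg M q by (simp add: J_def)
        then show ?thesis using pos_le_divide_eq[OF N[of "(?M, q)"]] by blast
      qed
      ultimately show False by (simp add: g_def)
    qed
    obtain d k where d: "\<And>p. p \<in> ?M \<Longrightarrow> d \<bullet> p = k + - w0 p"
      using affine_independent_interpolation[OF ind, of "\<lambda>p. - w0 p"] by auto
    have val: "d \<bullet> q + w0 q = k + g (?M, q)" if q: "q \<in> A" for q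
    proof -
      have "d \<bullet> q = (\<Sum>p\<in>?M. K ?M q p * (d \<bullet> p))"
        by (subst (1) K(2)[OF M q, symmetric]) (simp add: inner_sum_right)
      also have "\<dots> = (\<Sum>p\<in>?M. K ?M q p * k - K ?M q p * w0 p)"
        using d by (intro sum.cong) (simp_all add: right_diff_distrib)
      also have "\<dots> = k - (\<Sum>p\<in>?M. K ?M q p * w0 p)"
        using K(1)[OF M q] by (simp add: sum_subtractf flip: sum_distrib_right)
      finally show ?thesis by (simp add: g_def)
    qed
    have "?M \<subseteq> minimizers w0 A d"
      using val g0 d minimizers_subset[of w A c] by (auto simp: minimizers_def[of w0 A d])
    then show ?thesis by blast
  qed
  then show ?thesis using \<epsilon>(1) by blast
qed

text \<open>Reduces unimodularity of a generic refinement to a check on the cells of the explicit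
  weight \<open>w0\<close>.\<close>

lemma ex_unimodular_weight:
  fixes A :: "'a::euclidean_space set"
  assumes A: "finite A"
    and uni: "\<And>c0 M. M \<subseteq> minimizers w0 A c0 \<Longrightarrow> affine hull M = affine hull A \<Longrightarrow>
      \<not> affine_dependent M \<Longrightarrow> unimodular_vertices M"
  shows "\<exists>w. unimodular_weight w A"
proof -
  obtain \<epsilon> where \<epsilon>: "\<epsilon> > 0" "\<And>w c. \<lbrakk>\<forall>p\<in>A. \<bar>w p - w0 p\<bar> < \<epsilon>;
    affine hull (minimizers w A c) = affine hull A; \<not> affine_dependent (minimizers w A c)\<rbrakk> \<Longrightarrow>
    \<exists>c0. minimizers w A c \<subseteq> minimizers w0 A c0"
    using perturbation_refines[OF A, of w0] by blast
  obtain w where w: "\<forall>p\<in>A. \<bar>w p - w0 p\<bar> < \<epsilon>" "\<And>c. \<not> affine_dependent (minimizers w A c)"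
    using generic_perturbation[OF A \<epsilon>(1), of w0] by blast
  have "unimodular_weight w A"
    unfolding unimodular_weight_def using \<epsilon>(2)[OF w(1) _ w(2)] uni w(2) by blast
  then show ?thesis by blast
qed

text \<open>The integer decomposition property: the cell containing \<open>x\<close> is unimodular,
  so \<open>k\<close> times the barycentric coordinates of \<open>x\<close> are nonnegative integers
  with sum \<open>k\<close>.\<close>

lemma unimodular_weight_decomposition:
  fixes P :: "'a::euclidean_space set"
  assumes P: "lattice_polytope P" and w: "unimodular_weight w (P \<inter> integer_points)"
    and x: "x \<in> P" "real k *\<^sub>R x \<in> integer_points" and k: "k > 0"
  shows "\<exists>n. (\<Sum>p\<in>P \<inter> integer_points. n p) = k \<and> (\<Sum>p\<in>P \<inter> integer_points. real (n p) *\<^sub>R p) = real k *\<^sub>R x"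
proof -
  let ?A = "P \<inter> integer_points"
  note A = lattice_polytope_integer_points[OF P]
  have "x \<in> convex hull ?A" using x(1) A(3) by simp
  then obtain c where c: "affine hull (minimizers w ?A c) = affine hull ?A"
      "x \<in> convex hull (minimizers w ?A c)"
    using minimizers_cover[OF A(1)] by blast
  define M where "M = minimizers w ?A c"
  have MA: "M \<subseteq> ?A" unfolding M_def by (rule minimizers_subset)
  have finM: "finite M" using MA A(1) by (rule finite_subset)
  have uM: "unimodular_vertices M" using w c(1) by (simp add: unimodular_weight_def M_def)
  obtain u where u: "\<And>p. p \<in> M \<Longrightarrow> 0 \<le> u p" "sum u M = 1" "(\<Sum>p\<in>M. u p *\<^sub>R p) = x"
    using c(2) convex_hull_finite[OF finM] by (auto simp: M_def)
  obtain p0 where p0: "p0 \<in> M" using u(2) by fastforce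
  \<comment> \<open>\<open>unimodular_vertices\<close> speaks of coefficient sum 1; removing
    \<open>k - 1\<close> copies of the vertex \<open>p0\<close> brings the sum down from
    \<open>k\<close>.\<close>
  define v where "v p = real k * u p - (if p = p0 then real k - 1 else 0)" for p
  have "sum v M = 1"
    using u(2) finM p0 by (simp add: v_def sum_subtractf flip: sum_distrib_left)
  moreover have "(\<Sum>p\<in>M. v p *\<^sub>R p) = real k *\<^sub>R x - real (k - 1) *\<^sub>R p0"
  proof -
    have "(\<Sum>p\<in>M. v p *\<^sub>R p) = (\<Sum>p\<in>M. real k *\<^sub>R (u p *\<^sub>R p) - (if p = p0 then (real k - 1) *\<^sub>R p0 else 0))"
      by (intro sum.cong) (auto simp: v_def scaleR_diff_left)
    also have "\<dots> = real k *\<^sub>R x - (real k - 1) *\<^sub>R p0"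
      unfolding u(3)[symmetric] scaleR_sum_right using finM p0 by (simp add: sum_subtractf)
    finally show ?thesis using k by (simp add: of_nat_diff)
  qed
  then have "(\<Sum>p\<in>M. v p *\<^sub>R p) \<in> integer_points"
    using x(2) p0 MA by (auto intro: integer_points_diff integer_points_scale)
  ultimately have "\<forall>p\<in>M. v p \<in> \<int>" using uM unfolding unimodular_vertices_def by blast
  then have int: "real k * u p \<in> \<int>" if "p \<in> M" for p
  proof -
    have "v p \<in> \<int>" using \<open>\<forall>p\<in>M. v p \<in> \<int>\<close> that by blast
    then have "v p + (if p = p0 then real k - 1 else 0) \<in> \<int>" by (intro Ints_add) auto
    then show ?thesis by (simp add: v_def)
  qed
  define n where "n p = (if p \<in> M then nat \<lfloor>real k * u p\<rfloor> else 0)" for p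
  have n: "real (n p) = real k * u p" if "p \<in> M" for p
    using int[OF that] u(1)[OF that] that by (auto simp: n_def elim!: Ints_cases)
  have "real (\<Sum>p\<in>?A. n p) = (\<Sum>p\<in>M. real (n p))"
    unfolding of_nat_sum using A(1) MA by (intro sum.mono_neutral_right) (auto simp: n_def)
  also have "\<dots> = real k" using n u(2) by (simp flip: sum_distrib_left)
  finally have 1: "(\<Sum>p\<in>?A. n p) = k" by (simp only: of_nat_eq_iff)
  have "(\<Sum>p\<in>?A. real (n p) *\<^sub>R p) = (\<Sum>p\<in>M. real (n p) *\<^sub>R p)"
    using A(1) MA by (intro sum.mono_neutral_right) (auto simp: n_def)
  also have "\<dots> = (\<Sum>p\<in>M. real k *\<^sub>R (u p *\<^sub>R p))" using n by (intro sum.cong) auto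
  also have "\<dots> = real k *\<^sub>R x" unfolding u(3)[symmetric] scaleR_sum_right ..
  finally show ?thesis using 1 by blast
qed

section \<open>Forests in bipartite multigraphs\<close>

lemma homogeneous_system_nontrivial_solution:
  fixes c :: "'j \<Rightarrow> 'i \<Rightarrow> real"
  assumes "finite J" "finite I" "card J < card I"
  shows "\<exists>x. (\<exists>i\<in>I. x i \<noteq> 0) \<and> (\<forall>j\<in>J. (\<Sum>i\<in>I. c j i * x i) = 0)"
  using assms
proof (induction J arbitrary: I c rule: finite_induct)
  case empty
  then have "I \<noteq> {}" by auto
  then show ?case by (intro exI[of _ "\<lambda>_. 1"]) auto
next
  case (insert j J)
  show ?case
  proof (cases "\<forall>i\<in>I. c j i = 0")
    case True
    have "card J < card I" using insert.prems insert.hyps by simp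
    then obtain x where "\<exists>i\<in>I. x i \<noteq> 0" "\<forall>j\<in>J. (\<Sum>i\<in>I. c j i * x i) = 0"
      using insert.IH[OF insert.prems(1), of c] by blast
    then show ?thesis using True by (intro exI[of _ x]) simp
  next
    case False
    then obtain i0 where i0: "i0 \<in> I" "c j i0 \<noteq> 0" by blast
    define I' where "I' = I - {i0}"
    \<comment> \<open>Gaussian elimination: equation \<open>j\<close> is solved for the variable
      \<open>i0\<close> and substituted into the others.\<close>
    define c' where "c' k i = c k i - c k i0 * c j i / c j i0" for k i
    have "finite I'" "card J < card I'" using insert i0 by (auto simp: I'_def)
    then obtain y where y: "\<exists>i\<in>I'. y i \<noteq> 0" "\<forall>k\<in>J. (\<Sum>i\<in>I'. c' k i * y i) = 0"
      using insert.IH[of I' c'] by blast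
    define s where "s = (\<Sum>i\<in>I'. c j i * y i) / c j i0"
    define x where "x i = (if i = i0 then - s else y i)" for i
    have sumx: "(\<Sum>i\<in>I. c k i * x i) = (\<Sum>i\<in>I'. c k i * y i) - c k i0 * s" for k
    proof -
      have "(\<Sum>i\<in>I. c k i * x i) = c k i0 * x i0 + (\<Sum>i\<in>I'. c k i * x i)"
        unfolding I'_def using insert.prems(1) i0(1) by (rule sum.remove)
      also have "(\<Sum>i\<in>I'. c k i * x i) = (\<Sum>i\<in>I'. c k i * y i)"
        by (intro sum.cong) (auto simp: x_def I'_def)
      finally show ?thesis by (simp add: x_def)
    qed
    have "(\<Sum>i\<in>I'. c k i * y i) - c k i0 * s = 0" if "k \<in> J" for k
    proof -
      have "(\<Sum>i\<in>I'. c' k i * y i) = (\<Sum>i\<in>I'. c k i * y i) - (\<Sum>i\<in>I'. c k i0 * (c j i * y i) / c j i0)"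
        by (simp add: c'_def left_diff_distrib sum_subtractf mult.assoc)
      also have "(\<Sum>i\<in>I'. c k i0 * (c j i * y i) / c j i0) = c k i0 * s"
        by (simp add: s_def sum_distrib_left sum_divide_distrib)
      finally show ?thesis using y(2) that by simp
    qed
    moreover have "(\<Sum>i\<in>I'. c j i * y i) - c j i0 * s = 0" using i0(2) by (simp add: s_def)
    ultimately have "\<forall>k\<in>insert j J. (\<Sum>i\<in>I. c k i * x i) = 0" by (simp add: sumx)
    moreover have "\<exists>i\<in>I. x i \<noteq> 0" using y(1) by (auto simp: x_def I'_def)
    ultimately show ?thesis by blast
  qed
qed

text \<open>The elements of \<open>M\<close> are the edges of a bipartite multigraph, \<open>m\<close> joining \<open>a m\<close> to \<open>b m\<close>. If its
  edge vectors are linearly independent (the graph is a forest), then an edge weight with integral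
  vertex sums is integral: otherwise the edges of nonintegral weight would form a nonempty subgraph
  of minimum degree at least two, which has too many edges to be independent.\<close>

lemma forest_weight_Ints:
  fixes a :: "'m \<Rightarrow> 'x" and b :: "'m \<Rightarrow> 'y" and u :: "'m \<Rightarrow> real"
  assumes M: "finite M"
    and forest: "\<And>\<mu>. \<lbrakk>\<And>x. (\<Sum>m | m \<in> M \<and> a m = x. \<mu> m) = 0; \<And>y. (\<Sum>m | m \<in> M \<and> b m = y. \<mu> m) = 0\<rbrakk>
      \<Longrightarrow> \<forall>m\<in>M. \<mu> m = (0::real)"
    and int: "\<And>x. (\<Sum>m | m \<in> M \<and> a m = x. u m) \<in> \<int>" "\<And>y. (\<Sum>m | m \<in> M \<and> b m = y. u m) \<in> \<int>"
  shows "\<forall>m\<in>M. u m \<in> \<int>"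
proof (rule ccontr)
  assume neg: "\<not> ?thesis"
  define N where "N = {m\<in>M. u m \<notin> \<int>}"
  have N: "finite N" "N \<noteq> {}" "N \<subseteq> M" using M neg by (auto simp: N_def)
  \<comment> \<open>A single edge of nonintegral weight at a vertex would make the vertex sum
    nonintegral, so every vertex met by \<open>N\<close> has degree at least 2 in
    \<open>N\<close>.\<close>
  have deg: "card {m\<in>N. g m = g m0} \<ge> 2" if m0: "m0 \<in> N"
    and g: "(\<Sum>m | m \<in> M \<and> g m = g m0. u m) \<in> \<int>" for m0 and g :: "'m \<Rightarrow> 'z"
  proof (rule ccontr)
    assume "\<not> ?thesis"
    then have c1: "card {m\<in>N. g m = g m0} \<le> 1" by simp
    have sub: "{m\<in>N. g m = g m0} \<subseteq> {m0}"
      using card_le_Suc0_iff_eq[of "{m\<in>N. g m = g m0}"] N(1) c1 m0 by auto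
    let ?F = "{m. m \<in> M \<and> g m = g m0}"
    have "(\<Sum>m\<in>?F. u m) = u m0 + (\<Sum>m\<in>?F - {m0}. u m)"
      using M N(3) m0 by (intro sum.remove) auto
    moreover have "(\<Sum>m\<in>?F - {m0}. u m) \<in> \<int>" using sub by (intro Ints_sum) (auto simp: N_def)
    ultimately have "u m0 \<in> \<int>" using g Ints_diff by fastforce
    then show False using m0 by (simp add: N_def)
  qed
  have cardge: "card N \<ge> 2 * card (g ` N)" if g: "\<And>z. (\<Sum>m | m \<in> M \<and> g m = z. u m) \<in> \<int>"
    for g :: "'m \<Rightarrow> 'z"
  proof -
    have "2 * card (g ` N) = (\<Sum>z\<in>g ` N. 2)" by simp
    also have "\<dots> \<le> (\<Sum>z\<in>g ` N. card {m\<in>N. g m = z})"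
      using deg[OF _ g] by (intro sum_mono) auto
    also have "\<dots> = card N" using sum.image_gen[OF N(1), of "\<lambda>_. 1::nat" g] by simp
    finally show ?thesis .
  qed
  obtain m1 where m1: "m1 \<in> N" using N by blast
  \<comment> \<open>The equation at \<open>b m1\<close> is omitted: it follows from the others
    because both colour classes give the same total. As \<open>N\<close> has at least twice as many
    edges as either class has vertices, the omission leaves fewer equations than edges.\<close>
  define J where "J = Inl ` (a ` N) \<union> Inr ` (b ` N - {b m1})"
  define c :: "'x + 'y \<Rightarrow> 'm \<Rightarrow> real" where
    "c j m = (case j of Inl x \<Rightarrow> of_bool (a m = x) | Inr y \<Rightarrow> of_bool (b m = y))" for j m
  have "card J < card N"
  proof -
    have "card J \<le> card (a ` N) + card (b ` N - {b m1})"
      unfolding J_def by (rule order_trans[OF card_Un_le]) (use N in \<open>auto intro!: add_mono card_image_le\<close>)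
    moreover have "card (b ` N - {b m1}) < card (b ` N)" using N m1 by (intro card_Diff1_less) auto
    ultimately show ?thesis using cardge[OF int(1)] cardge[OF int(2)] by linarith
  qed
  moreover have "finite J" using N by (simp add: J_def)
  ultimately obtain x where x: "\<exists>m\<in>N. x m \<noteq> 0" "\<And>j. j \<in> J \<Longrightarrow> (\<Sum>m\<in>N. c j m * x m) = 0"
    using homogeneous_system_nontrivial_solution[of J N c] N(1) by blast
  define \<mu> where "\<mu> m = (if m \<in> N then x m else 0)" for m
  have filt: "(\<Sum>m | m \<in> N \<and> g m = z. x m) = (\<Sum>m\<in>N. of_bool (g m = z) * x m)" for g :: "'m \<Rightarrow> 'z" and z
    using N(1) by (intro sum.mono_neutral_cong_left) auto
  have restrict: "(\<Sum>m | m \<in> M \<and> g m = z. \<mu> m) = (\<Sum>m\<in>N. of_bool (g m = z) * x m)" for g :: "'m \<Rightarrow> 'z" and z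
  proof -
    have "(\<Sum>m | m \<in> M \<and> g m = z. \<mu> m) = (\<Sum>m | m \<in> N \<and> g m = z. x m)"
      using M N by (intro sum.mono_neutral_cong_right) (auto simp: \<mu>_def)
    then show ?thesis unfolding filt .
  qed
  have A: "(\<Sum>m\<in>N. of_bool (a m = z) * x m) = 0" for z
  proof (cases "z \<in> a ` N")
    case True
    then show ?thesis using x(2)[of "Inl z"] by (simp add: J_def c_def)
  qed (rule sum.neutral, auto)
  have B1: "(\<Sum>m\<in>N. of_bool (b m = z) * x m) = 0" if "z \<noteq> b m1" for z
  proof (cases "z \<in> b ` N")
    case True
    then show ?thesis using x(2)[of "Inr z"] that by (simp add: J_def c_def)
  qed (rule sum.neutral, auto)
  have total: "(\<Sum>m\<in>N. x m) = (\<Sum>z\<in>g ` N. \<Sum>m\<in>N. of_bool (g m = z) * x m)" for g :: "'m \<Rightarrow> 'z"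
    using sum.image_gen[OF N(1), of x g] unfolding filt .
  have "(\<Sum>m\<in>N. x m) = 0" using total[of a] A by simp
  then have "(\<Sum>z\<in>b ` N. \<Sum>m\<in>N. of_bool (b m = z) * x m) = 0" using total[of b] by simp
  moreover have "(\<Sum>z\<in>b ` N. \<Sum>m\<in>N. of_bool (b m = z) * x m)
      = (\<Sum>m\<in>N. of_bool (b m = b m1) * x m) + (\<Sum>z\<in>b ` N - {b m1}. \<Sum>m\<in>N. of_bool (b m = z) * x m)"
    using N(1) m1 by (intro sum.remove) auto
  moreover have "(\<Sum>z\<in>b ` N - {b m1}. \<Sum>m\<in>N. of_bool (b m = z) * x m) = 0"
    using B1 by (intro sum.neutral) auto
  ultimately have B2: "(\<Sum>m\<in>N. of_bool (b m = b m1) * x m) = 0" by linarith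
  have "\<forall>m\<in>M. \<mu> m = 0"
  proof (rule forest)
    show "(\<Sum>m | m \<in> M \<and> a m = z. \<mu> m) = 0" for z unfolding restrict by (rule A)
    show "(\<Sum>m | m \<in> M \<and> b m = z. \<mu> m) = 0" for z unfolding restrict using B1[of z] B2 by (cases "z = b m1") auto
  qed
  moreover obtain m where "m \<in> N" "x m \<noteq> 0" using x(1) by blast
  ultimately show False using N(3) by (force simp: \<mu>_def)
qed

section \<open>Cayley and Minkowski sums\<close>

lemma integer_points_Pair [simp]:
  "(t, x) \<in> (integer_points :: ('a::euclidean_space \<times> 'b::euclidean_space) set) \<longleftrightarrow>
    t \<in> integer_points \<and> x \<in> integer_points"
  by (simp add: integer_points_def Basis_prod_def ball_Un)

lemma integer_points_real [simp]: "(integer_points :: real set) = \<int>"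
  by (auto simp: integer_points_def)

lemma cayley_sum_iff:
  fixes P Q :: "'a::euclidean_space set"
  assumes "convex P" "P \<noteq> {}" "convex Q" "Q \<noteq> {}"
  shows "(t, x) \<in> cayley_sum P Q \<longleftrightarrow> 0 \<le> t \<and> t \<le> 1 \<and> (\<exists>p\<in>P. \<exists>q\<in>Q. x = t *\<^sub>R p + (1 - t) *\<^sub>R q)"
proof -
  have "cayley_sum P Q = {u *\<^sub>R s + v *\<^sub>R t | u v s t. u \<ge> 0 \<and> v \<ge> 0 \<and> u + v = 1 \<and> s \<in> {1::real} \<times> P \<and> t \<in> {0::real} \<times> Q}"
    unfolding cayley_sum_def using assms by (intro convex_hull_union_two) (auto intro: convex_Times)
  also have "(t, x) \<in> \<dots> \<longleftrightarrow> 0 \<le> t \<and> t \<le> 1 \<and> (\<exists>p\<in>P. \<exists>q\<in>Q. x = t *\<^sub>R p + (1 - t) *\<^sub>R q)" (is "?l \<longleftrightarrow> ?r")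
  proof
    assume ?l
    then obtain v s q where "t \<ge> 0" "v \<ge> 0" "t + v = 1" "s \<in> P" "q \<in> Q" "x = t *\<^sub>R s + v *\<^sub>R q" by auto
    moreover from this have "v = 1 - t" by simp
    ultimately show ?r by auto
  next
    assume ?r
    then obtain p q where pq: "0 \<le> t" "t \<le> 1" "p \<in> P" "q \<in> Q" "x = t *\<^sub>R p + (1 - t) *\<^sub>R q" by blast
    then have "(t, x) = t *\<^sub>R (1, p) + (1 - t) *\<^sub>R (0, q)" by simp
    then show ?l using pq by (intro CollectI exI[of _ t] exI[of _ "1 - t"] exI[of _ "(1, p)"] exI[of _ "(0, q)"]) auto
  qed
  finally show ?thesis .
qed

lemma lattice_polytope_convex: "lattice_polytope P \<Longrightarrow> convex P"
  by (auto simp: lattice_polytope_def)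

lemma lattice_polytope_nonempty: "lattice_polytope P \<Longrightarrow> P \<noteq> {}"
  by (auto simp: lattice_polytope_def)

lemma cayley_sum_convex_hull:
  "cayley_sum (convex hull V) (convex hull W) = convex hull ({1} \<times> V \<union> {0} \<times> W)"
proof -
  have "convex hull ({1::real} \<times> V) = {1} \<times> (convex hull V)" "convex hull ({0::real} \<times> W) = {0} \<times> (convex hull W)"
    by (simp_all add: convex_hull_Times)
  then show ?thesis unfolding cayley_sum_def using hull_Un_left[of convex] hull_Un_right[of convex] by metis
qed

lemma lattice_polytope_cayley_sum:
  assumes "lattice_polytope P" "lattice_polytope Q"
  shows "lattice_polytope (cayley_sum P Q)"
proof -
  obtain V where V: "finite V" "V \<noteq> {}" "V \<subseteq> integer_points" "P = convex hull V"
    using assms(1) unfolding lattice_polytope_def by blast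
  obtain W where W: "finite W" "W \<noteq> {}" "W \<subseteq> integer_points" "Q = convex hull W"
    using assms(2) unfolding lattice_polytope_def by blast
  show ?thesis unfolding V(4) W(4) cayley_sum_convex_hull lattice_polytope_def
    using V(1-3) W(1-3) by (intro exI[of _ "{1} \<times> V \<union> {0} \<times> W"]) auto
qed

text \<open>The first coordinate is an integer between 0 and 1, so a lattice point lies at one of
  the two ends.\<close>

lemma cayley_sum_integer_points:
  assumes "lattice_polytope P" "lattice_polytope Q"
  shows "cayley_sum P Q \<inter> integer_points = {1} \<times> (P \<inter> integer_points) \<union> {0} \<times> (Q \<inter> integer_points)"
proof -
  note iff = cayley_sum_iff[OF lattice_polytope_convex[OF assms(1)] lattice_polytope_nonempty[OF assms(1)]
      lattice_polytope_convex[OF assms(2)] lattice_polytope_nonempty[OF assms(2)]]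
  have ne: "P \<noteq> {}" "Q \<noteq> {}" using assms by (auto simp: lattice_polytope_nonempty)
  have "(t, x) \<in> cayley_sum P Q \<inter> integer_points \<longleftrightarrow> (t, x) \<in> {1} \<times> (P \<inter> integer_points) \<union> {0} \<times> (Q \<inter> integer_points)" for t x
  proof
    assume l: "(t, x) \<in> cayley_sum P Q \<inter> integer_points"
    then have "0 \<le> t" "t \<le> 1" "t \<in> \<int>" by (auto simp: iff)
    then have "t = 0 \<or> t = 1" by (auto elim!: Ints_cases)
    then show "(t, x) \<in> {1} \<times> (P \<inter> integer_points) \<union> {0} \<times> (Q \<inter> integer_points)"
      using l by (auto simp: iff)
  next
    assume "(t, x) \<in> {1} \<times> (P \<inter> integer_points) \<union> {0} \<times> (Q \<inter> integer_points)"
    then show "(t, x) \<in> cayley_sum P Q \<inter> integer_points" using ne by (auto simp: iff)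
  qed
  then show ?thesis by (intro set_eqI) (simp only: split_paired_all)
qed

lemma sum_cayley:
  fixes g :: "real \<times> 'a \<Rightarrow> 'c::comm_monoid_add"
  assumes "finite A" "finite B"
  shows "(\<Sum>p\<in>{1} \<times> A \<union> {0} \<times> B. g p) = (\<Sum>a\<in>A. g (1, a)) + (\<Sum>b\<in>B. g (0, b))"
proof -
  have "{1::real} \<times> A = Pair 1 ` A" "{0::real} \<times> B = Pair 0 ` B" by auto
  then have "(\<Sum>p\<in>{1} \<times> A. g p) = (\<Sum>a\<in>A. g (1, a))" "(\<Sum>p\<in>{0} \<times> B. g p) = (\<Sum>b\<in>B. g (0, b))"
    by (simp_all add: sum.reindex inj_on_def)
  moreover have "(\<Sum>p\<in>{1} \<times> A \<union> {0} \<times> B. g p) = (\<Sum>p\<in>{1} \<times> A. g p) + (\<Sum>p\<in>{0} \<times> B. g p)"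
    using assms by (intro sum.union_disjoint) auto
  ultimately show ?thesis by simp
qed

text \<open>Integer decomposition applied to \<open>(1, z)\<close> in the second dilate: comparing
  first coordinates, exactly one summand comes from each end.\<close>

lemma cayley_weight_lattice_points_add:
  fixes P Q :: "'a::euclidean_space set"
  assumes P: "lattice_polytope P" and Q: "lattice_polytope Q"
    and w: "unimodular_weight w (cayley_sum P Q \<inter> integer_points)"
  shows "(P \<inter> integer_points) + (Q \<inter> integer_points) = (P + Q) \<inter> integer_points"
proof
  show "(P \<inter> integer_points) + (Q \<inter> integer_points) \<subseteq> (P + Q) \<inter> integer_points"
    by (auto simp: set_plus_def integer_points_add)
  show "(P + Q) \<inter> integer_points \<subseteq> (P \<inter> integer_points) + (Q \<inter> integer_points)"
  proof
    fix z assume z: "z \<in> (P + Q) \<inter> integer_points"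
    then obtain p q where pq: "p \<in> P" "q \<in> Q" "z = p + q" by (auto simp: set_plus_def)
    let ?A = "P \<inter> integer_points" and ?B = "Q \<inter> integer_points"
    have finAB: "finite ?A" "finite ?B" using lattice_polytope_integer_points P Q by blast+
    have "(1/2, (1/2) *\<^sub>R z) \<in> cayley_sum P Q"
      unfolding cayley_sum_iff[OF lattice_polytope_convex[OF P] lattice_polytope_nonempty[OF P]
        lattice_polytope_convex[OF Q] lattice_polytope_nonempty[OF Q]]
      using pq(1,2) by (intro conjI bexI[of _ p] bexI[of _ q]) (simp_all add: pq(3) scaleR_add_right)
    moreover have "real 2 *\<^sub>R (1/2::real, (1/2) *\<^sub>R z) \<in> integer_points" using z by simp
    ultimately obtain n where n: "(\<Sum>p\<in>{1} \<times> ?A \<union> {0} \<times> ?B. n p) = 2"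
        "(\<Sum>p\<in>{1} \<times> ?A \<union> {0} \<times> ?B. real (n p) *\<^sub>R p) = real 2 *\<^sub>R (1/2::real, (1/2) *\<^sub>R z)"
      using unimodular_weight_decomposition[OF lattice_polytope_cayley_sum[OF P Q] w, of "(1/2, (1/2) *\<^sub>R z)" 2]
      unfolding cayley_sum_integer_points[OF P Q] by auto
    note split = sum_cayley[OF finAB]
    have fstn: "(\<Sum>a\<in>?A. real (n (1, a))) = 1"
      using arg_cong[OF n(2), of fst] by (simp add: split fst_sum)
    then have nA: "(\<Sum>a\<in>?A. n (1, a)) = 1" by (simp flip: of_nat_sum)
    then have nB: "(\<Sum>b\<in>?B. n (0, b)) = 1" using n(1) by (simp add: split)
    have "\<exists>a\<in>?A. n (1, a) = 1 \<and> (\<forall>a'\<in>?A. a \<noteq> a' \<longrightarrow> n (1, a') = 0)"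
      using nA by (rule sum_eq_1_iff[OF finAB(1), THEN iffD1])
    then obtain a where a: "a \<in> ?A" "n (1, a) = 1" "\<forall>a'\<in>?A. a \<noteq> a' \<longrightarrow> n (1, a') = 0" by (elim bexE conjE)
    have "\<exists>b\<in>?B. n (0, b) = 1 \<and> (\<forall>b'\<in>?B. b \<noteq> b' \<longrightarrow> n (0, b') = 0)"
      using nB by (rule sum_eq_1_iff[OF finAB(2), THEN iffD1])
    then obtain b where b: "b \<in> ?B" "n (0, b) = 1" "\<forall>b'\<in>?B. b \<noteq> b' \<longrightarrow> n (0, b') = 0" by (elim bexE conjE)
    have "z = (\<Sum>a\<in>?A. real (n (1, a)) *\<^sub>R a) + (\<Sum>b\<in>?B. real (n (0, b)) *\<^sub>R b)"
      using arg_cong[OF n(2), of snd] by (simp add: split snd_sum)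
    also have "(\<Sum>a\<in>?A. real (n (1, a)) *\<^sub>R a) = a"
    proof -
      have "(\<Sum>a'\<in>?A - {a}. real (n (1, a')) *\<^sub>R a') = 0" using a(3) by (intro sum.neutral) auto
      then show ?thesis
        using sum.remove[OF finAB(1) a(1), of "\<lambda>a. real (n (1, a)) *\<^sub>R a"] a(2) by simp
    qed
    also have "(\<Sum>b\<in>?B. real (n (0, b)) *\<^sub>R b) = b"
    proof -
      have "(\<Sum>b'\<in>?B - {b}. real (n (0, b')) *\<^sub>R b') = 0" using b(3) by (intro sum.neutral) auto
      then show ?thesis
        using sum.remove[OF finAB(2) b(1), of "\<lambda>b. real (n (0, b)) *\<^sub>R b"] b(2) by simp
    qed
    finally show "z \<in> ?A + ?B" using a(1) b(1) by (auto simp: set_plus_def)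
  qed
qed

lemma sum_fibers_scaleR:
  fixes g :: "'m \<Rightarrow> 'v::real_vector"
  assumes "finite M" "finite X" "g ` M \<subseteq> X"
  shows "(\<Sum>x\<in>X. (\<Sum>m | m \<in> M \<and> g m = x. u m) *\<^sub>R x) = (\<Sum>m\<in>M. u m *\<^sub>R g m)"
proof -
  have "(\<Sum>x\<in>X. (\<Sum>m | m \<in> M \<and> g m = x. u m) *\<^sub>R x) = (\<Sum>x\<in>X. \<Sum>m | m \<in> M \<and> g m = x. u m *\<^sub>R g m)"
    by (intro sum.cong refl) (auto simp: scaleR_sum_left intro: sum.cong)
  also have "\<dots> = (\<Sum>m\<in>M. u m *\<^sub>R g m)" by (rule sum.group[OF assms])
  finally show ?thesis .
qed

text \<open>The Cayley trick. A cell of the lift of the Cayley sum with vertices \<open>{1} \<times> N1 \<union> {0} \<times> N2\<close>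
  corresponds to the mixed cell \<open>N1 + N2\<close>, and a simplex with vertices in \<open>N1 + N2\<close> is a spanning
  forest of the complete bipartite graph on \<open>N1\<close> and \<open>N2\<close>.\<close>

lemma cayley_weight_minkowski_sum:
  fixes P Q :: "'a::euclidean_space set"
  assumes P: "lattice_polytope P" and Q: "lattice_polytope Q"
    and w: "unimodular_weight w (cayley_sum P Q \<inter> integer_points)"
  shows "\<exists>w'. unimodular_weight w' ((P + Q) \<inter> integer_points)"
proof -
  define A where "A = P \<inter> integer_points"
  define B where "B = Q \<inter> integer_points"
  define C where "C = {1::real} \<times> A \<union> {0} \<times> B"
  have C: "cayley_sum P Q \<inter> integer_points = C"
    unfolding cayley_sum_integer_points[OF P Q] A_def B_def C_def ..
  have AB: "A + B = (P + Q) \<inter> integer_points"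
    unfolding A_def B_def by (rule cayley_weight_lattice_points_add[OF P Q w])
  have fin: "finite A" "finite B" "A \<noteq> {}" "B \<noteq> {}"
    using lattice_polytope_integer_points(1,2)[OF P] lattice_polytope_integer_points(1,2)[OF Q]
    by (simp_all add: A_def B_def)
  have finC: "finite C" using fin by (simp add: C_def)
  define D where "D z = (\<lambda>(a, b). w (1, a) + w (0, b)) ` {(a, b)\<in>A \<times> B. a + b = z}" for z
  \<comment> \<open>The weight of a sum is the least total weight over its decompositions, so the
    lower hull of the Minkowski sum is the sum of the two lower hulls.\<close>
  define w' where "w' z = Min (D z)" for z
  have finD: "finite (D z)" for z
    unfolding D_def using fin by (intro finite_imageI) (auto intro: finite_subset[of _ "A \<times> B"])
  have w'_le: "w' (a + b) \<le> w (1, a) + w (0, b)" if "a \<in> A" "b \<in> B" for a b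
    unfolding w'_def using that finD by (intro Min_le) (auto simp: D_def intro!: image_eqI[of _ _ "(a, b)"])
  have w'_ex: "\<exists>a b. a \<in> A \<and> b \<in> B \<and> z = a + b \<and> w' z = w (1, a) + w (0, b)" if "z \<in> A + B" for z
  proof -
    have "D z \<noteq> {}" using that by (auto simp: D_def set_plus_def)
    then have "w' z \<in> D z" unfolding w'_def using finD by (intro Min_in)
    then show ?thesis by (auto simp: D_def)
  qed
  have finAB: "finite (A + B)" using fin by (intro finite_set_plus)
  have "\<exists>w''. unimodular_weight w'' (A + B)"
  proof (rule ex_unimodular_weight[OF finAB])
    fix c0 M
    assume M: "M \<subseteq> minimizers w' (A + B) c0" and span: "affine hull M = affine hull (A + B)"
      and ind: "\<not> affine_dependent M"
    have finM: "finite M" using aff_independent_finite[OF ind] .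
    have MAB: "M \<subseteq> A + B" using M minimizers_subset by blast
    \<comment> \<open>The quantity minimized is additive over optimal decompositions, so minimizers
      in the sum are sums of minimizers in \<open>A\<close> and \<open>B\<close> for the same
      functional.\<close>
    define N1 where "N1 = minimizers (\<lambda>a. w (1, a)) A c0"
    define N2 where "N2 = minimizers (\<lambda>b. w (0, b)) B c0"
    have N1A: "N1 \<subseteq> A" and N2B: "N2 \<subseteq> B" by (simp_all add: N1_def N2_def minimizers_subset)
    have finN: "finite N1" "finite N2" using fin N1A N2B finite_subset by blast+
    obtain a1 where a1: "a1 \<in> N1" using minimizers_nonempty[OF fin(1,3)] unfolding N1_def by blast
    obtain b1 where b1: "b1 \<in> N2" using minimizers_nonempty[OF fin(2,4)] unfolding N2_def by blast
    have a1A: "a1 \<in> A" and b1B: "b1 \<in> B" using a1 b1 N1A N2B by blast+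
    have N1_le: "c0 \<bullet> a1 + w (1, a1) \<le> c0 \<bullet> a + w (1, a)" if "a \<in> A" for a
      using minimizers_le[OF a1[unfolded N1_def] that] .
    have N2_le: "c0 \<bullet> b1 + w (0, b1) \<le> c0 \<bullet> b + w (0, b)" if "b \<in> B" for b
      using minimizers_le[OF b1[unfolded N2_def] that] .
    have N1_iff: "a \<in> N1 \<longleftrightarrow> a \<in> A \<and> c0 \<bullet> a + w (1, a) = c0 \<bullet> a1 + w (1, a1)" for a
      using N1A minimizers_eq[OF _ a1[unfolded N1_def]] minimizers_eqI[OF a1[unfolded N1_def]]
      unfolding N1_def by blast
    have N2_iff: "b \<in> N2 \<longleftrightarrow> b \<in> B \<and> c0 \<bullet> b + w (0, b) = c0 \<bullet> b1 + w (0, b1)" for b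
      using N2B minimizers_eq[OF _ b1[unfolded N2_def]] minimizers_eqI[OF b1[unfolded N2_def]]
      unfolding N2_def by blast
    have "\<exists>ab. fst ab \<in> N1 \<and> snd ab \<in> N2 \<and> m = fst ab + snd ab" if m: "m \<in> M" for m
    proof -
      have mM: "m \<in> minimizers w' (A + B) c0" using m M by blast
      obtain a b where ab: "a \<in> A" "b \<in> B" "m = a + b" "w' m = w (1, a) + w (0, b)"
        using w'_ex m MAB by blast
      have "a1 + b1 \<in> A + B" using a1A b1B by (auto simp: set_plus_def)
      then have "c0 \<bullet> m + w' m \<le> c0 \<bullet> (a1 + b1) + w' (a1 + b1)" by (rule minimizers_le[OF mM])
      then have "c0 \<bullet> a + w (1, a) + (c0 \<bullet> b + w (0, b)) \<le> c0 \<bullet> a1 + w (1, a1) + (c0 \<bullet> b1 + w (0, b1))"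
        using w'_le[OF a1A b1B] unfolding ab(4) by (simp add: ab(3) inner_add_right)
      then have "a \<in> N1" "b \<in> N2" using N1_le[OF ab(1)] N2_le[OF ab(2)] ab by (simp_all add: N1_iff N2_iff)
      then show ?thesis using ab(3) by (intro exI[of _ "(a, b)"]) simp
    qed
    then have "\<forall>m\<in>M. \<exists>ab. fst ab \<in> N1 \<and> snd ab \<in> N2 \<and> m = fst ab + snd ab" by blast
    from bchoice[OF this] obtain f where f: "\<forall>m\<in>M. fst (f m) \<in> N1 \<and> snd (f m) \<in> N2 \<and> m = fst (f m) + snd (f m)" ..
    define fa where "fa m = fst (f m)" for m
    define fb where "fb m = snd (f m)" for m
    have fab: "fa m \<in> N1" "fb m \<in> N2" "fa m + fb m = m" if "m \<in> M" for m
      using f that by (simp_all add: fa_def fb_def)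
    define v0 where "v0 = c0 \<bullet> b1 + w (0, b1)"
    \<comment> \<open>The first component \<open>\<tau>\<close> brings the minimal levels at heights
      1 and 0 to the same value \<open>v0\<close>.\<close>
    define \<tau> where "\<tau> = v0 - (c0 \<bullet> a1 + w (1, a1))"
    define N where "N = {1::real} \<times> N1 \<union> {0} \<times> N2"
    have N: "minimizers w C (\<tau>, c0) = N"
    proof -
      have ge: "v0 \<le> (\<tau>, c0) \<bullet> p + w p" if pC: "p \<in> C" for p
      proof -
        consider a where "a \<in> A" "p = (1, a)" | b where "b \<in> B" "p = (0, b)" using pC by (auto simp: C_def)
        then show ?thesis
        proof cases
          case 1
          then show ?thesis using N1_le[OF 1(1)] by (simp add: \<tau>_def)
        next
          case 2
          then show ?thesis using N2_le[OF 2(1)] by (simp add: v0_def)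
        qed
      qed
      have "(0, b1) \<in> C" "(\<tau>, c0) \<bullet> (0, b1) + w (0, b1) = v0" using b1B by (auto simp: C_def v0_def)
      then have "minimizers w C (\<tau>, c0) = {p\<in>C. (\<tau>, c0) \<bullet> p + w p = v0}"
        using ge by (intro minimizers_level)
      also have "\<dots> = N" by (auto simp: C_def N_def N1_iff N2_iff \<tau>_def v0_def)
      finally show ?thesis .
    qed
    have NC: "N \<subseteq> C" using N1A N2B by (auto simp: N_def C_def)
    have affN: "affine (affine hull N)" by simp
    have "affine hull N = affine hull C"
    proof
      show "affine hull N \<subseteq> affine hull C" using NC by (rule hull_mono)
      \<comment> \<open>The slice of the Cayley sum at height 1/2 is a copy of half the Minkowski
        sum. Since \<open>M\<close> spans, the slice lies in the affine hull of \<open>N\<close>,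
        and extrapolation from \<open>b1\<close> or \<open>a1\<close> through it recovers the points
        at the ends.\<close>
      define h where "h z = (0::real, (1/2) *\<^sub>R z)" for z :: 'a
      have h: "linear h" unfolding h_def by (intro linearI) (auto simp: scaleR_add_right)
      have mid: "(1/2, (1/2) *\<^sub>R z) \<in> affine hull N" if "z \<in> A + B" for z
      proof -
        have "(1/2, (1/2) *\<^sub>R m) \<in> affine hull N" if "m \<in> M" for m
        proof -
          have "(1, fa m) \<in> affine hull N" "(0, fb m) \<in> affine hull N"
            using fab[OF that] by (auto simp: N_def intro: hull_inc)
          from mem_affine[OF affN this, of "1/2" "1/2"] show ?thesis
            using fab(3)[OF that] by (simp flip: scaleR_add_right)
        qed
        then have "(\<lambda>z. (1/2, 0) + h z) ` M \<subseteq> affine hull N" by (auto simp: h_def)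
        then have "affine hull ((\<lambda>z. (1/2, 0) + h z) ` M) \<subseteq> affine hull N"
          by (intro hull_minimal) auto
        then have "(\<lambda>z. (1/2, 0) + h z) ` (affine hull M) \<subseteq> affine hull N"
          unfolding affine_hull_affine_image[OF h] .
        moreover have "z \<in> affine hull M" unfolding span using that by (rule hull_inc)
        ultimately show ?thesis by (auto simp: h_def)
      qed
      have "C \<subseteq> affine hull N"
      proof
        fix p assume "p \<in> C"
        then consider a where "a \<in> A" "p = (1, a)" | b where "b \<in> B" "p = (0, b)" by (auto simp: C_def)
        then show "p \<in> affine hull N"
        proof cases
          case 1
          have "(0, b1) \<in> affine hull N" using b1 by (auto simp: N_def intro: hull_inc)
          moreover have "(1/2, (1/2) *\<^sub>R (a + b1)) \<in> affine hull N"
            using 1 b1B by (intro mid) (auto simp: set_plus_def)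
          ultimately have "2 *\<^sub>R (1/2, (1/2) *\<^sub>R (a + b1)) + (-1) *\<^sub>R (0, b1) \<in> affine hull N"
            by (intro mem_affine[OF affN]) auto
          then show ?thesis by (simp add: 1)
        next
          case 2
          have "(1, a1) \<in> affine hull N" using a1 by (auto simp: N_def intro: hull_inc)
          moreover have "(1/2, (1/2) *\<^sub>R (a1 + b)) \<in> affine hull N"
            using 2 a1A by (intro mid) (auto simp: set_plus_def)
          ultimately have "2 *\<^sub>R (1/2, (1/2) *\<^sub>R (a1 + b)) + (-1) *\<^sub>R (1, a1) \<in> affine hull N"
            by (intro mem_affine[OF affN]) auto
          then show ?thesis by (simp add: 2)
        qed
      qed
      then show "affine hull C \<subseteq> affine hull N" by (rule hull_minimal) simp
    qed
    then have uN: "unimodular_vertices N"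
      using w unfolding C unimodular_weight_def N[symmetric] by blast
    show "unimodular_vertices M"
      unfolding unimodular_vertices_def
    proof (intro conjI allI impI)
      show "\<not> affine_dependent M" by (rule ind)
      fix u assume u1: "sum u M = 1" and ui: "(\<Sum>m\<in>M. u m *\<^sub>R m) \<in> integer_points"
      \<comment> \<open>\<open>u\<close> is an edge weight on the bipartite graph joining
        \<open>fa m\<close> to \<open>fb m\<close>; \<open>r\<close> and \<open>s\<close> are its
        vertex sums.\<close>
      define r where "r a = (\<Sum>m | m \<in> M \<and> fa m = a. u m)" for a
      define s where "s b = (\<Sum>m | m \<in> M \<and> fb m = b. u m)" for b
      have sub: "fa ` M \<subseteq> N1" "fb ` M \<subseteq> N2" using fab by blast+
      have r1: "sum r N1 = 1" "(\<Sum>a\<in>N1. r a *\<^sub>R a) = (\<Sum>m\<in>M. u m *\<^sub>R fa m)"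
        unfolding r_def sum.group[OF finM finN(1) sub(1)] sum_fibers_scaleR[OF finM finN(1) sub(1)] by (simp_all add: u1)
      have s1: "sum s N2 = 1" "(\<Sum>b\<in>N2. s b *\<^sub>R b) = (\<Sum>m\<in>M. u m *\<^sub>R fb m)"
        unfolding s_def sum.group[OF finM finN(2) sub(2)] sum_fibers_scaleR[OF finM finN(2) sub(2)] by (simp_all add: u1)
      have tot: "(\<Sum>m\<in>M. u m *\<^sub>R fa m) + (\<Sum>m\<in>M. u m *\<^sub>R fb m) = (\<Sum>m\<in>M. u m *\<^sub>R m)"
        unfolding sum.distrib[symmetric] using fab(3)
        by (intro sum.cong refl) (simp flip: scaleR_add_right)
      \<comment> \<open>The vertex sums add up to 2 in total, so one unit is taken off at
        \<open>(0, b1)\<close> to obtain an affine combination.\<close>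
      define v where "v p = (if fst p = 1 then r (snd p) else s (snd p) - of_bool (snd p = b1))" for p :: "real \<times> 'a"
      have "sum v N = 1"
        unfolding N_def sum_cayley[OF finN] using r1(1) s1(1) finN b1
        by (simp add: v_def sum_subtractf of_bool_def)
      moreover have "(\<Sum>p\<in>N. v p *\<^sub>R p) = (1, (\<Sum>m\<in>M. u m *\<^sub>R m) - b1)"
      proof -
        have "(\<Sum>b\<in>N2. (s b - of_bool (b = b1)) *\<^sub>R b) = (\<Sum>b\<in>N2. s b *\<^sub>R b) - (\<Sum>b\<in>N2. if b = b1 then b1 else 0)"
          unfolding sum_subtractf[symmetric] by (intro sum.cong) (auto simp: scaleR_diff_left)
        then have "(\<Sum>b\<in>N2. (s b - of_bool (b = b1)) *\<^sub>R b) = (\<Sum>b\<in>N2. s b *\<^sub>R b) - b1"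
          using finN b1 by simp
        then show ?thesis
          unfolding N_def sum_cayley[OF finN] tot[symmetric]
          by (intro prod_eqI) (simp_all add: v_def fst_sum snd_sum r1 s1(2))
      qed
      moreover have "b1 \<in> integer_points" using b1B by (simp add: B_def)
      ultimately have vint: "\<forall>p\<in>N. v p \<in> \<int>"
        using uN ui unfolding unimodular_vertices_def by (simp add: integer_points_diff)
      show "\<forall>m\<in>M. u m \<in> \<int>"
      proof (rule forest_weight_Ints[OF finM, of fa fb])
        show "(\<Sum>m | m \<in> M \<and> fa m = a. u m) \<in> \<int>" for a
        proof (cases "a \<in> N1")
          case True
          then have "v (1, a) \<in> \<int>" using vint by (auto simp: N_def)
          then show ?thesis by (simp add: v_def r_def)
        next
          case False
          then have "{m. m \<in> M \<and> fa m = a} = {}" using fab by blast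
          then show ?thesis by (simp only: sum.empty Ints_0)
        qed
        show "(\<Sum>m | m \<in> M \<and> fb m = b. u m) \<in> \<int>" for b
        proof (cases "b \<in> N2")
          case True
          then have "v (0, b) \<in> \<int>" using vint by (auto simp: N_def)
          then have "s b - of_bool (b = b1) + of_bool (b = b1) \<in> \<int>" unfolding v_def by (intro Ints_add) auto
          then show ?thesis by (simp add: s_def)
        next
          case False
          then have "{m. m \<in> M \<and> fb m = b} = {}" using fab by blast
          then show ?thesis by (simp only: sum.empty Ints_0)
        qed
        \<comment> \<open>Vanishing vertex sums make \<open>\<mu>\<close> an affine dependence of
          \<open>M\<close>, which is trivial by independence.\<close>
        fix \<mu> :: "'a \<Rightarrow> real"
        assume za: "\<And>a. (\<Sum>m | m \<in> M \<and> fa m = a. \<mu> m) = 0" and zb: "\<And>b. (\<Sum>m | m \<in> M \<and> fb m = b. \<mu> m) = 0"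
        have "(\<Sum>m\<in>M. \<mu> m *\<^sub>R fa m) = 0" "(\<Sum>m\<in>M. \<mu> m *\<^sub>R fb m) = 0"
          using sum_fibers_scaleR[OF finM finN(1) sub(1), of \<mu>] sum_fibers_scaleR[OF finM finN(2) sub(2), of \<mu>] za zb by simp_all
        moreover         have "(\<Sum>m\<in>M. \<mu> m *\<^sub>R m) = (\<Sum>m\<in>M. \<mu> m *\<^sub>R fa m) + (\<Sum>m\<in>M. \<mu> m *\<^sub>R fb m)"
          unfolding sum.distrib[symmetric] using fab(3)
          by (intro sum.cong refl) (simp flip: scaleR_add_right)
        ultimately have "(\<Sum>m\<in>M. \<mu> m *\<^sub>R m) = 0" by simp
        moreover have "sum \<mu> M = 0" using sum.group[OF finM finN(1) sub(1), of \<mu>] za by simp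
        ultimately show "\<forall>m\<in>M. \<mu> m = 0" using ind affine_dependent_explicit_finite[OF finM] by blast
      qed
    qed
  qed
  then show ?thesis unfolding AB .
qed

text \<open>0 is the midpoint of any relative interior point and its negative.\<close>

lemma zero_in_rel_interior_symmetric:
  fixes S :: "'a::euclidean_space set"
  assumes "convex S" "S \<noteq> {}" "uminus ` S = S"
  shows "0 \<in> rel_interior S"
proof -
  obtain y where y: "y \<in> rel_interior S" using assms rel_interior_eq_empty by blast
  have "rel_interior (uminus ` S) = uminus ` rel_interior S"
    by (rule rel_interior_injective_linear_image) (auto simp: bounded_linear_minus inj_on_def intro: bounded_linear_ident)
  then have "- y \<in> rel_interior S" using y assms(3) by auto
  then have "(1/2) *\<^sub>R y + (1/2) *\<^sub>R (- y) \<in> rel_interior S"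
    using y convex_rel_interior[OF assms(1)] by (intro convexD) auto
  then show ?thesis by simp
qed

lemma lattice_polytope_affine_image:
  assumes P: "lattice_polytope P" and L: "linear L"
    and int: "\<And>x. x \<in> integer_points \<Longrightarrow> c + L x \<in> integer_points"
  shows "lattice_polytope ((\<lambda>x. c + L x) ` P)"
proof -
  obtain V where V: "finite V" "V \<noteq> {}" "V \<subseteq> integer_points" "P = convex hull V"
    using P unfolding lattice_polytope_def by blast
  have "(\<lambda>x. c + L x) ` P = convex hull ((\<lambda>x. c + L x) ` V)"
    unfolding V(4) by (rule convex_hull_affine_image[OF L, symmetric])
  then show ?thesis
    unfolding lattice_polytope_def using V(1-3) int by (intro exI[of _ "(\<lambda>x. c + L x) ` V"]) auto
qed

lemma lattice_polytope_linear_image: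
  assumes "lattice_polytope P" "linear L" "\<And>x. x \<in> integer_points \<Longrightarrow> L x \<in> integer_points"
  shows "lattice_polytope (L ` P)"
  using lattice_polytope_affine_image[of P L 0] assms by simp

lemma lattice_polytope_add:
  assumes "lattice_polytope P" "lattice_polytope Q"
  shows "lattice_polytope (P + Q)"
proof -
  obtain V where V: "finite V" "V \<noteq> {}" "V \<subseteq> integer_points" "P = convex hull V"
    using assms(1) unfolding lattice_polytope_def by blast
  obtain W where W: "finite W" "W \<noteq> {}" "W \<subseteq> integer_points" "Q = convex hull W"
    using assms(2) unfolding lattice_polytope_def by blast
  have "V + W \<noteq> {}" using V(2) W(2) by (auto simp: set_plus_def)
  moreover have "V + W \<subseteq> integer_points" using V(3) W(3) by (auto simp: set_plus_def intro: integer_points_add)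
  ultimately show ?thesis
    unfolding lattice_polytope_def V(4) W(4) convex_hull_set_plus[symmetric]
    using V(1) W(1) by (intro exI[of _ "V + W"]) (auto intro: finite_set_plus)
qed

lemma uminus_image_eqI:
  fixes S :: "'a::group_add set"
  assumes "\<And>z. z \<in> S \<Longrightarrow> - z \<in> S"
  shows "uminus ` S = S"
  using assms by (auto intro: image_eqI[of _ uminus "- z" for z])

lemma linear_image_set_plus:
  assumes "linear f"
  shows "f ` (A + B) = f ` A + f ` B"
proof
  show "f ` (A + B) \<subseteq> f ` A + f ` B"
  proof clarify
    fix x assume "x \<in> A + B"
    then obtain a b where "a \<in> A" "b \<in> B" "x = a + b" by (rule set_plus_elim)
    then show "f x \<in> f ` A + f ` B" using linear_add[OF assms] by (auto intro!: set_plus_intro)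
  qed
  show "f ` A + f ` B \<subseteq> f ` (A + B)"
  proof
    fix y assume "y \<in> f ` A + f ` B"
    then obtain a b where ab: "a \<in> A" "b \<in> B" "y = f a + f b" by (auto elim!: set_plus_elim)
    then have "y = f (a + b)" using linear_add[OF assms] by simp
    moreover have "a + b \<in> A + B" using ab by (intro set_plus_intro)
    ultimately show "y \<in> f ` (A + B)" by (rule image_eqI)
  qed
qed

text \<open>The case \<open>k = 0\<close> is included because the recursion for the lattice point
  counts starts there.\<close>

lemma scaled_cayley_sum_iff:
  fixes P Q :: "'a::euclidean_space set"
  assumes "convex P" "P \<noteq> {}" "convex Q" "Q \<noteq> {}"
  shows "(t, x) \<in> (\<lambda>z. real k *\<^sub>R z) ` cayley_sum P Q \<longleftrightarrow>
    0 \<le> t \<and> t \<le> real k \<and> (\<exists>p\<in>P. \<exists>q\<in>Q. x = t *\<^sub>R p + (real k - t) *\<^sub>R q)"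
proof (cases "k = 0")
  case True
  obtain p q where pq: "p \<in> P" "q \<in> Q" using assms by blast
  have "(0, q) \<in> cayley_sum P Q" using pq unfolding cayley_sum_def by (intro hull_inc) auto
  then have "(\<lambda>z. real k *\<^sub>R z) ` cayley_sum P Q = {0}" using True by auto
  then show ?thesis using True pq by (auto simp: zero_prod_def)
next
  case False
  have "(t, x) \<in> (\<lambda>z. real k *\<^sub>R z) ` cayley_sum P Q \<longleftrightarrow> (t / real k, (1 / real k) *\<^sub>R x) \<in> cayley_sum P Q"
  proof
    assume "(t / real k, (1 / real k) *\<^sub>R x) \<in> cayley_sum P Q"
    then show "(t, x) \<in> (\<lambda>z. real k *\<^sub>R z) ` cayley_sum P Q" by (rule rev_image_eqI) (use False in simp)
  next
    assume "(t, x) \<in> (\<lambda>z. real k *\<^sub>R z) ` cayley_sum P Q"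
    then show "(t / real k, (1 / real k) *\<^sub>R x) \<in> cayley_sum P Q" using False by auto
  qed
  also have "\<dots> \<longleftrightarrow> 0 \<le> t \<and> t \<le> real k \<and> (\<exists>p\<in>P. \<exists>q\<in>Q. (1 / real k) *\<^sub>R x = (t / real k) *\<^sub>R p + (1 - t / real k) *\<^sub>R q)"
    unfolding cayley_sum_iff[OF assms] using False by (simp add: zero_le_divide_iff)
  also have "(\<lambda>p q. (1 / real k) *\<^sub>R x = (t / real k) *\<^sub>R p + (1 - t / real k) *\<^sub>R q)
      = (\<lambda>p q. x = t *\<^sub>R p + (real k - t) *\<^sub>R q)"
  proof (intro ext)
    fix p q :: 'a
    have "(t / real k) *\<^sub>R p + (1 - t / real k) *\<^sub>R q = (1 / real k) *\<^sub>R (t *\<^sub>R p + (real k - t) *\<^sub>R q)"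
    proof -
      have "1 - t / real k = (real k - t) / real k" using False by (simp add: diff_divide_distrib)
      then show ?thesis unfolding scaleR_add_right scaleR_scaleR by simp
    qed
    then show "((1 / real k) *\<^sub>R x = (t / real k) *\<^sub>R p + (1 - t / real k) *\<^sub>R q) = (x = t *\<^sub>R p + (real k - t) *\<^sub>R q)"
      using False by simp
  qed
  finally show ?thesis .
qed

lemma convex_scaled_add:
  assumes "convex S" "p \<in> S" "r \<in> S" "0 \<le> a" "0 \<le> (\<delta>::real)"
  shows "\<exists>q\<in>S. a *\<^sub>R p + \<delta> *\<^sub>R r = (a + \<delta>) *\<^sub>R q"
proof (cases "a + \<delta> = 0")
  case True
  then have "a = 0" "\<delta> = 0" using assms by linarith+
  then show ?thesis using assms by auto
next
  case False
  have "(a / (a + \<delta>)) *\<^sub>R p + (\<delta> / (a + \<delta>)) *\<^sub>R r \<in> S"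
    using assms False by (intro convexD) (auto simp flip: add_divide_distrib)
  moreover have "(a + \<delta>) *\<^sub>R ((a / (a + \<delta>)) *\<^sub>R p + (\<delta> / (a + \<delta>)) *\<^sub>R r) = a *\<^sub>R p + \<delta> *\<^sub>R r"
    using False by (simp add: scaleR_add_right)
  ultimately show ?thesis by metis
qed

lemma finite_scaled_lattice_polytope:
  assumes "lattice_polytope P"
  shows "finite ((\<lambda>x. real k *\<^sub>R x) ` P \<inter> integer_points)"
proof -
  obtain V where "finite V" "P = convex hull V" using assms unfolding lattice_polytope_def by blast
  then have "bounded P" by (simp add: bounded_convex_hull finite_imp_bounded)
  then show ?thesis by (intro finite_integer_points_bounded bounded_scaling)
qed

text \<open>The constant coefficient needs no separate treatment: the zeroth dilate is
  \<open>{0}\<close>, whose single lattice point matches the convention.\<close>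

lemma ehrhart_series_nth:
  assumes "lattice_polytope P"
  shows "fps_nth (ehrhart_series P) k = int (card ((\<lambda>x. real k *\<^sub>R x) ` P \<inter> integer_points))"
proof (cases "k = 0")
  case True
  have "(\<lambda>x. real k *\<^sub>R x) ` P \<inter> integer_points = {0}"
    using lattice_polytope_nonempty[OF assms] True by (auto simp: integer_points_def)
  then show ?thesis using True by (simp add: ehrhart_series_def)
qed (simp add: ehrhart_series_def)

section \<open>Edge polytopes of bipartite graphs\<close>

lemma integer_points_vec: "x \<in> (integer_points :: (real ^ 'd::finite) set) \<longleftrightarrow> (\<forall>i. x $ i \<in> \<int>)"
  by (auto simp: integer_points_def Basis_vec_def inner_axis)

locale bipartite_edges =
  fixes E :: "'d::finite set set" and U :: "'d set"
  assumes bipartition: "e \<in> E \<Longrightarrow> \<exists>i\<in>U. \<exists>j\<in>-U. e = {i, j}" and edges_nonempty: "E \<noteq> {}"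
begin

abbreviation \<rho> :: "'d set \<Rightarrow> real ^ 'd" where "\<rho> \<equiv> edge_vector"

definition left_end :: "'d set \<Rightarrow> 'd" where "left_end e = (THE i. i \<in> e \<inter> U)"

definition right_end :: "'d set \<Rightarrow> 'd" where "right_end e = (THE j. j \<in> e - U)"

text \<open>Pairing with this vector sums the coordinates over one colour class; it serves as a
  height function that is 1 on every edge vector.\<close>

definition left_sum :: "real ^ 'd" where "left_sum = (\<chi> i. of_bool (i \<in> U))"

definition right_sum :: "real ^ 'd" where "right_sum = (\<chi> i. of_bool (i \<notin> U))"

lemma finite_edges [simp]: "finite E" by simp

lemma edge_ends:
  assumes "e \<in> E"
  shows "left_end e \<in> U" "right_end e \<notin> U" "e = {left_end e, right_end e}"
proof -
  obtain i j where ij: "i \<in> U" "j \<notin> U" "e = {i, j}" using bipartition[OF assms] by auto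
  have "left_end e = i" unfolding left_end_def using ij by (intro the_equality) auto
  moreover have "right_end e = j" unfolding right_end_def using ij by (intro the_equality) auto
  ultimately show "left_end e \<in> U" "right_end e \<notin> U" "e = {left_end e, right_end e}" using ij by auto
qed

lemma edge_vector_ends:
  assumes "e \<in> E"
  shows "\<rho> e = axis (left_end e) 1 + axis (right_end e) 1"
proof -
  note ends = edge_ends[OF assms]
  have "left_end e \<noteq> right_end e" using ends(1,2) by auto
  then show ?thesis unfolding edge_vector_def by (subst ends(3)) simp
qed

lemma inner_edge_vector: "e \<in> E \<Longrightarrow> c \<bullet> \<rho> e = c $ left_end e + c $ right_end e"
  by (simp add: edge_vector_ends inner_add_right inner_axis)

lemma left_sum_edge [simp]: "e \<in> E \<Longrightarrow> left_sum \<bullet> \<rho> e = 1"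
  using edge_ends by (simp add: inner_edge_vector left_sum_def)

lemma right_sum_edge [simp]: "e \<in> E \<Longrightarrow> right_sum \<bullet> \<rho> e = 1"
  using edge_ends by (simp add: inner_edge_vector right_sum_def)

lemma edge_vector_nonzero: "e \<in> E \<Longrightarrow> \<rho> e \<noteq> 0"
  using left_sum_edge by fastforce

lemma edge_vector_component:
  assumes "e \<in> E"
  shows "\<rho> e $ i = of_bool (i \<in> e)"
  using edge_ends[OF assms] by (auto simp: edge_vector_ends[OF assms] axis_def)

lemma edge_vector_inj: "inj_on \<rho> E"
proof (rule inj_onI)
  fix e e' assume e: "e \<in> E" "e' \<in> E" and eq: "\<rho> e = \<rho> e'"
  have "i \<in> e \<longleftrightarrow> i \<in> e'" for i
    using arg_cong[OF eq, of "\<lambda>x. x $ i"] by (simp add: edge_vector_component[OF e(1)] edge_vector_component[OF e(2)] of_bool_eq_iff)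
  then show "e = e'" by blast
qed

lemma edge_vector_integer: "e \<in> E \<Longrightarrow> \<rho> e \<in> integer_points"
  by (simp add: integer_points_vec edge_vector_component)

text \<open>Links linear algebra to the graph: coordinates of a combination of edge vectors are
  vertex sums of an edge weight, as in \<open>forest_weight_Ints\<close>.\<close>

lemma sum_edge_vector_component:
  assumes F: "F \<subseteq> E"
  shows "i \<in> U \<Longrightarrow> (\<Sum>e\<in>F. \<mu> e *\<^sub>R \<rho> e) $ i = (\<Sum>e | e \<in> F \<and> left_end e = i. \<mu> e)"
    and "i \<notin> U \<Longrightarrow> (\<Sum>e\<in>F. \<mu> e *\<^sub>R \<rho> e) $ i = (\<Sum>e | e \<in> F \<and> right_end e = i. \<mu> e)"
proof -
  have fF: "finite F" using F finite_subset by auto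
  have 1: "(\<Sum>e\<in>F. \<mu> e *\<^sub>R \<rho> e) $ i = (\<Sum>e\<in>F. \<mu> e * of_bool (i \<in> e))" for i
    using F by (simp add: edge_vector_component subset_iff)
  {
    assume i: "i \<in> U"
    have "i \<in> e \<longleftrightarrow> left_end e = i" if e: "e \<in> F" for e
    proof -
      have "e \<in> E" using e F by blast
      from edge_ends[OF this] show ?thesis using i by (metis insert_iff singletonD)
    qed
    then show "(\<Sum>e\<in>F. \<mu> e *\<^sub>R \<rho> e) $ i = (\<Sum>e | e \<in> F \<and> left_end e = i. \<mu> e)"
      unfolding 1 using fF by (intro sum.mono_neutral_cong_right) auto
  next
    assume i: "i \<notin> U"
    have "i \<in> e \<longleftrightarrow> right_end e = i" if e: "e \<in> F" for e
    proof -
      have "e \<in> E" using e F by blast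
      from edge_ends[OF this] show ?thesis using i by (metis insert_iff singletonD)
    qed
    then show "(\<Sum>e\<in>F. \<mu> e *\<^sub>R \<rho> e) $ i = (\<Sum>e | e \<in> F \<and> right_end e = i. \<mu> e)"
      unfolding 1 using fF by (intro sum.mono_neutral_cong_right) auto
  }
qed

lemma forest_coefficients_Ints:
  assumes F: "F \<subseteq> E" and ind: "\<And>\<mu>. (\<Sum>e\<in>F. \<mu> e *\<^sub>R \<rho> e) = 0 \<Longrightarrow> \<forall>e\<in>F. \<mu> e = 0"
    and int: "(\<Sum>e\<in>F. u e *\<^sub>R \<rho> e) \<in> integer_points"
  shows "\<forall>e\<in>F. u e \<in> \<int>"
proof (rule forest_weight_Ints[of F left_end right_end])
  show "finite F" using F finite_subset by auto
  have L0: "(\<Sum>e | e \<in> F \<and> left_end e = i. \<mu> e) = 0" if "i \<notin> U" for i and \<mu> :: "'d set \<Rightarrow> real"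
  proof -
    have E: "{e. e \<in> F \<and> left_end e = i} = {}" using that F edge_ends(1) by auto
    show ?thesis unfolding E by simp
  qed
  have R0: "(\<Sum>e | e \<in> F \<and> right_end e = i. \<mu> e) = 0" if "i \<in> U" for i and \<mu> :: "'d set \<Rightarrow> real"
  proof -
    have E: "{e. e \<in> F \<and> right_end e = i} = {}" using that F edge_ends(2) by auto
    show ?thesis unfolding E by simp
  qed
  have int': "(\<Sum>e\<in>F. u e *\<^sub>R \<rho> e) $ i \<in> \<int>" for i using int by (simp only: integer_points_vec)
  show "(\<Sum>e | e \<in> F \<and> left_end e = i. u e) \<in> \<int>" for i
    using L0[of i u] sum_edge_vector_component(1)[OF F, of i u] int'[of i]
    by (cases "i \<in> U") (simp_all only: Ints_0 not_True_eq_False not_False_eq_True simp_thms)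
  show "(\<Sum>e | e \<in> F \<and> right_end e = i. u e) \<in> \<int>" for i
    using R0[of i u] sum_edge_vector_component(2)[OF F, of i u] int'[of i]
    by (cases "i \<in> U") (simp_all only: Ints_0 not_True_eq_False not_False_eq_True simp_thms)
  fix \<mu> :: "'d set \<Rightarrow> real"
  assume "\<And>i. (\<Sum>e | e \<in> F \<and> left_end e = i. \<mu> e) = 0" "\<And>i. (\<Sum>e | e \<in> F \<and> right_end e = i. \<mu> e) = 0"
  then have "(\<Sum>e\<in>F. \<mu> e *\<^sub>R \<rho> e) $ i = 0" for i
    using sum_edge_vector_component[OF F, of i \<mu>] by (cases "i \<in> U") auto
  then show "\<forall>e\<in>F. \<mu> e = 0" by (intro ind) (simp add: vec_eq_iff)
qed

abbreviation "P \<equiv> edge_polytope0 E"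

abbreviation "P' \<equiv> edge_polytope E"

lemma uminus_convex_hull: "uminus ` (convex hull S) = convex hull (uminus ` S)" for S :: "(real ^ 'd) set"
  by (rule convex_hull_linear_image) (rule linear_uminus)

lemma uminus_P: "uminus ` P = convex hull (insert 0 ((\<lambda>e. - \<rho> e) ` E))"
  by (simp add: edge_polytope0_def uminus_convex_hull image_image)

lemma lattice_P: "lattice_polytope P"
  unfolding lattice_polytope_def edge_polytope0_def
  by (intro exI[of _ "insert 0 (\<rho> ` E)"]) (auto simp: integer_points_vec edge_vector_component)

lemma lattice_uminus_P: "lattice_polytope (uminus ` P)"
  unfolding lattice_polytope_def uminus_P
  by (intro exI[of _ "insert 0 ((\<lambda>e. - \<rho> e) ` E)"]) (auto simp: integer_points_vec edge_vector_component)

lemma zero_in_P: "0 \<in> P"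
  unfolding edge_polytope0_def by (simp add: hull_inc)

lemma edge_in_P: "e \<in> E \<Longrightarrow> \<rho> e \<in> P"
  unfolding edge_polytope0_def by (simp add: hull_inc)

text \<open>The vertices are lattice points of the unit cube, all of which are vertices of the cube.\<close>

lemma P_integer_points: "P \<inter> integer_points = insert 0 (\<rho> ` E)"
proof
  show "insert 0 (\<rho> ` E) \<subseteq> P \<inter> integer_points"
    using zero_in_P edge_in_P edge_vector_integer by (auto simp: integer_points_vec)
  show "P \<inter> integer_points \<subseteq> insert 0 (\<rho> ` E)"
  proof
    fix x assume x: "x \<in> P \<inter> integer_points"
    let ?Q = "cbox 0 (\<chi> i. 1) :: (real ^ 'd) set"
    have "insert 0 (\<rho> ` E) \<subseteq> ?Q" by (auto simp: mem_box_cart edge_vector_component)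
    then have PQ: "P \<subseteq> ?Q" unfolding edge_polytope0_def by (intro hull_minimal) auto
    have x01: "x $ i = 0 \<or> x $ i = 1" for i
    proof -
      have "x \<in> ?Q" using x PQ by blast
      then have "0 \<le> x $ i" "x $ i \<le> 1" "x $ i \<in> \<int>" using x by (auto simp: mem_box_cart integer_points_vec)
      then show ?thesis by (auto elim!: Ints_cases)
    qed
    have "x extreme_point_of P"
      unfolding extreme_point_of_def
    proof (intro conjI ballI notI)
      show "x \<in> P" using x by blast
      fix a b assume ab: "a \<in> P" "b \<in> P" "x \<in> open_segment a b"
      then obtain t where t: "0 < t" "t < 1" "x = (1 - t) *\<^sub>R a + t *\<^sub>R b" "a \<noteq> b"
        by (auto simp: in_segment)
      have "a $ i = b $ i" for i
      proof -
        have bd: "0 \<le> a $ i" "a $ i \<le> 1" "0 \<le> b $ i" "b $ i \<le> 1"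
          using ab PQ by (auto simp: mem_box_cart subset_iff)
        have xi: "x $ i = (1 - t) * a $ i + t * b $ i" using t(3) by simp
        from x01[of i] show ?thesis
        proof
          assume "x $ i = 0"
          moreover have "(1 - t) * a $ i \<ge> 0" "t * b $ i \<ge> 0" using bd t by simp_all
          ultimately have "(1 - t) * a $ i = 0" "t * b $ i = 0" using xi by linarith+
          then show ?thesis using t by simp
        next
          assume "x $ i = 1"
          then have "(1 - t) * (1 - a $ i) + t * (1 - b $ i) = 0" using xi by (simp add: algebra_simps)
          moreover have "(1 - t) * (1 - a $ i) \<ge> 0" "t * (1 - b $ i) \<ge> 0" using bd t by simp_all
          ultimately have "(1 - t) * (1 - a $ i) = 0" "t * (1 - b $ i) = 0" by linarith+
          then show ?thesis using t by simp
        qed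
      qed
      then show False using t(4) by (simp add: vec_eq_iff)
    qed
    then show "x \<in> insert 0 (\<rho> ` E)" unfolding edge_polytope0_def by (rule extreme_point_of_convex_hull)
  qed
qed

lemma uminus_P_integer_points: "uminus ` P \<inter> integer_points = insert 0 ((\<lambda>e. - \<rho> e) ` E)"
proof -
  have "uminus ` P \<inter> integer_points = uminus ` (P \<inter> integer_points)"
  proof (intro set_eqI iffI)
    fix x assume "x \<in> uminus ` P \<inter> integer_points"
    then have "- x \<in> P \<inter> integer_points" by (auto simp: integer_points_vec)
    then show "x \<in> uminus ` (P \<inter> integer_points)" by (intro image_eqI[of _ _ "- x"]) auto
  qed (auto simp: integer_points_vec)
  then show ?thesis by (simp add: P_integer_points image_image)
qed

section \<open>The triangulation of the Cayley sum\<close>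

abbreviation "C \<equiv> cayley_sum P (uminus ` P)"

definition cayley_points :: "(real \<times> (real ^ 'd)) set" where
  "cayley_points = {(1, 0), (0, 0)} \<union> ((\<lambda>e. (1, \<rho> e)) ` E \<union> (\<lambda>e. (0, - \<rho> e)) ` E)"

lemma lattice_C: "lattice_polytope C"
  by (rule lattice_polytope_cayley_sum[OF lattice_P lattice_uminus_P])

lemma C_eq: "C = convex hull ({1} \<times> insert 0 (\<rho> ` E) \<union> {0} \<times> insert 0 ((\<lambda>e. - \<rho> e) ` E))"
  unfolding uminus_P unfolding edge_polytope0_def by (rule cayley_sum_convex_hull)

lemma C_subset:
  assumes "convex S" "(1, 0) \<in> S" "(0, 0) \<in> S" "\<And>e. e \<in> E \<Longrightarrow> (1, \<rho> e) \<in> S" "\<And>e. e \<in> E \<Longrightarrow> (0, - \<rho> e) \<in> S"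
  shows "C \<subseteq> S"
  unfolding C_eq using assms by (intro hull_minimal) auto

lemma C_vertices: "(1, 0) \<in> C" "(0, 0) \<in> C" "e \<in> E \<Longrightarrow> (1, \<rho> e) \<in> C" "e \<in> E \<Longrightarrow> (0, - \<rho> e) \<in> C"
  unfolding C_eq by (auto intro!: hull_inc)

lemma C_integer_points: "C \<inter> integer_points = cayley_points"
  unfolding cayley_sum_integer_points[OF lattice_P lattice_uminus_P] P_integer_points uminus_P_integer_points cayley_points_def
  by auto

lemma sum_cell:
  fixes g :: "real \<times> (real ^ 'd) \<Rightarrow> 'z::comm_monoid_add"
  assumes "S \<subseteq> E" "T \<subseteq> E"
  shows "(\<Sum>p\<in>{(1, 0), (0, 0)} \<union> ((\<lambda>e. (1, \<rho> e)) ` S \<union> (\<lambda>e. (0, - \<rho> e)) ` T). g p)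
    = g (1, 0) + g (0, 0) + ((\<Sum>e\<in>S. g (1, \<rho> e)) + (\<Sum>e\<in>T. g (0, - \<rho> e)))"
proof -
  have finST: "finite S" "finite T" using assms finite_subset[OF _ finite_edges] by blast+
  have inj: "inj_on \<rho> S" "inj_on \<rho> T" using edge_vector_inj assms inj_on_subset by blast+
  have nz: "\<rho> e \<noteq> 0" if "e \<in> S \<union> T" for e using edge_vector_nonzero that assms by blast
  have "(\<Sum>p\<in>{(1, 0), (0, 0)} \<union> ((\<lambda>e. (1, \<rho> e)) ` S \<union> (\<lambda>e. (0, - \<rho> e)) ` T). g p)
      = (\<Sum>p\<in>{(1, 0), (0, 0)}. g p) + (\<Sum>p\<in>(\<lambda>e. (1, \<rho> e)) ` S \<union> (\<lambda>e. (0, - \<rho> e)) ` T. g p)"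
    using finST nz by (intro sum.union_disjoint) auto
  also have "(\<Sum>p\<in>(\<lambda>e. (1, \<rho> e)) ` S \<union> (\<lambda>e. (0, - \<rho> e)) ` T. g p)
      = (\<Sum>p\<in>(\<lambda>e. (1, \<rho> e)) ` S. g p) + (\<Sum>p\<in>(\<lambda>e. (0, - \<rho> e)) ` T. g p)"
    using finST by (intro sum.union_disjoint) auto
  also have "(\<Sum>p\<in>(\<lambda>e. (1, \<rho> e)) ` S. g p) = (\<Sum>e\<in>S. g (1, \<rho> e))"
    using inj(1) by (subst sum.reindex) (auto simp: inj_on_def)
  also have "(\<Sum>p\<in>(\<lambda>e. (0, - \<rho> e)) ` T. g p) = (\<Sum>e\<in>T. g (0, - \<rho> e))"
    using inj(2) by (subst sum.reindex) (auto simp: inj_on_def)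
  finally show ?thesis by simp
qed

lemma finite_cayley_points: "finite cayley_points" by (simp add: cayley_points_def)

text \<open>The segment from \<open>(1, 0)\<close> to \<open>(0, 0)\<close> passes through the interior of the Cayley sum. Giving its
  ends a smaller weight than the other lattice points forces every maximal cell to contain both, so
  that the cell is a double cone over a face of \<open>conv {\<plusminus> \<rho> e}\<close>.\<close>

definition center_weight :: "real \<times> (real ^ 'd) \<Rightarrow> real" where "center_weight p = of_bool (snd p \<noteq> 0)"

text \<open>An affine equation valid on a spanning set holds at all lattice points of the Cayley
  sum. If an end of the central segment were missing, \<open>left_sum\<close> and the functional of
  the cell would combine to an equation that fails at that end or contradicts minimality
  there.\<close>

lemma spanning_cell_vertices:
  assumes M: "M \<subseteq> minimizers center_weight cayley_points (\<tau>, \<gamma>)" and span: "affine hull M = affine hull cayley_points"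
  shows "(1, 0) \<in> M" "(0, 0) \<in> M" "\<tau> = 0" "\<And>e. e \<in> E \<Longrightarrow> (1, \<rho> e) \<in> M \<Longrightarrow> \<gamma> \<bullet> \<rho> e = -1"
    "\<And>e. e \<in> E \<Longrightarrow> (0, - \<rho> e) \<in> M \<Longrightarrow> \<gamma> \<bullet> \<rho> e = 1"
proof -
  have MA: "M \<subseteq> cayley_points" using M minimizers_subset by blast
  have func: "(a, v) \<bullet> p = k" if "\<And>q. q \<in> M \<Longrightarrow> (a, v) \<bullet> q = k" "p \<in> cayley_points" for a v k p
  proof -
    have "affine hull M \<subseteq> {q. (a, v) \<bullet> q = k}"
      by (rule hull_minimal) (use that(1) in \<open>auto simp: affine_hyperplane\<close>)
    moreover have "p \<in> affine hull M" unfolding span using that(2) by (rule hull_inc)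
    ultimately show ?thesis by blast
  qed
  have cases: "p = (1, 0) \<or> p = (0, 0) \<or> (\<exists>e\<in>E. p = (1, \<rho> e)) \<or> (\<exists>e\<in>E. p = (0, - \<rho> e))" if "p \<in> M" for p
    using that MA by (auto simp: cayley_points_def)
  have w1: "center_weight (1, \<rho> e) = 1" "center_weight (0, - \<rho> e) = 1" if "e \<in> E" for e
    using edge_vector_nonzero[OF that] by (simp_all add: center_weight_def)
  have w0: "center_weight (1, 0) = 0" "center_weight (0, 0) = 0" by (simp_all add: center_weight_def)
  have inA: "(1, 0) \<in> cayley_points" "(0, 0) \<in> cayley_points" by (simp_all add: cayley_points_def)
  have eqM: "(\<tau>, \<gamma>) \<bullet> p + center_weight p = (\<tau>, \<gamma>) \<bullet> q + center_weight q" if "p \<in> M" "q \<in> M" for p q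
    using that M minimizers_eq by blast
  have leM: "(\<tau>, \<gamma>) \<bullet> p + center_weight p \<le> (\<tau>, \<gamma>) \<bullet> q + center_weight q" if "p \<in> M" "q \<in> cayley_points" for p q
    using that M minimizers_le by blast
  have nn: "(1, 0) \<in> M \<or> (0, 0) \<in> M"
  proof (rule ccontr)
    assume "\<not> ?thesis"
    \<comment> \<open>This functional is 1 at all \<open>(1, \<rho> e)\<close> and
      \<open>(0, - \<rho> e)\<close> but 2 at \<open>(1, 0)\<close>, so at least one end of the
      segment is in \<open>M\<close>.\<close>
    then have "(2, - left_sum) \<bullet> q = 1" if "q \<in> M" for q using cases[OF that] that by auto
    from func[OF this inA(1)] show False by simp
  qed
  show M1: "(1, 0) \<in> M"
  proof (rule ccontr)
    assume n1: "(1, 0) \<notin> M"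
    then have M0: "(0, 0) \<in> M" using nn by blast
    \<comment> \<open>The cell has level 0, attained at \<open>(0, 0)\<close>, which makes this
      functional vanish on \<open>M\<close>. At \<open>(1, 0)\<close> this forces
      \<open>\<tau> = -2\<close>, putting \<open>(1, 0)\<close> below the minimum.\<close>
    have "(2 + \<tau>, \<gamma> - left_sum) \<bullet> q = 0" if q: "q \<in> M" for q
      using cases[OF q] q n1 eqM[OF q M0] by (auto simp: inner_diff_left w1 w0)
    from func[OF this inA(1)] have "\<tau> = -2" by simp
    then show False using leM[OF M0 inA(1)] by (simp add: w0)
  qed
  show M0: "(0, 0) \<in> M"
  proof (rule ccontr)
    assume n0: "(0, 0) \<notin> M"
    \<comment> \<open>The mirror image: here \<open>(0, 0)\<close> falls below the level
      \<open>\<tau> = 2\<close> of \<open>(1, 0)\<close>.\<close>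
    have "(\<tau> - 2, \<gamma> + left_sum) \<bullet> q = \<tau> - 2" if q: "q \<in> M" for q
      using cases[OF q] q n0 eqM[OF q M1] by (auto simp: inner_add_left w1 w0)
    from func[OF this inA(2)] have "\<tau> = 2" by simp
    then show False using leM[OF M1 inA(2)] by (simp add: w0)
  qed
  show \<tau>: "\<tau> = 0" using eqM[OF M1 M0] by (simp add: w0)
  show "\<gamma> \<bullet> \<rho> e = -1" if "e \<in> E" "(1, \<rho> e) \<in> M" for e using eqM[OF that(2) M0] w1[OF that(1)] by (simp add: w0 \<tau>)
  show "\<gamma> \<bullet> \<rho> e = 1" if "e \<in> E" "(0, - \<rho> e) \<in> M" for e using eqM[OF that(2) M0] w1[OF that(1)] by (simp add: w0 \<tau>)
qed

text \<open>No edge occurs with both signs, since \<open>\<gamma> \<bullet> \<rho> e\<close> would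
  be both -1 and 1. The two ends of the segment absorb the coefficient sum and the first coordinate,
  so affine independence of the cell becomes linear independence of its edge vectors.\<close>

lemma spanning_simplex_unimodular:
  assumes M: "M \<subseteq> minimizers center_weight cayley_points c" and span: "affine hull M = affine hull cayley_points"
    and ind: "\<not> affine_dependent M"
  shows "unimodular_vertices M"
proof -
  obtain \<tau> \<gamma> where c: "c = (\<tau>, \<gamma>)" by fastforce
  note V = spanning_cell_vertices[OF M[unfolded c] span]
  have MA: "M \<subseteq> cayley_points" using M minimizers_subset by blast
  have finM: "finite M" using aff_independent_finite[OF ind] .
  define S where "S = {e\<in>E. (1, \<rho> e) \<in> M}"
  define T where "T = {e\<in>E. (0, - \<rho> e) \<in> M}"
  have ST: "S \<inter> T = {}" "S \<subseteq> E" "T \<subseteq> E" using V(4,5) by (force simp: S_def T_def)+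
  have finST: "finite S" "finite T" by (simp_all add: S_def T_def)
  have M_eq: "M = {(1, 0), (0, 0)} \<union> ((\<lambda>e. (1, \<rho> e)) ` S \<union> (\<lambda>e. (0, - \<rho> e)) ` T)"
    using MA V(1,2) by (auto simp: cayley_points_def S_def T_def)
  have nz: "\<rho> e \<noteq> 0" if "e \<in> S \<union> T" for e using edge_vector_nonzero that ST by blast
  have sumM: "(\<Sum>p\<in>M. g p) = g (1, 0) + g (0, 0) + ((\<Sum>e\<in>S. g (1, \<rho> e)) + (\<Sum>e\<in>T. g (0, - \<rho> e)))"
    for g :: "real \<times> (real ^ 'd) \<Rightarrow> 'z::comm_monoid_add"
    unfolding M_eq by (rule sum_cell[OF ST(2,3)])
  have sumST: "(\<Sum>e\<in>S \<union> T. \<mu> e *\<^sub>R \<rho> e) = (\<Sum>e\<in>S. \<mu> e *\<^sub>R \<rho> e) + (\<Sum>e\<in>T. \<mu> e *\<^sub>R \<rho> e)" for \<mu>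
    using finST ST(1) by (rule sum.union_disjoint)
  have indST: "\<forall>e\<in>S \<union> T. \<mu> e = 0" if \<mu>: "(\<Sum>e\<in>S \<union> T. \<mu> e *\<^sub>R \<rho> e) = 0" for \<mu>
  proof -
    \<comment> \<open>The coefficients at \<open>(1, 0)\<close> and \<open>(0, 0)\<close> cancel the
      coefficient sums at heights 1 and 0.\<close>
    define v where "v p = (if snd p = 0 then (if fst p = 1 then - sum \<mu> S else sum \<mu> T)
      else if fst p = 1 then \<mu> (inv_into E \<rho> (snd p)) else - \<mu> (inv_into E \<rho> (- snd p)))" for p :: "real \<times> (real ^ 'd)"
    have v: "v (1, 0) = - sum \<mu> S" "v (0, 0) = sum \<mu> T" "\<And>e. e \<in> S \<Longrightarrow> v (1, \<rho> e) = \<mu> e"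
      "\<And>e. e \<in> T \<Longrightarrow> v (0, - \<rho> e) = - \<mu> e"
      using nz ST edge_vector_inj by (auto simp: v_def subset_iff)
    have "sum v M = 0" unfolding sumM by (simp add: v sum_negf)
    moreover have "(\<Sum>p\<in>M. v p *\<^sub>R p) = 0"
      unfolding sumM using \<mu> by (intro prod_eqI) (simp_all add: v fst_sum snd_sum sumST)
    ultimately have "\<forall>p\<in>M. v p = 0" using ind affine_dependent_explicit_finite[OF finM] by blast
    then have "v (1, \<rho> e) = 0" if "e \<in> S" for e using that by (auto simp: S_def)
    moreover have "v (0, - \<rho> e) = 0" if "e \<in> T" for e
      using \<open>\<forall>p\<in>M. v p = 0\<close> that by (auto simp: T_def)
    ultimately show ?thesis using v by force
  qed
  show ?thesis unfolding unimodular_vertices_def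
  proof (intro conjI allI impI)
    show "\<not> affine_dependent M" by (rule ind)
    fix u assume u1: "sum u M = 1" and ui: "(\<Sum>p\<in>M. u p *\<^sub>R p) \<in> integer_points"
    define \<mu> where "\<mu> e = (if e \<in> S then u (1, \<rho> e) else - u (0, - \<rho> e))" for e
    have \<mu>S: "\<mu> e = u (1, \<rho> e)" if "e \<in> S" for e using that by (simp add: \<mu>_def)
    have \<mu>T: "\<mu> e = - u (0, - \<rho> e)" if "e \<in> T" for e using that ST by (auto simp: \<mu>_def)
    have "(\<Sum>p\<in>M. u p *\<^sub>R p) = (u (1, 0) + (\<Sum>e\<in>S. u (1, \<rho> e)), \<Sum>e\<in>S \<union> T. \<mu> e *\<^sub>R \<rho> e)"
    proof -
      have "(\<Sum>e\<in>S. \<mu> e *\<^sub>R \<rho> e) = (\<Sum>e\<in>S. u (1, \<rho> e) *\<^sub>R \<rho> e)" by (intro sum.cong) (simp_all add: \<mu>_def)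
      moreover have "(\<Sum>e\<in>T. \<mu> e *\<^sub>R \<rho> e) = (\<Sum>e\<in>T. - (u (0, - \<rho> e) *\<^sub>R \<rho> e))"
        by (intro sum.cong) (simp_all add: \<mu>T)
      ultimately show ?thesis unfolding sumM sumST by (intro prod_eqI) (simp_all add: fst_sum snd_sum)
    qed
    then have i1: "u (1, 0) + (\<Sum>e\<in>S. u (1, \<rho> e)) \<in> \<int>" and i2: "(\<Sum>e\<in>S \<union> T. \<mu> e *\<^sub>R \<rho> e) \<in> integer_points"
      using ui by simp_all
    have "\<forall>e\<in>S \<union> T. \<mu> e \<in> \<int>"
      by (rule forest_coefficients_Ints[OF _ indST i2]) (use ST in auto)
    then have uS: "u (1, \<rho> e) \<in> \<int>" if "e \<in> S" for e using that \<mu>S[OF that] by (metis UnI1)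
    have uT: "u (0, - \<rho> e) \<in> \<int>" if "e \<in> T" for e
      using \<open>\<forall>e\<in>S \<union> T. \<mu> e \<in> \<int>\<close> that \<mu>T[OF that] by (metis Ints_minus UnI2 minus_minus)
    have sS: "(\<Sum>e\<in>S. u (1, \<rho> e)) \<in> \<int>" using uS by (rule Ints_sum)
    have sT: "(\<Sum>e\<in>T. u (0, - \<rho> e)) \<in> \<int>" using uT by (rule Ints_sum)
    have u10: "u (1, 0) \<in> \<int>" using Ints_diff[OF i1 sS] by simp
    have "u (0, 0) = 1 - u (1, 0) - (\<Sum>e\<in>S. u (1, \<rho> e)) - (\<Sum>e\<in>T. u (0, - \<rho> e))"
      using u1 unfolding sumM by simp
    then have "u (0, 0) \<in> \<int>" using u10 sS sT by simp
    then show "\<forall>p\<in>M. u p \<in> \<int>" unfolding M_eq using u10 uS uT by auto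
  qed
qed

lemma ex_unimodular_weight_C: "\<exists>w. unimodular_weight w (C \<inter> integer_points)"
  unfolding C_integer_points
  by (rule ex_unimodular_weight[OF finite_cayley_points]) (rule spanning_simplex_unimodular)

subsection \<open>Ehrhart series\<close>

abbreviation "C' \<equiv> cayley_sum P' (uminus ` P')"

lemma lattice_P': "lattice_polytope P'"
  unfolding lattice_polytope_def edge_polytope_def using edges_nonempty edge_vector_integer
  by (intro exI[of _ "\<rho> ` E"]) auto

lemma lattice_uminus_P': "lattice_polytope (uminus ` P')"
  unfolding lattice_polytope_def edge_polytope_def uminus_convex_hull using edges_nonempty
  by (intro exI[of _ "uminus ` \<rho> ` E"]) (auto simp: integer_points_vec edge_vector_component of_bool_def split: if_splits)

lemma lattice_C': "lattice_polytope C'"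
  by (rule lattice_polytope_cayley_sum[OF lattice_P' lattice_uminus_P'])

lemma left_sum_P': "p \<in> P' \<Longrightarrow> left_sum \<bullet> p = 1"
proof -
  have "P' \<subseteq> {p. left_sum \<bullet> p = 1}"
    unfolding edge_polytope_def by (intro hull_minimal convex_hyperplane) auto
  then show "p \<in> P' \<Longrightarrow> left_sum \<bullet> p = 1" by blast
qed

lemma convex_P': "convex P'"
  unfolding edge_polytope_def by simp

lemma P'_nonempty: "P' \<noteq> {}"
  using lattice_polytope_nonempty[OF lattice_P'] .

lemma P_iff: "p \<in> P \<longleftrightarrow> (\<exists>s q. 0 \<le> s \<and> s \<le> 1 \<and> q \<in> P' \<and> p = s *\<^sub>R q)"
proof -
  have "P = {x. \<exists>u\<ge>0. \<exists>v\<ge>0. \<exists>b. u + v = 1 \<and> b \<in> P' \<and> x = u *\<^sub>R 0 + v *\<^sub>R b}"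
    unfolding edge_polytope0_def edge_polytope_def using edges_nonempty by (intro convex_hull_insert) simp
  also have "p \<in> \<dots> \<longleftrightarrow> (\<exists>s q. 0 \<le> s \<and> s \<le> 1 \<and> q \<in> P' \<and> p = s *\<^sub>R q)"
  proof
    assume "p \<in> {x. \<exists>u\<ge>0. \<exists>v\<ge>0. \<exists>b. u + v = 1 \<and> b \<in> P' \<and> x = u *\<^sub>R 0 + v *\<^sub>R b}"
    then obtain u v b where "0 \<le> u" "0 \<le> v" "u + v = 1" "b \<in> P'" "p = v *\<^sub>R b" by auto
    then show "\<exists>s q. 0 \<le> s \<and> s \<le> 1 \<and> q \<in> P' \<and> p = s *\<^sub>R q" by (intro exI[of _ v] exI[of _ b]) auto
  next
    assume "\<exists>s q. 0 \<le> s \<and> s \<le> 1 \<and> q \<in> P' \<and> p = s *\<^sub>R q"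
    then obtain s q where "0 \<le> s" "s \<le> 1" "q \<in> P'" "p = s *\<^sub>R q" by blast
    then show "p \<in> {x. \<exists>u\<ge>0. \<exists>v\<ge>0. \<exists>b. u + v = 1 \<and> b \<in> P' \<and> x = u *\<^sub>R 0 + v *\<^sub>R b}"
      by (intro CollectI exI[of _ "1 - s"] exI[of _ s] exI[of _ q] conjI) auto
  qed
  finally show ?thesis .
qed

text \<open>\<open>P\<close> is a pyramid over \<open>P'\<close> with apex 0, so the multipliers
  \<open>a\<close> and \<open>b\<close> may stay below \<open>t\<close> and \<open>k - t\<close>;
  the deficits are the shares of the apices \<open>(1, 0)\<close> and \<open>(0, 0)\<close>.\<close>

lemma scaled_C_iff:
  "(t, x) \<in> (\<lambda>z. real k *\<^sub>R z) ` C \<longleftrightarrow> 0 \<le> t \<and> t \<le> real k \<and>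
    (\<exists>a b. 0 \<le> a \<and> a \<le> t \<and> 0 \<le> b \<and> b \<le> real k - t \<and> (\<exists>p\<in>P'. \<exists>q\<in>P'. x = a *\<^sub>R p - b *\<^sub>R q))"
  (is "_ \<longleftrightarrow> ?r")
proof -
  have "(t, x) \<in> (\<lambda>z. real k *\<^sub>R z) ` C \<longleftrightarrow>
      0 \<le> t \<and> t \<le> real k \<and> (\<exists>p\<in>P. \<exists>q\<in>uminus ` P. x = t *\<^sub>R p + (real k - t) *\<^sub>R q)" (is "_ \<longleftrightarrow> ?l")
    using lattice_P lattice_uminus_P
    by (intro scaled_cayley_sum_iff) (simp_all add: lattice_polytope_convex lattice_polytope_nonempty del: image_is_empty)
  also have "?l \<longleftrightarrow> ?r"
  proof
    assume l: ?l
    then obtain p q where pq: "p \<in> P" "q \<in> P" "x = t *\<^sub>R p - (real k - t) *\<^sub>R q" by auto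
    obtain s p' where p: "0 \<le> s" "s \<le> 1" "p' \<in> P'" "p = s *\<^sub>R p'" using pq(1) P_iff by blast
    obtain r q' where q: "0 \<le> r" "r \<le> 1" "q' \<in> P'" "q = r *\<^sub>R q'" using pq(2) P_iff by blast
    have "x = (t * s) *\<^sub>R p' - ((real k - t) * r) *\<^sub>R q'" by (simp add: pq(3) p(4) q(4))
    moreover have "0 \<le> t * s" "0 \<le> (real k - t) * r" using l p(1) q(1) by simp_all
    moreover have "t * s \<le> t" "(real k - t) * r \<le> real k - t"
      using l p(2) q(2) by (simp_all add: mult_left_le)
    ultimately show ?r using l p(3) q(3) by blast
  next
    assume r: ?r
    then obtain a b p q where ab: "0 \<le> a" "a \<le> t" "0 \<le> b" "b \<le> real k - t" and pq: "p \<in> P'" "q \<in> P'" "x = a *\<^sub>R p - b *\<^sub>R q"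
      by blast
    have "(c / u) *\<^sub>R r \<in> P" if "0 \<le> c" "c \<le> u" "r \<in> P'" for c u :: real and r
      unfolding P_iff by (intro exI[of _ "c / u"] exI[of _ r]) (use that in \<open>auto simp: divide_le_eq_1\<close>)
    then have "(a / t) *\<^sub>R p \<in> P" "(b / (real k - t)) *\<^sub>R q \<in> P" using ab pq by blast+
    \<comment> \<open>When \<open>t = 0\<close> or \<open>t = k\<close>, division by zero gives 0,
      and the corresponding multiplier is 0 as well.\<close>
    moreover have "t * (a / t) = a" "(real k - t) * (b / (real k - t)) = b" using ab by auto
    then have "x = t *\<^sub>R ((a / t) *\<^sub>R p) + (real k - t) *\<^sub>R (- ((b / (real k - t)) *\<^sub>R q))"
      unfolding pq(3) scaleR_minus_right scaleR_scaleR by simp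
    ultimately show ?l using r by blast
  qed
  finally show ?thesis .
qed

lemma scaled_C'_iff:
  "(t, x) \<in> (\<lambda>z. real k *\<^sub>R z) ` C' \<longleftrightarrow> 0 \<le> t \<and> t \<le> real k \<and> (\<exists>p\<in>P'. \<exists>q\<in>P'. x = t *\<^sub>R p - (real k - t) *\<^sub>R q)"
proof -
  have "(t, x) \<in> (\<lambda>z. real k *\<^sub>R z) ` C' \<longleftrightarrow>
      0 \<le> t \<and> t \<le> real k \<and> (\<exists>p\<in>P'. \<exists>q\<in>uminus ` P'. x = t *\<^sub>R p + (real k - t) *\<^sub>R q)"
    using lattice_P' lattice_uminus_P'
    by (intro scaled_cayley_sum_iff) (simp_all add: lattice_polytope_convex lattice_polytope_nonempty del: image_is_empty)
  then show ?thesis by simp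
qed

definition pts :: "nat \<Rightarrow> (real \<times> (real ^ 'd)) set" where
  "pts k = (\<lambda>z. real k *\<^sub>R z) ` C \<inter> integer_points"

definition pts' :: "nat \<Rightarrow> (real \<times> (real ^ 'd)) set" where
  "pts' k = (\<lambda>z. real k *\<^sub>R z) ` C' \<inter> integer_points"

lemma finite_pts: "finite (pts k)"
  unfolding pts_def by (rule finite_scaled_lattice_polytope[OF lattice_C])

lemma finite_pts': "finite (pts' k)"
  unfolding pts'_def by (rule finite_scaled_lattice_polytope[OF lattice_C'])

text \<open>Adds the lattice point \<open>(0, 0)\<close> or \<open>(1, 0)\<close> of
  \<open>C\<close>, which leaves \<open>x\<close> unchanged.\<close>

lemma pts_Suc: "(t, x) \<in> pts k \<Longrightarrow> (t, x) \<in> pts (Suc k) \<and> (t + 1, x) \<in> pts (Suc k)"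
  unfolding pts_def Int_iff scaled_C_iff integer_points_Pair integer_points_real
  by (intro conjI; elim conjE exE; (rule exI conjI | assumption | simp | linarith)+)

lemma pts'_subset: "pts' k \<subseteq> pts k"
proof
  fix z assume z: "z \<in> pts' k"
  obtain t x where tx: "z = (t, x)" by fastforce
  have "0 \<le> t \<and> t \<le> real k \<and> (\<exists>p\<in>P'. \<exists>q\<in>P'. x = t *\<^sub>R p - (real k - t) *\<^sub>R q)"
    using z unfolding pts'_def tx Int_iff scaled_C'_iff by blast
  then have "(t, x) \<in> (\<lambda>z. real k *\<^sub>R z) ` C"
    unfolding scaled_C_iff by (intro conjI exI[of _ t] exI[of _ "real k - t"]) auto
  then show "z \<in> pts k" using z by (simp add: pts_def pts'_def tx)
qed

text \<open>Both representations have the same difference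
  \<open>a - b = left_sum \<bullet> x\<close>, so one of them has the smaller \<open>a\<close> and
  the smaller \<open>b\<close>. It obeys the bound on \<open>a\<close> from the lower height and the
  bound on \<open>b\<close> from the higher one, hence fits into the smaller dilate.\<close>

lemma pts_merge:
  assumes "(t0, x) \<in> pts (Suc k)" "(t, x) \<in> pts (Suc k)" "t0 < t"
  shows "(t - 1, x) \<in> pts k"
proof -
  obtain a b p q where 0: "0 \<le> a" "a \<le> t0" "0 \<le> b" "b \<le> real (Suc k) - t0" "p \<in> P'" "q \<in> P'" "x = a *\<^sub>R p - b *\<^sub>R q" "0 \<le> t0"
    using assms(1) unfolding pts_def Int_iff scaled_C_iff by blast
  obtain a' b' p' q' where 1: "0 \<le> a'" "a' \<le> t" "0 \<le> b'" "b' \<le> real (Suc k) - t" "p' \<in> P'" "q' \<in> P'" "x = a' *\<^sub>R p' - b' *\<^sub>R q'" "t \<le> real (Suc k)"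
    using assms(2) unfolding pts_def Int_iff scaled_C_iff by blast
  have int: "t0 \<in> \<int>" "t \<in> \<int>" "x \<in> integer_points" using assms(1,2) by (simp_all add: pts_def)
  then have t: "t0 + 1 \<le> t" using assms(3) by (auto elim!: Ints_cases)
  have "a - b = left_sum \<bullet> x" using 0 left_sum_P' by (simp add: inner_diff_right)
  moreover have "a' - b' = left_sum \<bullet> x" using 1 left_sum_P' by (simp add: inner_diff_right)
  ultimately have ab: "a - b = a' - b'" by simp
  have "\<exists>a b. 0 \<le> a \<and> a \<le> t - 1 \<and> 0 \<le> b \<and> b \<le> real k - (t - 1) \<and> (\<exists>p\<in>P'. \<exists>q\<in>P'. x = a *\<^sub>R p - b *\<^sub>R q)"
  proof (cases "a \<le> a'")
    case True
    then have "a \<le> t - 1" "b \<le> real k - (t - 1)" using ab 0 1 t by simp_all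
    then show ?thesis using 0 by blast
  next
    case False
    then have "a' \<le> t - 1" "b' \<le> real k - (t - 1)" using ab 0 1 t by simp_all
    then show ?thesis using 1 by blast
  qed
  moreover have "0 \<le> t - 1" "t - 1 \<le> real k" using 0(8) 1(8) t by simp_all
  ultimately have "(t - 1, x) \<in> (\<lambda>z. real k *\<^sub>R z) ` C" unfolding scaled_C_iff by blast
  then show ?thesis using int by (simp add: pts_def)
qed

text \<open>Shifting by \<open>(1, 0)\<close> embeds one dilate in the next. By
  \<open>pts_merge\<close> the points not reached are exactly the lowest ones over each
  \<open>x\<close>.\<close>

lemma card_pts_Suc: "card (pts (Suc k)) = card (pts k) + card (snd ` pts (Suc k))"
proof -
  define sh where "sh = (\<lambda>(t, x). (t + 1, x) :: real \<times> (real ^ 'd))"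
  define R where "R = pts (Suc k) - sh ` pts k"
  have sub: "sh ` pts k \<subseteq> pts (Suc k)" using pts_Suc by (auto simp: sh_def)
  have "inj_on sh (pts k)" by (auto simp: inj_on_def sh_def)
  then have c1: "card (sh ` pts k) = card (pts k)" by (rule card_image)
  have inR: "z = z'" if z: "z \<in> R" "z' \<in> pts (Suc k)" "snd z = snd z'" "fst z' \<le> fst z" for z z'
  proof (rule ccontr)
    assume ne: "z \<noteq> z'"
    obtain t x where tx: "z = (t, x)" by fastforce
    obtain t0 where t0: "z' = (t0, x)" using z(3) tx by (metis prod.collapse snd_conv)
    have "t0 < t" using ne z(4) by (simp add: tx t0)
    then have "(t - 1, x) \<in> pts k" using z(1,2) unfolding R_def tx t0 by (intro pts_merge[of t0]) auto
    then have "sh (t - 1, x) \<in> sh ` pts k" by blast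
    then show False using z(1) by (simp add: R_def tx sh_def)
  qed
  have "inj_on snd R"
  proof (rule inj_onI)
    fix z z' assume "z \<in> R" "z' \<in> R" "snd z = snd z'"
    then show "z = z'" using inR[of z z'] inR[of z' z] by (cases "fst z' \<le> fst z") (auto simp: R_def)
  qed
  moreover have "snd ` R = snd ` pts (Suc k)"
  proof
    show "snd ` R \<subseteq> snd ` pts (Suc k)" by (auto simp: R_def)
    show "snd ` pts (Suc k) \<subseteq> snd ` R"
    proof
      fix x assume "x \<in> snd ` pts (Suc k)"
      then obtain t1 where t1: "(t1, x) \<in> pts (Suc k)" by force
      define F where "F = fst ` {z \<in> pts (Suc k). snd z = x}"
      have F: "finite F" "F \<noteq> {}" using finite_pts[of "Suc k"] t1 by (auto simp: F_def)
      define t where "t = Min F"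
      have "t \<in> F" unfolding t_def using F by (rule Min_in)
      then have t: "(t, x) \<in> pts (Suc k)" by (auto simp: F_def)
      have "(t, x) \<notin> sh ` pts k"
      proof
        assume "(t, x) \<in> sh ` pts k"
        then have "(t - 1, x) \<in> pts k" by (auto simp: sh_def)
        then have "(t - 1, x) \<in> pts (Suc k)" using pts_Suc by blast
        then have "t - 1 \<in> F" by (force simp: F_def)
        then have "t \<le> t - 1" unfolding t_def using F by (intro Min_le)
        then show False by simp
      qed
      then have "(t, x) \<in> R" using t by (simp add: R_def)
      then show "x \<in> snd ` R" by force
    qed
  qed
  ultimately have c2: "card R = card (snd ` pts (Suc k))" using card_image by metis
  have "card (pts (Suc k)) = card (sh ` pts k) + card R"
    unfolding R_def using sub finite_pts by (simp add: card_Diff_subset finite_subset card_mono)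
  then show ?thesis using c1 c2 by simp
qed

lemma edge_combination:
  assumes "\<And>e. e \<in> E \<Longrightarrow> 0 \<le> \<mu> e"
  shows "\<exists>p\<in>P'. (\<Sum>e\<in>E. \<mu> e *\<^sub>R \<rho> e) = sum \<mu> E *\<^sub>R p"
proof (cases "sum \<mu> E = 0")
  case True
  then have "\<forall>e\<in>E. \<mu> e = 0" using assms by (simp add: sum_nonneg_eq_0_iff)
  then have "(\<Sum>e\<in>E. \<mu> e *\<^sub>R \<rho> e) = sum \<mu> E *\<^sub>R p" for p using True by simp
  then show ?thesis using P'_nonempty by blast
next
  case False
  have "(\<Sum>e\<in>E. (\<mu> e / sum \<mu> E) *\<^sub>R \<rho> e) \<in> P'"
    using assms False by (intro convex_sum convex_P')
      (auto simp: edge_polytope_def sum_nonneg simp flip: sum_divide_distrib intro: hull_inc)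
  moreover have "(\<Sum>e\<in>E. \<mu> e *\<^sub>R \<rho> e) = sum \<mu> E *\<^sub>R (\<Sum>e\<in>E. (\<mu> e / sum \<mu> E) *\<^sub>R \<rho> e)"
    using False by (simp add: scaleR_sum_right)
  ultimately show ?thesis by blast
qed

text \<open>The unimodular triangulation provides integral multiplicities; dropping those of
  \<open>(1, 0)\<close> and \<open>(0, 0)\<close> turns the total \<open>k\<close> into an upper
  bound.\<close>

lemma pts_decomposition:
  assumes "(t, x) \<in> pts k"
  shows "\<exists>a b :: nat. a + b \<le> k \<and> (\<exists>p\<in>P'. \<exists>q\<in>P'. x = real a *\<^sub>R p - real b *\<^sub>R q)"
proof (cases "k = 0")
  case True
  obtain p where "p \<in> P'" using P'_nonempty by blast
  moreover have "x = 0" using assms True by (auto simp: pts_def zero_prod_def)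
  ultimately show ?thesis using True by auto
next
  case False
  obtain z where z: "z \<in> C" "(t, x) = real k *\<^sub>R z" using assms by (auto simp: pts_def)
  obtain w where w: "unimodular_weight w (C \<inter> integer_points)" using ex_unimodular_weight_C by blast
  have "real k *\<^sub>R z \<in> integer_points" using assms z(2) by (simp add: pts_def)
  then obtain n where n: "(\<Sum>p\<in>cayley_points. n p) = k" "(\<Sum>p\<in>cayley_points. real (n p) *\<^sub>R p) = real k *\<^sub>R z"
    using unimodular_weight_decomposition[OF lattice_C w z(1)] False
    unfolding C_integer_points by blast
  define a where "a = (\<Sum>e\<in>E. n (1, \<rho> e))"
  define b where "b = (\<Sum>e\<in>E. n (0, - \<rho> e))"
  have "a + b \<le> k" using n(1) unfolding cayley_points_def sum_cell[OF subset_refl subset_refl] a_def b_def by simp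
  moreover have "x = (\<Sum>e\<in>E. real (n (1, \<rho> e)) *\<^sub>R \<rho> e) - (\<Sum>e\<in>E. real (n (0, - \<rho> e)) *\<^sub>R \<rho> e)"
    using arg_cong[OF n(2), of snd] unfolding z(2)[symmetric] cayley_points_def sum_cell[OF subset_refl subset_refl]
    by (simp add: snd_sum sum_negf)
  moreover obtain p where "p \<in> P'" "(\<Sum>e\<in>E. real (n (1, \<rho> e)) *\<^sub>R \<rho> e) = real a *\<^sub>R p"
    using edge_combination[of "\<lambda>e. real (n (1, \<rho> e))"] by (auto simp: a_def)
  moreover obtain q where "q \<in> P'" "(\<Sum>e\<in>E. real (n (0, - \<rho> e)) *\<^sub>R \<rho> e) = real b *\<^sub>R q"
    using edge_combination[of "\<lambda>e. real (n (0, - \<rho> e))"] by (auto simp: b_def)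
  ultimately show ?thesis by auto
qed

text \<open>An even surplus is spent by adding and subtracting \<open>\<delta>\<close> copies of the
  same point of \<open>P'\<close>.\<close>

lemma pts'_I:
  assumes "x \<in> integer_points" "p \<in> P'" "q \<in> P'" "x = real a *\<^sub>R p - real b *\<^sub>R q" "k = a + b + 2 * \<delta>"
  shows "(real (a + \<delta>), x) \<in> pts' k"
proof -
  obtain p' where p': "p' \<in> P'" "real a *\<^sub>R p + real \<delta> *\<^sub>R p = (real a + real \<delta>) *\<^sub>R p'"
    using convex_scaled_add[OF convex_P' assms(2,2), of "real a" "real \<delta>"] by auto
  obtain q' where q': "q' \<in> P'" "real b *\<^sub>R q + real \<delta> *\<^sub>R p = (real b + real \<delta>) *\<^sub>R q'"
    using convex_scaled_add[OF convex_P' assms(3,2), of "real b" "real \<delta>"] by auto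
  have "real k - real (a + \<delta>) = real b + real \<delta>" using assms(5) by simp
  moreover have "x = (real a *\<^sub>R p + real \<delta> *\<^sub>R p) - (real b *\<^sub>R q + real \<delta> *\<^sub>R p)" using assms(4) by simp
  then have "x = (real a + real \<delta>) *\<^sub>R p' - (real b + real \<delta>) *\<^sub>R q'" unfolding p'(2) q'(2) .
  ultimately have "(real (a + \<delta>), x) \<in> (\<lambda>z. real k *\<^sub>R z) ` C'"
    unfolding scaled_C'_iff using p'(1) q'(1) assms(5) by auto
  then show ?thesis using assms(1) by (simp add: pts'_def)
qed

text \<open>Without the apices the height is determined by \<open>x\<close>, so projecting
  \<open>pts' k\<close> loses nothing.\<close>

lemma pts'_height:
  assumes "(t, x) \<in> pts' k"
  shows "left_sum \<bullet> x = 2 * t - real k"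
proof -
  obtain p q where "p \<in> P'" "q \<in> P'" "x = t *\<^sub>R p - (real k - t) *\<^sub>R q"
    using assms by (auto simp: pts'_def scaled_C'_iff)
  then show ?thesis using left_sum_P' by (simp add: inner_diff_right)
qed

text \<open>The projection of \<open>pts k\<close> splits according to the parity of \<open>left_sum \<bullet> x - k\<close>.\<close>

lemma card_snd_pts_Suc: "card (snd ` pts (Suc k)) = card (pts' (Suc k)) + card (pts' k)"
proof -
  have eq: "snd ` pts (Suc k) = snd ` pts' (Suc k) \<union> snd ` pts' k"
  proof
    show "snd ` pts' (Suc k) \<union> snd ` pts' k \<subseteq> snd ` pts (Suc k)"
    proof -
      have "pts k \<subseteq> pts (Suc k)" using pts_Suc by auto
      then show ?thesis using pts'_subset[of k] pts'_subset[of "Suc k"] by blast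
    qed
    show "snd ` pts (Suc k) \<subseteq> snd ` pts' (Suc k) \<union> snd ` pts' k"
    proof
      fix x assume "x \<in> snd ` pts (Suc k)"
      then obtain t where t: "(t, x) \<in> pts (Suc k)" by force
      then have xi: "x \<in> integer_points" by (simp add: pts_def)
      obtain a b p q where ab: "a + b \<le> Suc k" "p \<in> P'" "q \<in> P'" "x = real a *\<^sub>R p - real b *\<^sub>R q"
        using pts_decomposition[OF t] by blast
      show "x \<in> snd ` pts' (Suc k) \<union> snd ` pts' k"
      proof (cases "even (Suc k - (a + b))")
        case True
        then obtain \<delta> where "Suc k - (a + b) = 2 * \<delta>" by (elim evenE)
        then have "Suc k = a + b + 2 * \<delta>" using ab(1) by linarith
        from pts'_I[OF xi ab(2-4) this] show ?thesis by force
      next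
        case False
        then obtain \<delta> where "Suc k - (a + b) = 2 * \<delta> + 1" by (elim oddE)
        then have "k = a + b + 2 * \<delta>" using ab(1) by linarith
        from pts'_I[OF xi ab(2-4) this] show ?thesis by force
      qed
    qed
  qed
  have inj: "inj_on snd (pts' j)" for j
  proof (rule inj_onI)
    fix z z' assume z: "z \<in> pts' j" "z' \<in> pts' j" "snd z = snd z'"
    then have "left_sum \<bullet> snd z = 2 * fst z - real j" "left_sum \<bullet> snd z' = 2 * fst z' - real j"
      using pts'_height by (metis prod.collapse)+
    then show "z = z'" using z(3) by (simp add: prod_eq_iff)
  qed
  \<comment> \<open>For one \<open>x\<close> the two height formulas would give heights differing by
    1/2, although both are integers.\<close>
  have "snd ` pts' (Suc k) \<inter> snd ` pts' k = {}"
  proof (rule ccontr)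
    assume "\<not> ?thesis"
    then obtain t t' x where tx: "(t, x) \<in> pts' (Suc k)" "(t', x) \<in> pts' k" by force
    have "2 * t - real (Suc k) = 2 * t' - real k" using pts'_height[OF tx(1)] pts'_height[OF tx(2)] by simp
    then have "2 * (t - t') = 1" by simp
    moreover have "t - t' \<in> \<int>" using tx by (simp add: pts'_def)
    then obtain i where "t - t' = real_of_int i" by (elim Ints_cases)
    ultimately have "real_of_int (2 * i) = real_of_int 1" by simp
    then have "2 * i = 1" by (simp only: of_int_eq_iff)
    then show False by presburger
  qed
  then show ?thesis
    unfolding eq using finite_pts' inj by (simp add: card_Un_disjoint card_image)
qed

lemma ehrhart_C: "(1 - fps_X) * ehrhart_series C = (1 + fps_X) * ehrhart_series C'"
proof (rule fps_ext)
  fix k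
  have 1: "fps_nth (ehrhart_series C) j = int (card (pts j))" for j
    unfolding pts_def by (rule ehrhart_series_nth[OF lattice_C])
  have 2: "fps_nth (ehrhart_series C') j = int (card (pts' j))" for j
    unfolding pts'_def by (rule ehrhart_series_nth[OF lattice_C'])
  have 3: "fps_nth (ehrhart_series S) 0 = 1" for S :: "(real \<times> (real ^ 'd)) set" by (simp add: ehrhart_series_def)
  show "fps_nth ((1 - fps_X) * ehrhart_series C) k = fps_nth ((1 + fps_X) * ehrhart_series C') k"
  proof (cases k)
    case 0
    then show ?thesis by (simp add: 3)
  next
    case (Suc j)
    then show ?thesis
      by (simp add: left_diff_distrib distrib_right 1 2 card_pts_Suc card_snd_pts_Suc)
  qed
qed

text \<open>\<open>C'\<close> lies in a hyperplane missing the origin, while \<open>C\<close>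
  contains the origin and lies in the linear span of \<open>C'\<close>, because
  \<open>(1, \<rho> e) + (0, - \<rho> e) = (1, 0)\<close>.\<close>

lemma aff_dim_C: "aff_dim C = aff_dim C' + 1"
proof -
  have C'_eq: "C' = convex hull ({1} \<times> \<rho> ` E \<union> {0} \<times> uminus ` \<rho> ` E)"
    unfolding edge_polytope_def uminus_convex_hull by (rule cayley_sum_convex_hull)
  have C'_vert: "(1, \<rho> e) \<in> C'" "(0, - \<rho> e) \<in> C'" if "e \<in> E" for e
    unfolding C'_eq using that by (auto intro!: hull_inc)
  have "C' \<subseteq> {z. (2, - left_sum) \<bullet> z = 1}"
    unfolding C'_eq by (intro hull_minimal convex_hyperplane) auto
  then have "affine hull C' \<subseteq> {z. (2, - left_sum) \<bullet> z = 1}" by (intro hull_minimal affine_hyperplane)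
  then have 0: "0 \<notin> affine hull C'" by auto
  have span: "affine hull (insert 0 C') = span C'" using affine_hull_span_0[of "insert 0 C'"] by (simp add: hull_inc)
  obtain e0 where e0: "e0 \<in> E" using edges_nonempty by blast
  have "(1, 0) \<in> span C'"
    using span_add[OF span_base[OF C'_vert(1)[OF e0]] span_base[OF C'_vert(2)[OF e0]]] by simp
  moreover have "(0, 0) \<in> span C'" using span_zero[of C'] by (simp add: zero_prod_def)
  ultimately have "C \<subseteq> span C'"
    unfolding C_eq using C'_vert by (intro hull_minimal subspace_imp_convex) (auto intro: span_base)
  then have "affine hull C \<subseteq> span C'" by (intro hull_minimal subspace_imp_affine) auto
  moreover have "insert 0 C' \<subseteq> C"
  proof -
    have "C' \<subseteq> C" unfolding C'_eq C_eq by (intro hull_mono) auto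
    moreover have "0 \<in> C" unfolding C_eq by (intro hull_inc) (auto simp: zero_prod_def)
    ultimately show ?thesis by blast
  qed
  then have "affine hull (insert 0 C') \<subseteq> affine hull C" by (rule hull_mono)
  ultimately have "affine hull C = affine hull (insert 0 C')" unfolding span by blast
  then have "aff_dim C = aff_dim (insert 0 C')" by (metis aff_dim_affine_hull)
  then show ?thesis using 0 by (simp add: aff_dim_insert)
qed

text \<open>The extra dimension of \<open>C\<close> supplies the factor \<open>1 - fps_X\<close>
  that appears in \<open>ehrhart_C\<close>.\<close>

lemma hstar_C: "hstar C = (1 + fps_X) * hstar C'"
proof -
  have "C' \<noteq> {}" by (rule lattice_polytope_nonempty[OF lattice_C'])
  then have "aff_dim C' \<ge> 0" using aff_dim_negative_iff[of C'] by linarith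
  then have "nat (aff_dim C) + 1 = Suc (nat (aff_dim C') + 1)" by (simp add: aff_dim_C nat_add_distrib)
  then have "hstar C = (1 - fps_X) ^ (nat (aff_dim C') + 1) * ((1 - fps_X) * ehrhart_series C)"
    unfolding hstar_def by (simp only: power_Suc mult.assoc mult.left_commute)
  then show ?thesis unfolding ehrhart_C hstar_def by (simp only: mult.left_commute)
qed

end

section \<open>Reflexivity\<close>

locale connected_bipartite = bipartite_edges +
  fixes root :: "'a"
  assumes connected: "connected_graph E" and root: "root \<in> U"
begin

section \<open>Coordinates on the hyperplane of the edge polytopes\<close>

definition root_basis :: "(real ^ 'a) set" where "root_basis = {axis i 1 | i. i \<noteq> root}"

text \<open>Projection along the coordinate of one vertex. On \<open>balanced\<close> that
  coordinate is an integral combination of the others, so nothing is lost and lattice points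
  correspond both ways.\<close>

definition drop_root :: "real ^ 'a \<Rightarrow> real ^ 'a" where "drop_root x = x - (x $ root) *\<^sub>R axis root 1"

lemma drop_root_nth: "drop_root x $ i = (if i = root then 0 else x $ i)"
  by (simp add: drop_root_def axis_def)

lemma linear_drop_root: "linear drop_root"
  by (intro linearI) (simp_all add: vec_eq_iff drop_root_nth)

lemma root_basis_subset: "root_basis \<subseteq> Basis"
  by (auto simp: root_basis_def Basis_vec_def)

lemma span_root_basis: "span root_basis = {x. x $ root = 0}"
proof
  have "subspace {x :: real ^ 'a. x $ root = 0}" by (auto simp: subspace_def)
  moreover have "root_basis \<subseteq> {x. x $ root = 0}" by (auto simp: root_basis_def axis_def)
  ultimately show "span root_basis \<subseteq> {x. x $ root = 0}" by (intro span_minimal)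
  show "{x. x $ root = 0} \<subseteq> span root_basis"
  proof clarify
    fix x :: "real ^ 'a" assume x: "x $ root = 0"
    have "x = (\<Sum>i\<in>UNIV. (x $ i) *\<^sub>R axis i 1)" using basis_expansion[of x] by (simp add: scalar_mult_eq_scaleR)
    also have "\<dots> \<in> span root_basis"
    proof (rule span_sum)
      fix i show "(x $ i) *\<^sub>R axis i 1 \<in> span root_basis"
      proof (cases "i = root")
        case True
        then show ?thesis using x by (simp add: span_zero)
      next
        case False
        then have "axis i 1 \<in> root_basis" unfolding root_basis_def by blast
        then show ?thesis by (intro span_scale span_base)
      qed
    qed
    finally show "x \<in> span root_basis" .
  qed
qed

lemma connected_induct:
  assumes "Q root" "\<And>i j. {i, j} \<in> E \<Longrightarrow> Q i \<Longrightarrow> Q j"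
  shows "Q v"
proof -
  have "(root, v) \<in> {(i, j). {i, j} \<in> E}\<^sup>*" using connected by (simp add: connected_graph_def)
  then show ?thesis by (induction rule: rtrancl_induct) (use assms in auto)
qed

lemma edge_vector_pair:
  assumes "{i, j} \<in> E"
  shows "\<rho> {i, j} = axis i 1 + axis j 1"
proof -
  have "i \<noteq> j"
  proof
    assume "i = j"
    then show False using edge_ends[OF assms] by auto
  qed
  then show ?thesis by (simp add: edge_vector_def)
qed

text \<open>Walk through the graph from the root: \<open>axis root 1\<close> is projected to 0, and
  along an edge \<open>axis j 1\<close> is the edge vector minus \<open>axis i 1\<close>.\<close>

lemma span_drop_root: "span (drop_root ` \<rho> ` E) = span root_basis"
proof
  have "drop_root ` \<rho> ` E \<subseteq> span root_basis" by (auto simp: span_root_basis drop_root_nth)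
  then show "span (drop_root ` \<rho> ` E) \<subseteq> span root_basis" by (intro span_minimal) auto
  have "drop_root (axis v 1) \<in> span (drop_root ` \<rho> ` E)" for v
  proof (rule connected_induct[where Q = "\<lambda>v. drop_root (axis v 1) \<in> span (drop_root ` \<rho> ` E)"])
    have "drop_root (axis root 1) = 0" by (simp add: vec_eq_iff drop_root_nth axis_def)
    then show "drop_root (axis root 1) \<in> span (drop_root ` \<rho> ` E)" by (simp add: span_zero)
    fix i j assume ij: "{i, j} \<in> E" "drop_root (axis i 1) \<in> span (drop_root ` \<rho> ` E)"
    have "drop_root (axis j 1) = drop_root (\<rho> {i, j}) - drop_root (axis i 1)"
      by (simp add: edge_vector_pair[OF ij(1)] linear_add[OF linear_drop_root])
    then show "drop_root (axis j 1) \<in> span (drop_root ` \<rho> ` E)"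
      using ij by (auto intro!: span_diff intro: span_base)
  qed
  moreover have "drop_root (axis v 1) = axis v 1" if "v \<noteq> root" for v
    using that by (auto simp: vec_eq_iff drop_root_nth axis_def)
  ultimately have "axis v 1 \<in> span (drop_root ` \<rho> ` E)" if "v \<noteq> root" for v using that by metis
  then have "root_basis \<subseteq> span (drop_root ` \<rho> ` E)" unfolding root_basis_def by blast
  then show "span root_basis \<subseteq> span (drop_root ` \<rho> ` E)" by (intro span_minimal) auto
qed

definition balanced :: "(real ^ 'a) set" where "balanced = {x. (left_sum - right_sum) \<bullet> x = 0}"

lemma affine_balanced: "affine balanced"
  unfolding balanced_def by (rule affine_hyperplane)

lemma balanced_P: "P \<subseteq> balanced"
  unfolding edge_polytope0_def
  by (intro hull_minimal affine_imp_convex affine_balanced) (auto simp: balanced_def inner_diff_left)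

lemma balanced_root:
  assumes "x \<in> balanced"
  shows "x $ root = (right_sum - left_sum) \<bullet> drop_root x"
proof -
  have "(right_sum - left_sum) \<bullet> x = 0" using assms by (simp add: balanced_def inner_diff_left)
  moreover have "(right_sum - left_sum) \<bullet> axis root 1 = -1"
    using root by (simp add: inner_axis left_sum_def right_sum_def)
  ultimately show ?thesis by (simp add: drop_root_def inner_diff_right)
qed

lemma drop_root_inj:
  assumes "x \<in> balanced" "y \<in> balanced" "drop_root x = drop_root y"
  shows "x = y"
proof -
  have "x $ root = y $ root"
    unfolding balanced_root[OF assms(1)] balanced_root[OF assms(2)] assms(3) ..
  then show ?thesis using assms(3) unfolding drop_root_def by simp
qed

lemma drop_root_integer_iff:
  assumes "x \<in> balanced"
  shows "drop_root x \<in> integer_points \<longleftrightarrow> x \<in> integer_points"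
proof
  assume i: "drop_root x \<in> integer_points"
  have "(right_sum - left_sum) \<bullet> drop_root x = (\<Sum>k\<in>UNIV. (right_sum - left_sum) $ k * drop_root x $ k)"
    by (simp add: inner_vec_def)
  also have "\<dots> \<in> \<int>"
    using i by (intro Ints_sum Ints_mult) (auto simp: integer_points_vec left_sum_def right_sum_def)
  finally have "x $ root \<in> \<int>" using balanced_root[OF assms] by simp
  then have "x $ k \<in> \<int>" for k
  proof (cases "k = root")
    case False
    have "drop_root x $ k \<in> \<int>" using i by (simp only: integer_points_vec)
    then show ?thesis using False by (simp add: drop_root_nth)
  qed simp
  then show "x \<in> integer_points" by (simp add: integer_points_vec)
qed (auto simp: integer_points_vec drop_root_nth)

lemma drop_root_integer: "x \<in> integer_points \<Longrightarrow> drop_root x \<in> integer_points"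
  by (auto simp: integer_points_vec drop_root_nth)

text \<open>The height \<open>s\<close> stands for the maximum of \<open>c\<close> on \<open>P\<close>. In the variables \<open>c\<^sub>i\<close> (\<open>i \<in> U\<close>), \<open>s - c\<^sub>j\<close> (\<open>j \<notin> U\<close>)
  and \<open>s\<close> all constraints bound differences of two variables (one of which may be the constant \<open>0\<close>) by
  integers, which makes the vertices integral.\<close>

definition dual_lift :: "(real \<times> (real ^ 'a)) set" where
  "dual_lift = {(s, c). 0 \<le> s \<and> s \<le> 1 \<and> c $ root = 0 \<and> (\<forall>e\<in>E. s - 1 \<le> c \<bullet> \<rho> e \<and> c \<bullet> \<rho> e \<le> s)}"

lemma dual_lift_halfspaces: "dual_lift = {z. (1, 0) \<bullet> z \<ge> 0} \<inter> {z. (1, 0) \<bullet> z \<le> 1} \<inter> {z. (0, axis root 1) \<bullet> z = 0}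
    \<inter> (\<Inter>e\<in>E. {z. (-1, \<rho> e) \<bullet> z \<ge> -1} \<inter> {z. (-1, \<rho> e) \<bullet> z \<le> 0})"
proof -
  have eq: "(s - 1 \<le> x \<and> x \<le> s) = (-1 \<le> x - s \<and> x - s \<le> 0)" for s x :: real by auto
  show ?thesis by (auto simp: dual_lift_def eq inner_axis inner_commute[of "_ :: real ^ 'a"])
qed

lemma convex_dual_lift: "convex dual_lift"
  unfolding dual_lift_halfspaces
  by (intro convex_Int convex_INT convex_halfspace_le convex_halfspace_ge convex_hyperplane)

text \<open>The two coordinates of \<open>c\<close> at an edge add up to a number between -1 and 1,
  so bounds propagate from \<open>c $ root = 0\<close> through the connected graph.\<close>

lemma bounded_dual_lift: "bounded dual_lift"
proof -
  have "\<exists>K. \<forall>(s, c)\<in>dual_lift. \<bar>c $ v\<bar> \<le> K" for v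
  proof (rule connected_induct[where Q = "\<lambda>v. \<exists>K. \<forall>(s, c)\<in>dual_lift. \<bar>c $ v\<bar> \<le> K"])
    show "\<exists>K. \<forall>(s, c)\<in>dual_lift. \<bar>c $ root\<bar> \<le> K" by (intro exI[of _ 0]) (auto simp: dual_lift_def)
    fix i j assume ij: "{i, j} \<in> E" and "\<exists>K. \<forall>(s, c)\<in>dual_lift. \<bar>c $ i\<bar> \<le> K"
    then obtain K where K: "\<And>s c. (s, c) \<in> dual_lift \<Longrightarrow> \<bar>c $ i\<bar> \<le> K" by blast
    have "\<bar>c $ j\<bar> \<le> K + 1" if sc: "(s, c) \<in> dual_lift" for s c
    proof -
      have "s - 1 \<le> c \<bullet> \<rho> {i, j}" "c \<bullet> \<rho> {i, j} \<le> s" "0 \<le> s" "s \<le> 1" using sc ij by (auto simp: dual_lift_def)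
      then have "\<bar>c $ i + c $ j\<bar> \<le> 1" unfolding edge_vector_pair[OF ij] by (simp add: inner_add_right inner_axis)
      then show ?thesis using K[OF sc] by linarith
    qed
    then show "\<exists>K. \<forall>(s, c)\<in>dual_lift. \<bar>c $ j\<bar> \<le> K" by (intro exI[of _ "K + 1"]) auto
  qed
  then have "\<forall>v. \<exists>K. \<forall>(s, c)\<in>dual_lift. \<bar>c $ v\<bar> \<le> K" by blast
  from choice[OF this] obtain K where K: "\<And>v s c. (s, c) \<in> dual_lift \<Longrightarrow> \<bar>c $ v\<bar> \<le> K v" by blast
  have "norm (s, c) \<le> 1 + sum K UNIV" if sc: "(s, c) \<in> dual_lift" for s c
  proof -
    have "norm (s, c) \<le> norm s + norm c" by (rule norm_Pair_le)
    also have "norm s \<le> 1" using sc by (simp add: dual_lift_def)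
    also have "norm c \<le> (\<Sum>v\<in>UNIV. \<bar>c $ v\<bar>)" by (rule norm_le_l1_cart)
    also have "\<dots> \<le> sum K UNIV" using K[OF sc] by (rule sum_mono)
    finally show ?thesis by simp
  qed
  then show ?thesis unfolding bounded_iff by (intro exI[of _ "1 + sum K UNIV"]) (simp add: split_paired_all)
qed

lemma compact_dual_lift: "compact dual_lift"
  unfolding compact_eq_bounded_closed
proof
  show "bounded dual_lift" by (rule bounded_dual_lift)
  show "closed dual_lift" unfolding dual_lift_halfspaces
    by (intro closed_Int closed_INT closed_halfspace_le closed_halfspace_ge closed_hyperplane ballI)
qed

text \<open>A nonintegral point can be moved both ways: all variables congruent to one nonintegral
  value \<open>\<phi>\<close> modulo the integers are shifted together. A constraint between a
  shifted and an unshifted variable is not tight, since their difference is not an integer; the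
  other constraints are unaffected.\<close>

lemma dual_lift_extreme_integer:
  assumes "z extreme_point_of dual_lift"
  shows "z \<in> integer_points"
proof (rule ccontr)
  assume nint: "z \<notin> integer_points"
  obtain s c where z: "z = (s, c)" by fastforce
  have zD: "(s, c) \<in> dual_lift" using assms by (simp add: z extreme_point_of_def)
  define val where "val i = (if i \<in> U then c $ i else s - c $ i)" for i
  have "\<exists>\<phi>. \<phi> \<notin> \<int> \<and> (\<phi> = s \<or> (\<exists>i. \<phi> = val i))"
  proof (rule ccontr)
    assume "\<not> ?thesis"
    then have int: "s \<in> \<int>" "\<And>i. val i \<in> \<int>" by blast+
    have "c $ i \<in> \<int>" for i using int(1) int(2)[of i] Ints_diff[OF int(1) int(2)[of i]] by (auto simp: val_def split: if_splits)
    then show False using nint int by (simp add: z integer_points_vec)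
  qed
  then obtain \<phi> where \<phi>: "\<phi> \<notin> \<int>" "\<phi> = s \<or> (\<exists>i. \<phi> = val i)" by blast
  define \<kappa> where "\<kappa> x = (of_bool (x - \<phi> \<in> \<int>) :: real)" for x
  have \<kappa>_diff: "x - y \<notin> \<int>" if "\<kappa> x \<noteq> \<kappa> y" for x y
  proof
    assume xy: "x - y \<in> \<int>"
    have "x - \<phi> \<in> \<int> \<longleftrightarrow> y - \<phi> \<in> \<int>"
      using Ints_add[OF xy, of "y - \<phi>"] Ints_diff[of "x - \<phi>", OF _ xy] by auto
    then show False using that by (simp add: \<kappa>_def)
  qed
  have \<kappa>0: "\<kappa> n = 0" if "n \<in> \<int>" for n
  proof -
    have "n - \<phi> \<notin> \<int>"
    proof
      assume "n - \<phi> \<in> \<int>"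
      from Ints_diff[OF that this] show False using \<phi>(1) by simp
    qed
    then show ?thesis by (simp add: \<kappa>_def)
  qed
  \<comment> \<open>The shift \<open>\<kappa>\<close> of the variables, translated back to
    \<open>c\<close>: for \<open>i \<notin> U\<close> the variable is
    \<open>s - c $ i\<close>.\<close>
  define d where "d = (\<chi> i. if i \<in> U then \<kappa> (val i) else \<kappa> s - \<kappa> (val i))"
  have dnz: "(\<kappa> s, d) \<noteq> 0"
  proof
    assume "(\<kappa> s, d) = 0"
    then have 0: "\<kappa> s = 0" "d = 0" by (simp_all add: zero_prod_def)
    have "\<kappa> (val i) = 0" for i using arg_cong[OF 0(2), of "\<lambda>d. d $ i"] 0(1) by (simp add: d_def split: if_splits)
    then have "\<kappa> \<phi> = 0" using \<phi>(2) 0(1) by auto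
    then show False by (simp add: \<kappa>_def)
  qed
  define g where "g e = c \<bullet> \<rho> e - s" for e
  have g_val: "g e = val (left_end e) - val (right_end e)" if "e \<in> E" for e
    using edge_ends[OF that] by (simp add: g_def inner_edge_vector[OF that] val_def)
  have g_d: "d \<bullet> \<rho> e - \<kappa> s = \<kappa> (val (left_end e)) - \<kappa> (val (right_end e))" if "e \<in> E" for e
    using edge_ends[OF that] by (simp add: inner_edge_vector[OF that] d_def)
  define J where "J = {e\<in>E. \<kappa> (val (left_end e)) \<noteq> \<kappa> (val (right_end e))}"
  have "min (- g e) (1 + g e) > 0" if e: "e \<in> J" for e
  proof -
    have eE: "e \<in> E" using e by (simp add: J_def)
    have "g e \<notin> \<int>" unfolding g_val[OF eE] using e \<kappa>_diff by (simp add: J_def)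
    then have "g e \<noteq> 0" "g e \<noteq> -1" by auto
    moreover have "-1 \<le> g e" "g e \<le> 0" using zD eE by (force simp: dual_lift_def g_def)+
    ultimately show ?thesis by simp
  qed
  moreover have "finite J" by (simp add: J_def)
  ultimately obtain \<eta>1 where \<eta>1: "\<eta>1 > 0" "\<And>e. e \<in> J \<Longrightarrow> \<eta>1 \<le> min (- g e) (1 + g e)"
    using finite_pos_lower_bound[of J "\<lambda>e. min (- g e) (1 + g e)"] by blast
  \<comment> \<open>If \<open>s\<close> itself moves, it is nonintegral and so strictly between 0
    and 1; the second bound keeps it in that interval.\<close>
  define \<eta> where "\<eta> = min \<eta>1 (if \<kappa> s = 0 then 1 else min s (1 - s))"
  have s01: "0 \<le> s" "s \<le> 1" using zD by (auto simp: dual_lift_def)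
  have "s \<noteq> 0 \<and> s \<noteq> 1" if "\<kappa> s \<noteq> 0" using that \<kappa>0[of 0] \<kappa>0[of 1] by auto
  then have \<eta>0: "\<eta> > 0" using \<eta>1(1) s01 by (auto simp: \<eta>_def)
  have move: "(s + \<sigma> * \<kappa> s, c + \<sigma> *\<^sub>R d) \<in> dual_lift" if \<sigma>: "\<bar>\<sigma>\<bar> = \<eta>" for \<sigma>
  proof -
    have \<kappa>01: "\<kappa> x = 0 \<or> \<kappa> x = 1" for x by (simp add: \<kappa>_def)
    have "\<bar>\<sigma> * \<kappa> s\<bar> \<le> min s (1 - s)"
    proof (cases "\<kappa> s = 0")
      case False
      then have "\<kappa> s = 1" using \<kappa>01 by blast
      then have "\<eta> \<le> min s (1 - s)" unfolding \<eta>_def by (auto simp: min_def)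
      then show ?thesis using \<sigma> \<open>\<kappa> s = 1\<close> by simp
    qed (use s01 in simp)
    then have "0 \<le> s + \<sigma> * \<kappa> s" "s + \<sigma> * \<kappa> s \<le> 1" by linarith+
    moreover have "(c + \<sigma> *\<^sub>R d) $ root = 0"
    proof -
      have "c $ root = 0" using zD by (simp add: dual_lift_def)
      then show ?thesis using root \<kappa>0[of 0] by (simp add: d_def val_def)
    qed
    moreover have "-1 \<le> (c + \<sigma> *\<^sub>R d) \<bullet> \<rho> e - (s + \<sigma> * \<kappa> s) \<and> (c + \<sigma> *\<^sub>R d) \<bullet> \<rho> e - (s + \<sigma> * \<kappa> s) \<le> 0" if e: "e \<in> E" for e
    proof -
      let ?\<delta> = "\<kappa> (val (left_end e)) - \<kappa> (val (right_end e))"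
      have eq: "(c + \<sigma> *\<^sub>R d) \<bullet> \<rho> e - (s + \<sigma> * \<kappa> s) = g e + \<sigma> * ?\<delta>"
      proof -
        have "d \<bullet> \<rho> e = ?\<delta> + \<kappa> s" using g_d[OF e] by linarith
        then show ?thesis by (simp add: g_def inner_add_left distrib_left)
      qed
      show ?thesis
      proof (cases "e \<in> J")
        case True
        have "\<bar>?\<delta>\<bar> \<le> 1" using \<kappa>01[of "val (left_end e)"] \<kappa>01[of "val (right_end e)"] by auto
        then have "\<bar>\<sigma> * ?\<delta>\<bar> \<le> \<eta> * 1" unfolding abs_mult \<sigma> using \<eta>0 by (intro mult_left_mono) auto
        moreover have "\<eta> \<le> - g e" "\<eta> \<le> 1 + g e" using \<eta>1(2)[OF True] by (auto simp: \<eta>_def)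
        ultimately show ?thesis unfolding eq by linarith
      next
        case False
        then have "?\<delta> = 0" using e by (simp add: J_def)
        moreover have "-1 \<le> g e" "g e \<le> 0" using zD e by (force simp: dual_lift_def g_def)+
        ultimately show ?thesis unfolding eq by simp
      qed
    qed
    ultimately show ?thesis unfolding dual_lift_def by force
  qed
  let ?a = "(s + \<eta> * \<kappa> s, c + \<eta> *\<^sub>R d)" and ?b = "(s + (- \<eta>) * \<kappa> s, c + (- \<eta>) *\<^sub>R d)"
  have ab: "?a \<in> dual_lift" "?b \<in> dual_lift" using move[of \<eta>] move[of "- \<eta>"] \<eta>0 by auto
  have "?a \<noteq> ?b"
  proof
    assume "?a = ?b"
    then have eq: "s + \<eta> * \<kappa> s = s + (- \<eta>) * \<kappa> s" "c + \<eta> *\<^sub>R d = c + (- \<eta>) *\<^sub>R d" by (simp_all only: prod.inject)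
    have "\<eta> * \<kappa> s = 0" using eq(1) by simp
    moreover have "\<eta> * d $ i = 0" for i using arg_cong[OF eq(2), of "\<lambda>d. d $ i"] by simp
    ultimately have "\<kappa> s = 0" "d = 0" using \<eta>0 by (simp_all add: vec_eq_iff)
    then show False using dnz by (simp add: zero_prod_def)
  qed
  moreover have "midpoint ?a ?b = z" by (simp add: z midpoint_def scaleR_2[symmetric] field_simps)
  ultimately have "z \<in> open_segment ?a ?b" using midpoint_in_open_segment[of ?a ?b] by simp
  then show False using assms ab unfolding extreme_point_of_def by blast
qed

lemma lattice_polytope_dual_lift: "lattice_polytope dual_lift"
  unfolding lattice_polytope_def
proof (intro exI conjI)
  let ?V = "dual_lift \<inter> integer_points"
  show "finite ?V" by (rule finite_integer_points_bounded[OF bounded_dual_lift])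
  have "(0, 0) \<in> ?V" by (auto simp: dual_lift_def integer_points_vec)
  then show "?V \<noteq> {}" by blast
  show "?V \<subseteq> integer_points" by blast
  have "{z. z extreme_point_of dual_lift} \<subseteq> ?V"
    using dual_lift_extreme_integer by (auto simp: extreme_point_of_def)
  then have "convex hull {z. z extreme_point_of dual_lift} \<subseteq> convex hull ?V" by (rule hull_mono)
  moreover have "dual_lift = convex hull {z. z extreme_point_of dual_lift}"
    using Krein_Milman_Minkowski[OF compact_dual_lift convex_dual_lift] by simp
  moreover have "convex hull ?V \<subseteq> dual_lift" by (intro hull_minimal convex_dual_lift) blast
  ultimately show "dual_lift = convex hull ?V" by blast
qed

section \<open>Reflexivity of the Minkowski sum\<close>

abbreviation "D \<equiv> P + uminus ` P"

lemma zero_in_uminus_P: "0 \<in> uminus ` P"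
  using zero_in_P by (intro image_eqI[of _ _ 0]) simp_all

lemma D_I: "p \<in> P \<Longrightarrow> q \<in> P \<Longrightarrow> p - q \<in> D"
  unfolding set_plus_def by force

lemma D_E:
  assumes "y \<in> D" obtains p q where "p \<in> P" "q \<in> P" "y = p - q"
  using assms unfolding set_plus_def by force

lemma lattice_D: "lattice_polytope D"
  by (rule lattice_polytope_add[OF lattice_P lattice_uminus_P])

lemma affine_hull_D: "affine hull D \<subseteq> balanced"
proof (rule hull_minimal)
  show "affine balanced" by (rule affine_balanced)
  show "D \<subseteq> balanced"
  proof
    fix y assume "y \<in> D"
    then obtain p q where pq: "p \<in> P" "q \<in> P" "y = p - q" by (rule D_E)
    then have "p \<in> balanced" "q \<in> balanced" using balanced_P by blast+
    then show "y \<in> balanced" unfolding pq(3) by (simp add: balanced_def inner_diff_right)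
  qed
qed

lemma unimodular_drop_root: "unimodular_map drop_root D (drop_root ` D)"
proof (rule unimodular_mapI[OF linear_drop_root, where c = 0])
  show "inj_on drop_root (affine hull D)" using drop_root_inj affine_hull_D by (intro inj_onI) blast
  show "drop_root x \<in> integer_points \<longleftrightarrow> x \<in> integer_points" if "x \<in> affine hull D" for x
    using drop_root_integer_iff affine_hull_D that by blast
qed simp

lemma inner_drop_root: "c $ root = 0 \<Longrightarrow> c \<bullet> drop_root x = c \<bullet> x"
  by (simp add: drop_root_def inner_diff_right inner_axis)

lemma inner_P_bounds:
  assumes "(s, c) \<in> dual_lift" "p \<in> P"
  shows "s - 1 \<le> c \<bullet> p" "c \<bullet> p \<le> s"
proof -
  have "P \<subseteq> {p. c \<bullet> p \<ge> s - 1} \<inter> {p. c \<bullet> p \<le> s}"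
    unfolding edge_polytope0_def
    by (intro hull_minimal convex_Int convex_halfspace_ge convex_halfspace_le) (use assms(1) in \<open>auto simp: dual_lift_def\<close>)
  then show "s - 1 \<le> c \<bullet> p" "c \<bullet> p \<le> s" using assms(2) by auto
qed

text \<open>Being at most 1 on the difference body means that the maximum and the minimum of
  \<open>c\<close> on \<open>P\<close> differ by at most 1; the maximum serves as the height
  \<open>s\<close>.\<close>

lemma dual_D: "{x \<in> span root_basis. \<forall>y\<in>drop_root ` D. x \<bullet> y \<le> 1} = snd ` dual_lift"
proof (intro set_eqI iffI)
  fix c assume c: "c \<in> {x \<in> span root_basis. \<forall>y\<in>drop_root ` D. x \<bullet> y \<le> 1}"
  then have root0: "c $ root = 0" by (simp add: span_root_basis)
  have le1: "c \<bullet> p - c \<bullet> q \<le> 1" if pq: "p \<in> P" "q \<in> P" for p q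
  proof -
    have "c \<bullet> drop_root (p - q) \<le> 1" using c D_I[OF pq] by blast
    then show ?thesis using inner_drop_root[OF root0] by (simp add: inner_diff_right)
  qed
  define V where "V = insert 0 (\<rho> ` E)"
  have V: "finite V" "V \<noteq> {}" "V \<subseteq> P" using zero_in_P edge_in_P by (auto simp: V_def)
  define s where "s = Max ((\<bullet>) c ` V)"
  have "s \<in> (\<bullet>) c ` V" unfolding s_def using V by (intro Max_in) auto
  then obtain p0 where p0: "p0 \<in> P" "s = c \<bullet> p0" using V by blast
  have ge: "c \<bullet> v \<le> s" if "v \<in> V" for v unfolding s_def using V that by (intro Max_ge) auto
  have "(s, c) \<in> dual_lift"
    unfolding dual_lift_def
  proof (clarify, intro conjI ballI)
    show "0 \<le> s" using ge[of 0] by (simp add: V_def)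
    show "s \<le> 1" using le1[OF p0(1) zero_in_P] p0(2) by simp
    show "c $ root = 0" by (rule root0)
    fix e assume e: "e \<in> E"
    show "s - 1 \<le> c \<bullet> \<rho> e" using le1[OF p0(1) edge_in_P[OF e]] p0(2) by simp
    show "c \<bullet> \<rho> e \<le> s" using ge e by (simp add: V_def)
  qed
  then show "c \<in> snd ` dual_lift" by force
next
  fix c assume "c \<in> snd ` dual_lift"
  then obtain s where sc: "(s, c) \<in> dual_lift" by force
  then have root0: "c $ root = 0" by (simp add: dual_lift_def)
  have "c \<bullet> drop_root y \<le> 1" if y: "y \<in> D" for y
  proof -
    obtain p q where pq: "p \<in> P" "q \<in> P" "y = p - q" using y by (rule D_E)
    then show ?thesis
      using inner_P_bounds[OF sc pq(1)] inner_P_bounds[OF sc pq(2)]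
      by (simp add: inner_drop_root[OF root0] inner_diff_right)
  qed
  then show "c \<in> {x \<in> span root_basis. \<forall>y\<in>drop_root ` D. x \<bullet> y \<le> 1}" using root0 by (auto simp: span_root_basis)
qed

lemma convex_D: "convex D"
  using lattice_D by (rule lattice_polytope_convex)

lemma reflexive_in_D: "reflexive_in root_basis (drop_root ` D)"
  unfolding reflexive_in_def
proof (intro conjI)
  show "root_basis \<subseteq> Basis" by (rule root_basis_subset)
  show "lattice_polytope (drop_root ` D)"
    by (rule lattice_polytope_linear_image[OF lattice_D linear_drop_root drop_root_integer])
  have "0 \<in> D" using D_I[OF zero_in_P zero_in_P] by simp
  then have 0: "0 \<in> drop_root ` D" using linear_0[OF linear_drop_root] by (metis image_eqI)
  show "affine hull drop_root ` D = span root_basis"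
  proof -
    have "span (drop_root ` D) = span root_basis"
    proof
      have "drop_root ` D \<subseteq> span root_basis" by (auto simp: span_root_basis drop_root_nth)
      then show "span (drop_root ` D) \<subseteq> span root_basis" by (intro span_minimal) auto
      have "drop_root ` \<rho> ` E \<subseteq> drop_root ` D" using D_I[OF edge_in_P zero_in_P] by auto
      then show "span root_basis \<subseteq> span (drop_root ` D)" unfolding span_drop_root[symmetric] by (rule span_mono)
    qed
    then show ?thesis using affine_hull_span_0[of "drop_root ` D"] hull_inc[OF 0, of affine] by simp
  qed
  show "0 \<in> rel_interior (drop_root ` D)"
  proof (rule zero_in_rel_interior_symmetric)
    show "convex (drop_root ` D)" by (rule convex_linear_image[OF linear_drop_root convex_D])
    show "drop_root ` D \<noteq> {}" using 0 by blast
    have "- drop_root y \<in> drop_root ` D" if y: "y \<in> D" for y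
    proof -
      obtain p q where "p \<in> P" "q \<in> P" "y = p - q" using y by (rule D_E)
      then have "- y \<in> D" using D_I[of q p] by simp
      then show ?thesis using linear_neg[OF linear_drop_root, of y] by (metis image_eqI)
    qed
    then show "uminus ` drop_root ` D = drop_root ` D" by (intro uminus_image_eqI) blast
  qed
  show "lattice_polytope {x \<in> span root_basis. \<forall>y\<in>drop_root ` D. x \<bullet> y \<le> 1}"
    unfolding dual_D by (rule lattice_polytope_linear_image[OF lattice_polytope_dual_lift linear_snd]) auto
qed

lemma reflexive_D: "reflexive D"
  unfolding reflexive_def unimodularly_equivalent_def
  using lattice_D reflexive_in_D unimodular_drop_root by blast

lemma nef_partition_D: "nef_partition D [P, uminus ` P]"
  unfolding nef_partition_def
proof (intro conjI exI)
  show "D = sum_list [P, uminus ` P]" by simp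
  show "\<forall>Q\<in>set [P, uminus ` P]. lattice_polytope Q \<and> 0 \<in> Q"
    using lattice_P lattice_uminus_P zero_in_P zero_in_uminus_P by simp
  show "linear drop_root" by (rule linear_drop_root)
  show "unimodular_map drop_root D (drop_root ` D)" by (rule unimodular_drop_root)
  have "drop_root ` D = drop_root ` P + drop_root ` uminus ` P"
    by (rule linear_image_set_plus[OF linear_drop_root])
  moreover have "0 \<in> drop_root ` P" "0 \<in> drop_root ` uminus ` P"
    using zero_in_P zero_in_uminus_P linear_0[OF linear_drop_root] by (metis image_eqI)+
  moreover have "lattice_polytope (drop_root ` P)" "lattice_polytope (drop_root ` uminus ` P)"
    using lattice_polytope_linear_image[OF _ linear_drop_root drop_root_integer] lattice_P lattice_uminus_P by blast+
  ultimately show "nef_partition_in root_basis (drop_root ` D) (map ((`) drop_root) [P, uminus ` P])"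
    unfolding nef_partition_in_def using reflexive_in_D by simp
qed

section \<open>The doubled Cayley sum, centred at the origin\<close>

definition center :: "real \<times> (real ^ 'a) \<Rightarrow> real \<times> (real ^ 'a)" where
  "center z = (-1, 0) + (fst z, drop_root (snd z))"

abbreviation "C2 \<equiv> (\<lambda>z. real 2 *\<^sub>R z) ` C"

definition cayley_basis :: "(real \<times> (real ^ 'a)) set" where "cayley_basis = insert (1, 0) (Pair 0 ` root_basis)"

lemma linear_center: "linear (\<lambda>z. (fst z, drop_root (snd z)))"
  by (intro linearI) (simp_all add: linear_add[OF linear_drop_root] linear_scale[OF linear_drop_root])

lemma lattice_C2: "lattice_polytope C2"
  by (rule lattice_polytope_linear_image[OF lattice_C linear_scaleR integer_points_scale])

lemma affine_hull_C2: "affine hull C2 \<subseteq> UNIV \<times> balanced"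
proof (rule hull_minimal)
  have "C \<subseteq> UNIV \<times> balanced"
    by (intro C_subset convex_Times convex_UNIV affine_imp_convex affine_balanced)
      (auto simp: balanced_def inner_diff_left)
  then show "C2 \<subseteq> UNIV \<times> balanced" by (auto simp: balanced_def)
  show "affine (UNIV \<times> balanced :: (real \<times> (real ^ 'a)) set)"
    using affine_balanced unfolding affine_def by auto
qed

text \<open>The translation by \<open>(-1, 0)\<close> preserves the lattice and moves the centre
  \<open>(1, 0)\<close> of \<open>C2\<close> to the origin.\<close>

lemma unimodular_center: "unimodular_map center C2 (center ` C2)"
proof (rule unimodular_mapI[OF linear_center, where c = "(-1, 0)"])
  show "center = (\<lambda>z. (-1, 0) + (fst z, drop_root (snd z)))" by (auto simp: center_def)
  show "inj_on center (affine hull C2)"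
  proof (rule inj_onI)
    fix y z assume "y \<in> affine hull C2" "z \<in> affine hull C2" and eq: "center y = center z"
    then have b: "snd y \<in> balanced" "snd z \<in> balanced" using affine_hull_C2 by auto
    have "fst y = fst z" "drop_root (snd y) = drop_root (snd z)" using eq by (auto simp: center_def)
    then show "y = z" using drop_root_inj[OF b] by (simp add: prod_eq_iff)
  qed
  fix z assume "z \<in> affine hull C2"
  then have b: "snd z \<in> balanced" using affine_hull_C2 by auto
  have "fst z - 1 \<in> \<int> \<longleftrightarrow> fst z \<in> \<int>"
    using Ints_add[of "fst z - 1" 1] Ints_diff[of "fst z" 1] by auto
  then show "center z \<in> integer_points \<longleftrightarrow> z \<in> integer_points"
    using drop_root_integer_iff[OF b] by (cases z) (simp add: center_def)
qed

lemma span_cayley_basis: "span cayley_basis = UNIV \<times> {x. x $ root = 0}"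
proof
  have "subspace (UNIV \<times> {x. x $ root = 0} :: (real \<times> (real ^ 'a)) set)" by (auto simp: subspace_def zero_prod_def)
  moreover have "cayley_basis \<subseteq> UNIV \<times> {x. x $ root = 0}" by (auto simp: cayley_basis_def root_basis_def axis_def)
  ultimately show "span cayley_basis \<subseteq> UNIV \<times> {x. x $ root = 0}" by (intro span_minimal)
  show "UNIV \<times> {x. x $ root = 0} \<subseteq> span cayley_basis"
  proof clarify
    fix t and x :: "real ^ 'a" assume "x $ root = 0"
    then have "x \<in> span root_basis" by (simp add: span_root_basis)
    then have "(0, x) \<in> Pair (0::real) ` span root_basis" by blast
    also have "Pair (0::real) ` span root_basis = span (Pair 0 ` root_basis)"
      by (rule span_linear_image[symmetric]) (intro linearI; simp)
    also have "\<dots> \<subseteq> span cayley_basis" by (rule span_mono) (auto simp: cayley_basis_def)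
    finally have "t *\<^sub>R (1, 0) + (0, x) \<in> span cayley_basis"
      by (intro span_add span_scale) (auto simp: cayley_basis_def intro: span_base)
    then show "(t, x) \<in> span cayley_basis" by simp
  qed
qed

lemma center_C2_iff: "z \<in> center ` C2 \<longleftrightarrow> (\<exists>t x. (t, x) \<in> C \<and> z = (2 * t - 1, 2 *\<^sub>R drop_root x))"
  by (force simp: center_def linear_scale[OF linear_drop_root])

text \<open>Testing \<open>(t, c)\<close> at the four kinds of generating points gives the
  inequalities of \<open>dual_lift\<close> for \<open>s = (1 - t) / 2\<close>. The inverse
  substitution \<open>t = 1 - 2 * s\<close> is integral, which is what makes the polar a lattice
  polytope.\<close>

lemma dual_C2: "{z \<in> span cayley_basis. \<forall>y\<in>center ` C2. z \<bullet> y \<le> 1} = (\<lambda>z. (1, 0) + (- 2 * fst z, snd z)) ` dual_lift"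
proof (intro set_eqI iffI)
  fix z assume z: "z \<in> {z \<in> span cayley_basis. \<forall>y\<in>center ` C2. z \<bullet> y \<le> 1}"
  obtain t c where tc: "z = (t, c)" by fastforce
  have root0: "c $ root = 0" using z by (simp add: tc span_cayley_basis)
  have le: "t * (2 * u - 1) + 2 * (c \<bullet> x) \<le> 1" if "(u, x) \<in> C" for u x
  proof -
    have "z \<bullet> (2 * u - 1, 2 *\<^sub>R drop_root x) \<le> 1" using z that center_C2_iff by blast
    then show ?thesis by (simp add: tc inner_drop_root[OF root0])
  qed
  have "((1 - t) / 2, c) \<in> dual_lift"
    unfolding dual_lift_def
  proof (clarify, intro conjI ballI)
    show "0 \<le> (1 - t) / 2" "(1 - t) / 2 \<le> 1" using le[OF C_vertices(1)] le[OF C_vertices(2)] by simp_all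
    show "c $ root = 0" by (rule root0)
    fix e assume e: "e \<in> E"
    show "(1 - t) / 2 - 1 \<le> c \<bullet> \<rho> e" "c \<bullet> \<rho> e \<le> (1 - t) / 2"
      using le[OF C_vertices(3)[OF e]] le[OF C_vertices(4)[OF e]] by (simp_all add: field_simps)
  qed
  then show "z \<in> (\<lambda>z. (1, 0) + (- 2 * fst z, snd z)) ` dual_lift"
    by (rule rev_image_eqI) (simp add: tc field_simps)
next
  fix z assume "z \<in> (\<lambda>z. (1, 0) + (- 2 * fst z, snd z)) ` dual_lift"
  then obtain s c where sc: "(s, c) \<in> dual_lift" "z = (1 - 2 * s, c)" by force
  then have root0: "c $ root = 0" by (simp add: dual_lift_def)
  \<comment> \<open>With the translation moved to the right-hand side, the polar inequality is
    linear on \<open>C\<close> and needs checking at the generating points only.\<close>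
  have "C \<subseteq> {y. (2 * (1 - 2 * s), 2 *\<^sub>R c) \<bullet> y \<le> 1 + (1 - 2 * s)}"
    using sc(1) by (intro C_subset convex_halfspace_le) (force simp: dual_lift_def)+
  then have "2 * (1 - 2 * s) * u + 2 * (c \<bullet> x) \<le> 1 + (1 - 2 * s)" if "(u, x) \<in> C" for u x using that by auto
  then have "z \<bullet> y \<le> 1" if "y \<in> center ` C2" for y
    using that unfolding center_C2_iff by (force simp: sc(2) inner_drop_root[OF root0] algebra_simps)
  then show "z \<in> {z \<in> span cayley_basis. \<forall>y\<in>center ` C2. z \<bullet> y \<le> 1}" using root0 by (simp add: span_cayley_basis sc(2))
qed

text \<open>The point reflection in \<open>(1/2, 0)\<close> permutes the generating points.\<close>

lemma C_symmetric:
  assumes "(t, x) \<in> C"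
  shows "(1 - t, - x) \<in> C"
proof -
  have "C \<subseteq> {z. (1, 0) + (- z) \<in> C}"
  proof (rule C_subset)
    have "{z. (1, 0) + (- z) \<in> C} = (+) (1, 0) ` uminus ` C" by (force simp: image_iff)
    then show "convex {z. (1, 0) + (- z) \<in> C}"
      using convex_translation[OF convex_negations[OF lattice_polytope_convex[OF lattice_C]]] by simp
  qed (use C_vertices in \<open>auto simp: zero_prod_def\<close>)
  then show ?thesis using assms by auto
qed

lemma reflexive_in_C2: "reflexive_in cayley_basis (center ` C2)"
  unfolding reflexive_in_def
proof (intro conjI)
  show "cayley_basis \<subseteq> Basis" using root_basis_subset by (auto simp: cayley_basis_def Basis_prod_def)
  have center_image: "center ` C2 = (\<lambda>z. (-1, 0) + (fst z, drop_root (snd z))) ` C2"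
    by (simp add: center_def[abs_def])
  show lat: "lattice_polytope (center ` C2)"
    unfolding center_image by (rule lattice_polytope_affine_image[OF lattice_C2 linear_center]) (auto simp: drop_root_integer)
  have half: "(1/2, 0) \<in> C"
    using convexD[OF lattice_polytope_convex[OF lattice_C] C_vertices(1,2), of "1/2" "1/2"] by simp
  have d0: "drop_root 0 = 0" using linear_0[OF linear_drop_root] .
  have 0: "0 \<in> center ` C2" unfolding center_C2_iff using half d0 by (force simp: zero_prod_def)
  have 1: "(1, 0) \<in> center ` C2" unfolding center_C2_iff using C_vertices(1) d0 by force
  have 2: "(1, 2 *\<^sub>R drop_root (\<rho> e)) \<in> center ` C2" if "e \<in> E" for e
    unfolding center_C2_iff using C_vertices(3)[OF that] by force
  show "affine hull center ` C2 = span cayley_basis"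
  proof -
    have "span (center ` C2) = span cayley_basis"
    proof
      have "center ` C2 \<subseteq> span cayley_basis" by (auto simp: span_cayley_basis center_def drop_root_nth)
      then show "span (center ` C2) \<subseteq> span cayley_basis" by (intro span_minimal) auto
      \<comment> \<open>Subtracting the image \<open>(1, 0)\<close> of an end of the central segment
        isolates the edge directions at height 0.\<close>
      have edges: "(0, drop_root (\<rho> e)) \<in> span (center ` C2)" if "e \<in> E" for e
      proof -
        have "(1/2) *\<^sub>R ((1, 2 *\<^sub>R drop_root (\<rho> e)) - (1, 0)) \<in> span (center ` C2)"
          using 1 2[OF that] by (intro span_scale span_diff) (auto intro: span_base)
        then show ?thesis by simp
      qed
      have lin: "linear (Pair (0::real) :: real ^ 'a \<Rightarrow> _)" by (intro linearI) simp_all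
      have "Pair 0 ` drop_root ` \<rho> ` E \<subseteq> span (center ` C2)" using edges by blast
      then have "span (Pair 0 ` drop_root ` \<rho> ` E) \<subseteq> span (center ` C2)" by (intro span_minimal) auto
      then have "Pair 0 ` span root_basis \<subseteq> span (center ` C2)"
        unfolding span_drop_root[symmetric] span_linear_image[OF lin] .
      then have "cayley_basis \<subseteq> span (center ` C2)" unfolding cayley_basis_def using 1 by (auto intro: span_base)
      then show "span cayley_basis \<subseteq> span (center ` C2)" by (intro span_minimal) auto
    qed
    then show ?thesis using affine_hull_span_0[of "center ` C2"] hull_inc[OF 0, of affine] by simp
  qed
  show "0 \<in> rel_interior (center ` C2)"
  proof (rule zero_in_rel_interior_symmetric)
    show "convex (center ` C2)" using lat by (rule lattice_polytope_convex)
    show "center ` C2 \<noteq> {}" using 0 by blast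
    have "- z \<in> center ` C2" if "z \<in> center ` C2" for z
    proof -
      obtain t x where tx: "(t, x) \<in> C" "z = (2 * t - 1, 2 *\<^sub>R drop_root x)" using \<open>z \<in> center ` C2\<close> center_C2_iff by blast
      have "- z = (2 * (1 - t) - 1, 2 *\<^sub>R drop_root (- x))" by (simp add: tx(2) linear_neg[OF linear_drop_root])
      then show ?thesis using C_symmetric[OF tx(1)] center_C2_iff by blast
    qed
    then show "uminus ` center ` C2 = center ` C2" by (rule uminus_image_eqI)
  qed
  show "lattice_polytope {z \<in> span cayley_basis. \<forall>y\<in>center ` C2. z \<bullet> y \<le> 1}"
    unfolding dual_C2
  proof (rule lattice_polytope_affine_image[OF lattice_polytope_dual_lift])
    show "linear (\<lambda>z :: real \<times> (real ^ 'a). (- 2 * fst z, snd z))" by (intro linearI) (simp_all add: algebra_simps)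
    show "(1, 0) + (- 2 * fst z, snd z) \<in> integer_points" if "z \<in> integer_points" for z :: "real \<times> (real ^ 'a)"
      using that by (cases z) auto
  qed
qed

lemma gorenstein_C: "gorenstein_of_index 2 C"
  unfolding gorenstein_of_index_def reflexive_def unimodularly_equivalent_def
  using lattice_C lattice_C2 reflexive_in_C2 unimodular_center by auto

end

theorem theorem3p6:
  fixes E :: "'d::finite set set"
  assumes "simple_graph E" and "connected_graph E" and "bipartite_graph E" and "E \<noteq> {}"
  shows "(gorenstein_of_index 2 (cayley_sum (edge_polytope0 E) (uminus ` edge_polytope0 E)) \<and>
          has_regular_unimodular_triangulation
            (cayley_sum (edge_polytope0 E) (uminus ` edge_polytope0 E))) \<and>
         (reflexive (edge_polytope0 E + uminus ` edge_polytope0 E) \<and>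
          has_regular_unimodular_triangulation (edge_polytope0 E + uminus ` edge_polytope0 E) \<and>
          nef_partition (edge_polytope0 E + uminus ` edge_polytope0 E)
            [edge_polytope0 E, uminus ` edge_polytope0 E]) \<and>
         (edge_polytope0 E \<inter> integer_points) + (uminus ` edge_polytope0 E \<inter> integer_points)
           = (edge_polytope0 E + uminus ` edge_polytope0 E) \<inter> integer_points \<and>
         hstar (cayley_sum (edge_polytope0 E) (uminus ` edge_polytope0 E))
           = (1 + fps_X) * hstar (cayley_sum (edge_polytope E) (uminus ` edge_polytope E))"
proof -
  obtain U W where UW: "U \<inter> W = {}" "U \<union> W = UNIV" "\<forall>e\<in>E. \<exists>i\<in>U. \<exists>j\<in>W. e = {i, j}"
    using assms(3) unfolding bipartite_graph_def by blast
  obtain root where root: "root \<in> U" using UW(3) assms(4) by blast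
  have "W = - U" using UW(1,2) by blast
  then interpret connected_bipartite E U root
    using UW(3) assms(2,4) root by unfold_locales auto
  \<comment> \<open>This one weight triangulates the Cayley sum, yields the integer decompositions
    and induces the weight on the Minkowski sum.\<close>
  obtain w where w: "unimodular_weight w (C \<inter> integer_points)" using ex_unimodular_weight_C by blast
  obtain w' where w': "unimodular_weight w' (D \<inter> integer_points)"
    using cayley_weight_minkowski_sum[OF lattice_P lattice_uminus_P w] by blast
  show ?thesis
    using gorenstein_C unimodular_weight_triangulation[OF lattice_C w] reflexive_D
      unimodular_weight_triangulation[OF lattice_D w'] nef_partition_D
      cayley_weight_lattice_points_add[OF lattice_P lattice_uminus_P w] hstar_C by blast
qed

end
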